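(* Subset FVS in Chordal Graphs admits an algorithm with running time $\mathcal{O}(2^{k}(n+m))$, where $n$ and $m$ are the number of vertices and edges of the input graph $G$, respectively.
   Context: A graph is chordal if every cycle of length at least four has a chord (equivalently, every induced cycle is a triangle). For a set $T$ of vertices ("terminals"), a $T$-cycle is a cycle containing at least one vertex of $T$. Subset FVS in Chordal Graphs: given a chordal graph $G=(V,E)$, a set $T\subseteq V$ and an integer $k$, decide whether there exists $S\subseteq V$ with $|S|\leq k$ such that $G[V\setminus S]$ contains no $T$-cycle. *)

theory Defs
  imports Main
begin

section \<open>Graphs, chordality and Subset FVS\<close>

definition simple_graph :: "'a set \<Rightarrow> 'a set set \<Rightarrow> bool" where
  "simple_graph V E \<longleftrightarrow> finite V \<and> (\<forall>e\<in>E. e \<subseteq> V \<and> card e = 2)"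

text \<open>A cycle is the list of its vertices in cyclic order, without repeating the first vertex.\<close>

definition is_cycle :: "'a set set \<Rightarrow> 'a list \<Rightarrow> bool" where
  "is_cycle E C \<longleftrightarrow> 3 \<le> length C \<and> distinct C \<and>
     (\<forall>i<length C. {C ! i, C ! (Suc i mod length C)} \<in> E)"

definition has_chord :: "'a set set \<Rightarrow> 'a list \<Rightarrow> bool" where
  "has_chord E C \<longleftrightarrow> (\<exists>i<length C. \<exists>j<length C.
     i \<noteq> j \<and> j \<noteq> Suc i mod length C \<and> i \<noteq> Suc j mod length C \<and> {C ! i, C ! j} \<in> E)"

definition chordal_graph :: "'a set \<Rightarrow> 'a set set \<Rightarrow> bool" where
  "chordal_graph V E \<longleftrightarrow> simple_graph V E \<and>
     (\<forall>C. is_cycle E C \<and> 4 \<le> length C \<longrightarrow> has_chord E C)"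

definition is_T_cycle :: "'a set set \<Rightarrow> 'a set \<Rightarrow> 'a list \<Rightarrow> bool" where
  "is_T_cycle E T C \<longleftrightarrow> is_cycle E C \<and> set C \<inter> T \<noteq> {}"

definition induced_edges :: "'a set set \<Rightarrow> 'a set \<Rightarrow> 'a set set" where
  "induced_edges E W = {e \<in> E. e \<subseteq> W}"

definition subset_FVS :: "'a set \<Rightarrow> 'a set set \<Rightarrow> 'a set \<Rightarrow> nat \<Rightarrow> bool" where
  "subset_FVS V E T k \<longleftrightarrow>
     (\<exists>S\<subseteq>V. card S \<le> k \<and> (\<nexists>C. is_T_cycle (induced_edges E (V - S)) T C))"

section \<open>Random access machine programs with uniform cost\<close>

text \<open>
  The model of computation is the uniform-cost random access machine over the natural numbers,
  with addition and truncated subtraction as its only arithmetic. A state consists of the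
  registers and the memory; a program mentions only finitely many registers, while memory is
  addressed indirectly. Programs are given in structured form. Every node of the syntax tree
  that is evaluated or executed costs one time unit, so this agrees up to a constant factor with
  counting the instructions of an equivalent program with jumps.
\<close>

type_synonym state = "(nat \<Rightarrow> nat) \<times> (nat \<Rightarrow> nat)"

datatype aexp = Const nat | Reg nat | Mem aexp | Add aexp aexp | Sub aexp aexp

datatype bexp = Less aexp aexp | Neg bexp | Conj bexp bexp

datatype com =
    Skip
  | Assign nat aexp
  | Store aexp aexp
  | Seq com com
  | Cond bexp com com
  | While bexp com

fun aval :: "aexp \<Rightarrow> state \<Rightarrow> nat" where
  "aval (Const c) s = c"
| "aval (Reg r) s = fst s r"
| "aval (Mem a) s = snd s (aval a s)"
| "aval (Add a b) s = aval a s + aval b s"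
| "aval (Sub a b) s = aval a s - aval b s"

fun acost :: "aexp \<Rightarrow> nat" where
  "acost (Const c) = 1"
| "acost (Reg r) = 1"
| "acost (Mem a) = 1 + acost a"
| "acost (Add a b) = 1 + acost a + acost b"
| "acost (Sub a b) = 1 + acost a + acost b"

fun bval :: "bexp \<Rightarrow> state \<Rightarrow> bool" where
  "bval (Less a b) s \<longleftrightarrow> aval a s < aval b s"
| "bval (Neg b) s \<longleftrightarrow> \<not> bval b s"
| "bval (Conj b c) s \<longleftrightarrow> bval b s \<and> bval c s"

fun bcost :: "bexp \<Rightarrow> nat" where
  "bcost (Less a b) = 1 + acost a + acost b"
| "bcost (Neg b) = 1 + bcost b"
| "bcost (Conj b c) = 1 + bcost b + bcost c"

text \<open>\<open>exec c s t s'\<close>: started in \<open>s\<close>, program \<open>c\<close> halts in \<open>s'\<close> after exactly \<open>t\<close> time units.\<close>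

inductive exec :: "com \<Rightarrow> state \<Rightarrow> nat \<Rightarrow> state \<Rightarrow> bool" where
  Skip: "exec Skip s 1 s"
| Assign: "exec (Assign r a) s (1 + acost a) ((fst s)(r := aval a s), snd s)"
| Store: "exec (Store a b) s (1 + acost a + acost b) (fst s, (snd s)(aval a s := aval b s))"
| Seq: "exec c1 s1 t1 s2 \<Longrightarrow> exec c2 s2 t2 s3 \<Longrightarrow> exec (Seq c1 c2) s1 (1 + t1 + t2) s3"
| CondTrue: "bval b s \<Longrightarrow> exec c1 s t s' \<Longrightarrow> exec (Cond b c1 c2) s (1 + bcost b + t) s'"
| CondFalse: "\<not> bval b s \<Longrightarrow> exec c2 s t s' \<Longrightarrow> exec (Cond b c1 c2) s (1 + bcost b + t) s'"
| WhileFalse: "\<not> bval b s \<Longrightarrow> exec (While b c) s (1 + bcost b) s"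
| WhileTrue: "bval b s1 \<Longrightarrow> exec c s1 t1 s2 \<Longrightarrow> exec (While b c) s2 t2 s3 \<Longrightarrow>
    exec (While b c) s1 (1 + bcost b + t1 + t2) s3"

inductive_cases SkipE: "exec Skip s t s'"
  and AssignE: "exec (Assign r a) s t s'"
  and StoreE: "exec (Store a b) s t s'"
  and SeqE: "exec (Seq c1 c2) s t s'"
  and CondE: "exec (Cond b c1 c2) s t s'"
  and WhileE: "exec (While b c) s t s'"

lemma exec_deterministic:
  "exec c s t s' \<Longrightarrow> exec c s u s'' \<Longrightarrow> t = u \<and> s' = s''"
proof (induction arbitrary: u s'' rule: exec.induct)
  case (Skip s)
  from Skip.prems show ?case by (rule SkipE) simp
next
  case (Assign r a s)
  from Assign.prems show ?case by (rule AssignE) simp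
next
  case (Store a b s)
  from Store.prems show ?case by (rule StoreE) simp
next
  case (Seq c1 s1 t1 s2 c2 t2 s3)
  from Seq.prems obtain t1' s2' t2' where
    u: "u = Suc (t1' + t2')" and 1: "exec c1 s1 t1' s2'" and 2: "exec c2 s2' t2' s''"
    by (rule SeqE)
  from Seq.IH(1)[OF 1] Seq.IH(2)[of t2' s''] u 2 show ?case by simp
next
  case (CondTrue b s c1 t s' c2)
  from CondTrue.prems show ?case
    by (rule CondE) (use CondTrue.hyps in \<open>auto dest!: CondTrue.IH\<close>)
next
  case (CondFalse b s c2 t s' c1)
  from CondFalse.prems show ?case
    by (rule CondE) (use CondFalse.hyps in \<open>auto dest!: CondFalse.IH\<close>)
next
  case (WhileFalse b s c)
  from WhileFalse.prems show ?case
    by (rule WhileE) (use WhileFalse.hyps in auto)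
next
  case (WhileTrue b s1 c t1 s2 t2 s3)
  from WhileTrue.prems obtain t1' s2' t2' where
    u: "u = Suc (bcost b + t1' + t2')" and 1: "exec c s1 t1' s2'" and 2: "exec (While b c) s2' t2' s''"
    by (rule WhileE) (use WhileTrue.hyps in simp_all)
  from WhileTrue.IH(1)[OF 1] WhileTrue.IH(2)[of t2' s''] u 2 show ?case by simp
qed

section \<open>Input format\<close>

text \<open>The vertices of an input graph are \<open>0, \<dots>, n - 1\<close>. The adjacency lists may be in any order.\<close>

definition adjacency_lists :: "nat \<Rightarrow> nat set set \<Rightarrow> nat list list \<Rightarrow> bool" where
  "adjacency_lists n E adj \<longleftrightarrow> length adj = n \<and>
     (\<forall>v<n. distinct (adj ! v) \<and> set (adj ! v) = {u. {v, u} \<in> E})"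

definition encode_instance ::
    "nat \<Rightarrow> nat set set \<Rightarrow> nat set \<Rightarrow> nat \<Rightarrow> nat list list \<Rightarrow> nat list" where
  "encode_instance n E T k adj =
     [n, card E, k] @ map (\<lambda>v. if v \<in> T then 1 else 0) [0..<n] @
     concat (map (\<lambda>xs. length xs # xs) adj)"

definition initial_state :: "nat list \<Rightarrow> state" where
  "initial_state xs = (\<lambda>r. 0, \<lambda>a. if a < length xs then xs ! a else 0)"

definition accepts :: "state \<Rightarrow> bool" where
  "accepts s \<longleftrightarrow> fst s 0 \<noteq> 0"

end

theory Submission
  imports Defs
begin

text \<open>
  In a chordal graph every T-cycle can be shortened to a T-triangle, so a solution is a set of vertices
  that hits all T-triangles. Fix a perfect elimination order, found by maximum cardinality search, and
  let \<open>up v\<close> be the clique of later neighbours of \<open>v\<close>. A branching family is a list of vertex sets, one of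
  which is contained in some optimal solution, such that the sum of \<open>2 ^ (- card X)\<close> over its members \<open>X\<close>
  is at most 1. Then the sum of \<open>2 ^ (k + 1) - 1\<close> over the open subproblems, \<open>k\<close> being their budgets,
  decreases with every subproblem that is expanded, so fewer than \<open>2 ^ (k + 1)\<close> of them occur, and it
  remains to find a branching family in linear time.

  Scan the vertices in elimination order. If \<open>x\<close> is the first vertex of a T-triangle and \<open>up x\<close> contains a
  terminal, or if \<open>x\<close> is a terminal with two later neighbours, then \<open>{t}\<close> and \<open>up x - {t}\<close> do, because \<open>x\<close>
  itself can be exchanged for \<open>t\<close>. In the remaining case \<open>x\<close> is a star, a terminal whose later
  neighbours are at least three non-terminals, and is passed over. When the scan reaches a vertex in
  \<open>up v\<close> for a single star \<open>v\<close>, that vertex can be exchanged for any survivor of \<open>up v\<close>, and \<open>{v}\<close> and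
  the rest of \<open>up v\<close> form a branching family. For several stars, branching on the vertex itself suffices
  except when the stars have degree three and meet nowhere else, where the sum above is 17/16. Such a
  vertex \<open>w\<close> is passed over as well: the second vertex \<open>x\<close> of one of its stars sees \<open>w\<close> together with
  two stars, and this larger configuration admits a branching family whether or not \<open>x\<close> has further stars.
\<close>

section \<open>Branching on T-triangles\<close>

text \<open>Two singletons already exhaust the sum 1, so any further alternative has to be paid for
  by larger sets. Two stars \<open>v\<close>, \<open>v'\<close> of degree three that meet only in
  \<open>w\<close> leave the alternatives \<open>{w}\<close>, \<open>{v, v'}\<close>, one star with
  the two other neighbours of the other star (twice), and the four other neighbours: 1/2 + 1/4 + 1/8
  + 1/8 + 1/16 = 17/16. At the second vertex of \<open>v\<close> an additional exchange becomes
  available and the sum drops to at most 1. Postponing is safe: a star has at least three later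
  neighbours, so its second one is always reached, and there the scan always branches. Linear time
  per subproblem rests on two facts. Deleting vertices preserves an elimination order, so the order
  is computed once and a subproblem is only a set of deletion flags with a budget. And the expensive
  step of a scan, writing a branching family, happens at most once, since it ends the scan; passing
  over a vertex costs no more than reading its adjacency list.\<close>

lemma card_exchange_le:
  assumes "finite S" "x \<in> S"
  shows "card (insert y (S - {x})) \<le> card S"
  using assms by (metis card_Suc_Diff1 card_insert_le_m1 diff_Suc_1 finite_Diff le_refl zero_less_Suc)

text \<open>\<open>pos\<close> is merely injective on \<open>V\<close>, not a numbering of it, so
  that the assumptions pass to every subset of \<open>V\<close>. A subproblem can therefore keep the
  order of the whole graph.\<close>

locale elimination_order =
  fixes V :: "'a set" and adj :: "'a \<Rightarrow> 'a \<Rightarrow> bool" and pos :: "'a \<Rightarrow> nat" and T :: "'a set"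
  assumes finite_V: "finite V"
    and adj_sym: "adj a b \<Longrightarrow> adj b a"
    and adj_irrefl: "\<not> adj a a"
    and inj_pos: "inj_on pos V"
    and later_clique: "\<lbrakk>a \<in> V; b \<in> V; c \<in> V; adj a b; adj a c; pos a < pos b; pos a < pos c; b \<noteq> c\<rbrakk> \<Longrightarrow> adj b c"
begin

definition up :: "'a \<Rightarrow> 'a set" where
  "up v = {u \<in> V. adj v u \<and> pos v < pos u}"

text \<open>A triangle is listed with its first vertex \<open>v\<close>.\<close>

definition T_triangle :: "'a \<Rightarrow> 'a \<Rightarrow> 'a \<Rightarrow> bool" where
  "T_triangle v a b \<longleftrightarrow> v \<in> V \<and> a \<in> up v \<and> b \<in> up v \<and> a \<noteq> b \<and> (v \<in> T \<or> a \<in> T \<or> b \<in> T)"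

definition hits :: "'a set \<Rightarrow> bool" where
  "hits S \<longleftrightarrow> S \<subseteq> V \<and> (\<forall>v a b. T_triangle v a b \<longrightarrow> v \<in> S \<or> a \<in> S \<or> b \<in> S)"

definition solvable :: "nat \<Rightarrow> bool" where
  "solvable k \<longleftrightarrow> (\<exists>S. hits S \<and> card S \<le> k)"

lemma up_subset: "up v \<subseteq> V" by (auto simp: up_def)
lemma finite_up: "finite (up v)" using finite_subset[OF up_subset finite_V] .
lemma up_V: "a \<in> up v \<Longrightarrow> a \<in> V" by (auto simp: up_def)
lemma up_pos: "a \<in> up v \<Longrightarrow> pos v < pos a" by (auto simp: up_def)
lemma not_in_own_up: "v \<notin> up v" by (simp add: up_def)

lemma up_clique:
  assumes "v \<in> V" "a \<in> up v" "b \<in> up v" "pos a < pos b"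
  shows "b \<in> up a"
  using assms later_clique[of v a b] by (auto simp: up_def)

lemma up_linear: "a \<in> up v \<Longrightarrow> b \<in> up v \<Longrightarrow> a \<noteq> b \<Longrightarrow> pos a < pos b \<or> pos b < pos a"
  using inj_pos up_V by (metis inj_onD nat_neq_iff)

lemma hits_subset: "hits S \<Longrightarrow> S \<subseteq> V" by (simp add: hits_def)
lemma hits_finite: "hits S \<Longrightarrow> finite S" using finite_V finite_subset by (auto simp: hits_def)

text \<open>\<open>T_triangle\<close> wants the first vertex to be singled out; as
  \<open>pos\<close> is injective, one of the three vertices is strictly earliest and can play that
  part.\<close>

lemma hits_triangle:
  assumes "hits S" "a \<in> V" "b \<in> V" "c \<in> V" "adj a b" "adj b c" "adj a c" "a \<in> T \<or> b \<in> T \<or> c \<in> T"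
  shows "a \<in> S \<or> b \<in> S \<or> c \<in> S"
proof -
  have *: "x \<in> S \<or> y \<in> S \<or> z \<in> S"
    if "x \<in> V" "y \<in> V" "z \<in> V" "adj x y" "adj y z" "adj x z" "x \<in> T \<or> y \<in> T \<or> z \<in> T" "pos x < pos y" "pos x < pos z" for x y z
  proof -
    have "T_triangle x y z" using that adj_irrefl by (auto simp: T_triangle_def up_def)
    then show ?thesis using assms(1) by (auto simp: hits_def)
  qed
  have "a \<noteq> b" "b \<noteq> c" "a \<noteq> c" using assms adj_irrefl by auto
  then have "pos a \<noteq> pos b" "pos b \<noteq> pos c" "pos a \<noteq> pos c" using inj_pos assms by (auto simp: inj_on_def)
  then consider "pos a < pos b" "pos a < pos c" | "pos b < pos a" "pos b < pos c" | "pos c < pos a" "pos c < pos b" by linarith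
  then show ?thesis
    using *[of a b c] *[of b a c] *[of c a b] assms adj_sym[of a b] adj_sym[of b c] adj_sym[of a c] by cases auto
qed

lemma hits_up:
  assumes "hits S" "v \<in> V" "a \<in> up v" "b \<in> up v" "a \<noteq> b" "v \<in> T \<or> a \<in> T \<or> b \<in> T"
  shows "v \<in> S \<or> a \<in> S \<or> b \<in> S"
  using assms by (auto simp: hits_def T_triangle_def)

text \<open>\<open>up v\<close> is a clique, so three of its vertices with a terminal among them
  form a T-triangle that avoids \<open>v\<close>. Exchanges use this for the triangles whose first
  vertex leaves the solution.\<close>

lemma hits_three_up:
  assumes "hits S" "v \<in> V" "a \<in> up v" "b \<in> up v" "c \<in> up v" "a \<noteq> b" "b \<noteq> c" "a \<noteq> c" "a \<in> T \<or> b \<in> T \<or> c \<in> T"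
  shows "a \<in> S \<or> b \<in> S \<or> c \<in> S"
proof (rule hits_triangle[OF assms(1)])
  have "adj x y" if "x \<in> up v" "y \<in> up v" "x \<noteq> y" for x y
    using that assms(2) later_clique[of v x y] by (auto simp: up_def)
  then show "adj a b" "adj b c" "adj a c" using assms by auto
qed (use assms up_V in auto)

text \<open>Exchanges enter through \<open>S'\<close>, which may differ from \<open>S\<close>.
  Quantifying over all hitting sets, not just smallest ones, makes a covering family usable for
  every budget.\<close>

definition covering :: "'a set list \<Rightarrow> bool" where
  "covering F \<longleftrightarrow> (\<forall>S. hits S \<longrightarrow> (\<exists>S'. hits S' \<and> card S' \<le> card S \<and> (\<exists>X\<in>set F. X \<subseteq> S')))"

text \<open>Branching over a light family with measure \<open>k\<close> has branching number at most 2.\<close>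

definition light :: "'a set list \<Rightarrow> bool" where
  "light F \<longleftrightarrow> sum_list (map (\<lambda>X. 2 ^ (4 - min 4 (card X))) F) \<le> (16 :: nat)"

definition branching :: "'a set list \<Rightarrow> bool" where
  "branching F \<longleftrightarrow> covering F \<and> light F \<and> (\<forall>X\<in>set F. X \<subseteq> V \<and> 1 \<le> card X)"

text \<open>The weight in \<open>light\<close> is 2 ^ (- card X) scaled by 16; sets of more than
  four vertices count as four, which keeps it integral. Only lower bounds on the cardinalities in a
  family are known, hence these four estimates.\<close>

lemma card_weight:
  "1 \<le> c \<Longrightarrow> 2 ^ (4 - min 4 c) \<le> (8::nat)"
  "2 \<le> c \<Longrightarrow> 2 ^ (4 - min 4 c) \<le> (4::nat)"
  "3 \<le> c \<Longrightarrow> 2 ^ (4 - min 4 c) \<le> (2::nat)"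
  "4 \<le> c \<Longrightarrow> 2 ^ (4 - min 4 c) \<le> (1::nat)"
  using power_increasing[of "4 - min 4 c" 3 "2::nat"] power_increasing[of "4 - min 4 c" 2 "2::nat"]
    power_increasing[of "4 - min 4 c" 1 "2::nat"]
  by auto

subsection \<open>The left-to-right scan\<close>

definition star :: "'a \<Rightarrow> bool" where
  "star v \<longleftrightarrow> v \<in> V \<and> v \<in> T \<and> up v \<inter> T = {} \<and> 3 \<le> card (up v)"

definition inert :: "'a \<Rightarrow> bool" where
  "inert v \<longleftrightarrow> (\<forall>a b. \<not> T_triangle v a b)"

text \<open>Every T-triangle whose first vertex precedes position \<open>i\<close> thus starts at a
  star of \<open>L\<close>. This keeps the exchange of a vertex local.\<close>

definition scanned :: "nat \<Rightarrow> 'a set \<Rightarrow> bool" where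
  "scanned i L \<longleftrightarrow> (\<forall>v\<in>V. pos v < i \<longrightarrow> (if v \<in> L then star v else inert v)) \<and> (\<forall>v\<in>L. v \<in> V \<and> pos v < i)"

lemma scanned_star: "scanned i L \<Longrightarrow> v \<in> L \<Longrightarrow> star v"
  by (auto simp: scanned_def)

text \<open>Only T-triangles through \<open>x\<close> can be lost. Those starting at
  \<open>x\<close> are handled by \<open>own\<close>; the first vertex of any other precedes
  position \<open>i\<close>, is not inert and hence is a star of \<open>L\<close> with
  \<open>x\<close> among its later neighbours.\<close>

lemma hits_without:
  assumes sc: "scanned i L" and x: "x \<in> V" "pos x = i" and S: "hits S" and S': "S - {x} \<subseteq> S'" "S' \<subseteq> V"
    and stars: "\<And>v z. v \<in> L \<Longrightarrow> x \<in> up v \<Longrightarrow> z \<in> up v \<Longrightarrow> z \<noteq> x \<Longrightarrow> v \<in> S' \<or> z \<in> S'"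
    and own: "\<And>a b. T_triangle x a b \<Longrightarrow> a \<in> S' \<or> b \<in> S'"
  shows "hits S'"
  unfolding hits_def
proof (intro conjI allI impI)
  fix v a b assume t: "T_triangle v a b"
  show "v \<in> S' \<or> a \<in> S' \<or> b \<in> S'"
  proof (cases "x \<in> {v, a, b}")
    case False
    then show ?thesis using S S' t unfolding hits_def by blast
  next
    case True
    show ?thesis
    proof (cases "x = v")
      case True then show ?thesis using own t by auto
    next
      case False
      with True have xab: "x = a \<or> x = b" by auto
      have "v \<in> V" "pos v < i" using t xab x up_pos by (auto simp: T_triangle_def)
      then have "v \<in> L" using sc t by (auto simp: scanned_def inert_def split: if_splits)
      then show ?thesis using stars[of v a] stars[of v b] t xab by (auto simp: T_triangle_def)
    qed
  qed
qed (rule S')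

text \<open>\<open>v\<close> is a terminal, stars have no terminal later neighbours, and the other
  vertices before position \<open>i\<close> start no T-triangle. So \<open>v\<close> lies in
  T-triangles only as first vertex, and only pairs inside \<open>up v\<close> have to be
  checked.\<close>

lemma hits_without_star:
  assumes sc: "scanned i L" and v: "v \<in> L" and S: "hits S" and S': "S - {v} \<subseteq> S'" "S' \<subseteq> V"
    and own: "\<And>a b. a \<in> up v \<Longrightarrow> b \<in> up v \<Longrightarrow> a \<noteq> b \<Longrightarrow> a \<in> S' \<or> b \<in> S'"
  shows "hits S'"
  unfolding hits_def
proof (intro conjI allI impI)
  fix u a b assume t: "T_triangle u a b"
  show "u \<in> S' \<or> a \<in> S' \<or> b \<in> S'"
  proof (cases "v \<in> {u, a, b}")
    case False
    then show ?thesis using S S' t unfolding hits_def by blast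
  next
    case True
    show ?thesis
    proof (cases "v = u")
      case True then show ?thesis using own t by (auto simp: T_triangle_def)
    next
      case False
      with True have vab: "v = a \<or> v = b" by auto
      have "u \<in> V" "pos u < pos v" using t vab up_pos by (auto simp: T_triangle_def)
      moreover have "pos v < i" using sc v by (auto simp: scanned_def)
      ultimately have "u \<in> L" using sc t by (auto simp: scanned_def inert_def split: if_splits)
      then have "up u \<inter> T = {}" using scanned_star[OF sc] by (auto simp: star_def)
      moreover have "v \<in> T" using scanned_star[OF sc v] by (auto simp: star_def)
      ultimately show ?thesis using vab t by (auto simp: T_triangle_def)
    qed
  qed
qed (rule S')

section \<open>Branching families at the scanned vertex\<close>

lemma star_rest:
  assumes "hits S" "star v" "v \<notin> S" "y \<in> up v" "y \<notin> S"
  shows "up v - {y} \<subseteq> S"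
  using assms hits_up[OF assms(1), of v y] by (auto simp: star_def)

lemma card_star_rest: "star v \<Longrightarrow> y \<in> up v \<Longrightarrow> 2 \<le> card (up v - {y})"
  using finite_up[of v] by (auto simp: star_def card_Diff_singleton)

text \<open>Without a star at \<open>x\<close>, all T-triangles through \<open>x\<close> start at
  \<open>x\<close>, so a chosen \<open>x\<close> can be traded for \<open>t\<close>. If neither is
  chosen, the triangles on \<open>x\<close> and \<open>t\<close> force the rest of
  \<open>up x\<close>. The weights are at most 8 + 8.\<close>

lemma branching_simplicial:
  assumes sc: "scanned i L" and x: "x \<in> V" "pos x = i" and nostar: "\<And>v. v \<in> L \<Longrightarrow> x \<notin> up v"
    and t: "t \<in> up x" and d: "2 \<le> card (up x)" and cases: "t \<in> T \<or> (x \<in> T \<and> card (up x) = 2)"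
  shows "branching [{t}, up x - {t}]"
  unfolding branching_def
proof (intro conjI)
  have c: "1 \<le> card (up x - {t})" using t d finite_up[of x] by (simp add: card_Diff_singleton)
  then show "light [{t}, up x - {t}]" using card_weight(1)[of 1] card_weight(1)[OF c] by (simp add: light_def)
  show "\<forall>X\<in>set [{t}, up x - {t}]. X \<subseteq> V \<and> 1 \<le> card X" using t c up_subset[of x] up_V[OF t] by auto
  show "covering [{t}, up x - {t}]"
    unfolding covering_def
  proof (intro allI impI)
    fix S assume S: "hits S"
    show "\<exists>S'. hits S' \<and> card S' \<le> card S \<and> (\<exists>X\<in>set [{t}, up x - {t}]. X \<subseteq> S')"
    proof (cases "t \<in> S")
      case True
      then show ?thesis using S by auto
    next
      case t_notin: False
      show ?thesis
      proof (cases "x \<in> S")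
        case False
        have "up x - {t} \<subseteq> S" using hits_up[OF S x(1) t] cases False t_notin by auto
        then show ?thesis using S by auto
      next
        case True
        let ?S = "insert t (S - {x})"
        have "hits ?S"
        proof (rule hits_without[OF sc x S])
          show "S - {x} \<subseteq> ?S" "?S \<subseteq> V" using hits_subset[OF S] up_V[OF t] by auto
          fix a b assume ab: "T_triangle x a b"
          show "a \<in> ?S \<or> b \<in> ?S"
          proof (rule ccontr)
            assume n: "\<not> ?thesis"
            have ab': "a \<in> up x" "b \<in> up x" "a \<noteq> b" using ab by (auto simp: T_triangle_def)
            have ne: "a \<noteq> t" "b \<noteq> t" using n by auto
            \<comment> \<open>Three distinct later neighbours rule out the degree-two case, so
              \<open>t\<close> is a terminal and \<open>a\<close>, \<open>b\<close>,
              \<open>t\<close> form a T-triangle avoiding \<open>x\<close>.\<close>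
            have "card {a, b, t} \<le> card (up x)" using ab' t by (intro card_mono finite_up) auto
            then have "3 \<le> card (up x)" using ne ab' by auto
            then have "t \<in> T" using cases by auto
            then have "a \<in> S \<or> b \<in> S \<or> t \<in> S" using hits_three_up[OF S x(1) ab'(1,2) t] ab' ne by auto
            moreover have "a \<noteq> x" "b \<noteq> x" using ab' not_in_own_up by auto
            ultimately show False using n t_notin by auto
          qed
        qed (use nostar in auto)
        moreover have "card ?S \<le> card S" by (rule card_exchange_le[OF hits_finite[OF S] True])
        ultimately show ?thesis by (intro exI[of _ ?S]) auto
      qed
    qed
  qed
qed

text \<open>A plain case analysis without exchange. It is affordable because
  \<open>up v - {y}\<close> has at least three vertices: the weights are at most 8 + 4 + 2 +
  2.\<close>

lemma branching_big_star:
  assumes v: "star v" "y \<in> up v" "4 \<le> card (up v)" and v': "star v'" "y \<in> up v'" and ne: "v \<noteq> v'"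
  shows "branching [{y}, {v, v'}, {v} \<union> (up v' - {y}), up v - {y}]"
  unfolding branching_def
proof (intro conjI)
  have V: "v \<in> V" "v' \<in> V" "v \<in> T" "v' \<in> T" "up v' \<inter> T = {}" using v v' by (auto simp: star_def)
  have c2: "3 \<le> card ({v} \<union> (up v' - {y}))"
  proof -
    have "card ({v} \<union> (up v' - {y})) = card {v} + card (up v' - {y})"
      using finite_up V by (intro card_Un_disjoint) auto
    then show ?thesis using card_star_rest[OF v'] by simp
  qed
  have c: "2 \<le> card {v, v'}" "3 \<le> card (up v - {y})"
    using ne v finite_up[of v] by (auto simp: card_Diff_singleton)
  show "light [{y}, {v, v'}, {v} \<union> (up v' - {y}), up v - {y}]"
    using card_weight(1)[of 1] card_weight(2)[OF c(1)] card_weight(3)[OF c2] card_weight(3)[OF c(2)] by (simp add: light_def)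
  show "\<forall>X\<in>set [{y}, {v, v'}, {v} \<union> (up v' - {y}), up v - {y}]. X \<subseteq> V \<and> 1 \<le> card X"
    using V c c2 up_subset[of v] up_subset[of v'] up_V[OF v(2)] by auto
  show "covering [{y}, {v, v'}, {v} \<union> (up v' - {y}), up v - {y}]"
    unfolding covering_def
  proof (intro allI impI)
    fix S assume S: "hits S"
    show "\<exists>S'. hits S' \<and> card S' \<le> card S \<and> (\<exists>X\<in>set [{y}, {v, v'}, {v} \<union> (up v' - {y}), up v - {y}]. X \<subseteq> S')"
      using star_rest[OF S v(1) _ v(2)] star_rest[OF S v'(1) _ v'(2)] S by (intro exI[of _ S]) auto
  qed
qed

text \<open>If \<open>y\<close> and one of the stars are avoided, the rest of that star's later
  neighbours is chosen, including a vertex \<open>z\<close> shared with the other star. With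
  \<open>z\<close> chosen, the other star can be traded for its third later neighbour. So both mixed
  alternatives merge into the last set, and the weights are at most 8 + 4 + 4.\<close>

lemma branching_sharing_stars:
  assumes sc: "scanned i L" and v: "v \<in> L" "y \<in> up v" "card (up v) = 3"
    and v': "v' \<in> L" "y \<in> up v'" "card (up v') = 3" and ne: "v \<noteq> v'"
    and share: "card ((up v - {y}) \<union> (up v' - {y})) < 4"
  shows "branching [{y}, {v, v'}, (up v - {y}) \<union> (up v' - {y})]" (is "branching ?F")
  unfolding branching_def
proof (intro conjI)
  have st: "star v" "star v'" using scanned_star[OF sc] v v' by auto
  then have V: "v \<in> V" "v' \<in> V" "v \<in> T" "v' \<in> T" "up v' \<inter> T = {}" using v v' by (auto simp: star_def)
  have "card (up v - {y}) \<le> card ((up v - {y}) \<union> (up v' - {y}))" using finite_up by (intro card_mono) auto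
  then have c: "2 \<le> card {v, v'}" "2 \<le> card ((up v - {y}) \<union> (up v' - {y}))"
    using ne card_star_rest[OF st(1) v(2)] by auto
  show "light ?F"
    using card_weight(1)[of 1] card_weight(2)[OF c(1)] card_weight(2)[OF c(2)] by (simp add: light_def)
  show "\<forall>X\<in>set ?F. X \<subseteq> V \<and> 1 \<le> card X" using V c up_subset[of v] up_subset[of v'] up_V[OF v(2)] by auto
  have c2: "card (up v - {y}) = 2" "card (up v' - {y}) = 2" using v v' finite_up by (auto simp: card_Diff_singleton)
  obtain z where z: "z \<in> up v" "z \<in> up v'" "z \<noteq> y"
  proof (rule ccontr)
    assume "\<not> thesis"
    then have "(up v - {y}) \<inter> (up v' - {y}) = {}" using that by blast
    then have "card ((up v - {y}) \<union> (up v' - {y})) = 4" using c2 finite_up by (subst card_Un_disjoint) auto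
    then show False using share by simp
  qed
  have one: "\<exists>S'. hits S' \<and> card S' \<le> card S \<and> (up a - {y}) \<union> (up b - {y}) \<subseteq> S'"
    if S: "hits S" and a: "a \<in> L" "y \<in> up a" "a \<notin> S" and b: "b \<in> L" "y \<in> up b" "card (up b - {y}) = 2" "z \<in> up b"
      and y: "y \<notin> S" and z: "z \<in> up a" for S a b
  proof -
    have sa: "up a - {y} \<subseteq> S" using star_rest[OF S scanned_star[OF sc a(1)] a(3) a(2) y] .
    obtain w where w: "up b - {y} = {z, w}" "z \<noteq> w"
    proof -
      have "z \<in> up b - {y}" using b(4) \<open>z \<noteq> y\<close> by auto
      moreover obtain p q where "up b - {y} = {p, q}" "p \<noteq> q" using b(3) by (auto simp: card_2_iff)
      ultimately consider "z = p" "up b - {y} = {z, q}" "z \<noteq> q" | "z = q" "up b - {y} = {z, p}" "z \<noteq> p" by auto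
      then show ?thesis using that by cases
    qed
    show ?thesis
    proof (cases "b \<in> S")
      case False
      then have "up b - {y} \<subseteq> S" using star_rest[OF S scanned_star[OF sc b(1)] _ b(2) y] by auto
      then show ?thesis using sa S by auto
    next
      case True
      let ?S = "insert w (S - {b})"
      have bT: "b \<notin> up a" using scanned_star[OF sc a(1)] scanned_star[OF sc b(1)] by (auto simp: star_def)
      have "hits ?S"
      proof (rule hits_without_star[OF sc b(1) S])
        show "?S \<subseteq> V" using hits_subset[OF S] w up_V[of w b] by auto
        have zs: "z \<in> ?S" using sa z \<open>z \<noteq> y\<close> b(4) not_in_own_up[of b] by auto
        fix p q assume "p \<in> up b" "q \<in> up b" "p \<noteq> q"
        then have "p \<in> {y, z, w}" "q \<in> {y, z, w}" "p \<noteq> q" using w by auto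
        then show "p \<in> ?S \<or> q \<in> ?S" using zs by auto
      qed auto
      moreover have "card ?S \<le> card S" by (rule card_exchange_le[OF hits_finite[OF S] True])
      moreover have "(up a - {y}) \<union> (up b - {y}) \<subseteq> ?S"
        using sa w z \<open>z \<noteq> y\<close> bT not_in_own_up[of b] b(4) by auto
      ultimately show ?thesis by blast
    qed
  qed
  show "covering ?F"
    unfolding covering_def
  proof (intro allI impI)
    fix S assume S: "hits S"
    consider "y \<in> S" | "v \<in> S" "v' \<in> S" | "y \<notin> S" "v \<notin> S" | "y \<notin> S" "v' \<notin> S" by blast
    then show "\<exists>S'. hits S' \<and> card S' \<le> card S \<and> (\<exists>X\<in>set ?F. X \<subseteq> S')"
    proof cases
      case 3
      then show ?thesis using one[OF S v(1,2) _ v'(1,2) c2(2) z(2) _ z(1)] by auto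
    next
      case 4
      then show ?thesis using one[OF S v'(1,2) _ v(1,2) c2(1) z(1) _ z(2)] by (auto simp: Un_commute)
    qed (use S in auto)
  qed
qed

text \<open>If \<open>x\<close> and \<open>t\<close> are both avoided, the terminal \<open>t\<close>
  forces \<open>up x - {t}\<close>, which contains \<open>up v - {x}\<close> because a star has no
  terminal later neighbour. The weights are at most 8 + 4 + 4.\<close>

lemma branching_star_and_terminal:
  assumes x: "x \<in> V" and v: "star v" "x \<in> up v" and fst: "up v - {x} \<subseteq> up x" and t: "t \<in> up x" "t \<in> T"
  shows "branching [{x}, {v, t}, up v - {x}]" (is "branching ?F")
  unfolding branching_def
proof (intro conjI)
  have V: "v \<in> V" "t \<in> V" "v \<in> T" "up v \<inter> T = {}" "v \<noteq> t" using v t up_V[OF t(1)] up_pos[OF v(2)] up_pos[OF t(1)] by (auto simp: star_def)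
  then have c: "2 \<le> card {v, t}" by auto
  show "light ?F"
    using card_weight(1)[of 1] card_weight(2)[OF c] card_weight(2)[OF card_star_rest[OF v]] by (simp add: light_def)
  show "\<forall>X\<in>set ?F. X \<subseteq> V \<and> 1 \<le> card X" using V c card_star_rest[OF v] x up_subset[of v] by auto
  show "covering ?F"
    unfolding covering_def
  proof (intro allI impI)
    fix S assume S: "hits S"
    have "x \<in> S \<or> {v, t} \<subseteq> S \<or> up v - {x} \<subseteq> S"
    proof (rule ccontr)
      assume n: "\<not> ?thesis"
      then have "v \<in> S" using star_rest[OF S v(1) _ v(2)] by auto
      with n have "t \<notin> S" "x \<notin> S" by auto
      then have "up x - {t} \<subseteq> S" using hits_up[OF S x t(1)] t by auto
      moreover have "t \<notin> up v" using t V by auto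
      ultimately show False using n fst by auto
    qed
    then show "\<exists>S'. hits S' \<and> card S' \<le> card S \<and> (\<exists>X\<in>set ?F. X \<subseteq> S')" using S by auto
  qed
qed

text \<open>If \<open>v\<close> is the only star at \<open>x\<close>, then \<open>x\<close> can be exchanged for the surviving vertex of \<open>up v\<close>.\<close>

lemma branching_single_star:
  assumes sc: "scanned i L" and x: "x \<in> V" "pos x = i" and v: "v \<in> L" "x \<in> up v" and fst: "up v - {x} \<subseteq> up x"
    and only: "\<And>u. u \<in> L \<Longrightarrow> x \<in> up u \<Longrightarrow> u = v"
  shows "branching [{v}, up v - {x}]" (is "branching ?F")
  unfolding branching_def
proof (intro conjI)
  have st: "star v" using scanned_star[OF sc v(1)] .
  then have V: "v \<in> V" "x \<notin> T" using v by (auto simp: star_def)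
  have c: "1 \<le> card (up v - {x})" using card_star_rest[OF st v(2)] by simp
  show "light ?F" using card_weight(1)[of 1] card_weight(1)[OF c] by (simp add: light_def)
  show "\<forall>X\<in>set ?F. X \<subseteq> V \<and> 1 \<le> card X" using V c up_subset[of v] by auto
  show "covering ?F"
    unfolding covering_def
  proof (intro allI impI)
    fix S assume S: "hits S"
    show "\<exists>S'. hits S' \<and> card S' \<le> card S \<and> (\<exists>X\<in>set ?F. X \<subseteq> S')"
    proof (cases "v \<in> S \<or> up v - {x} \<subseteq> S")
      case True
      then show ?thesis using S by auto
    next
      case False
      then obtain y where y: "y \<in> up v" "y \<noteq> x" "y \<notin> S" by auto
      have xS: "x \<in> S" using star_rest[OF S st _ v(2)] False by auto
      \<comment> \<open>\<open>y\<close> is the only survivor in \<open>up v\<close>, so swapping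
        \<open>x\<close> for \<open>y\<close> completes \<open>up v - {x}\<close>.\<close>
      have rest: "up v - {y} \<subseteq> S" using star_rest[OF S st _ y(1,3)] False by auto
      let ?S = "insert y (S - {x})"
      have sub: "up v - {x} \<subseteq> ?S" using rest by auto
      have "hits ?S"
      proof (rule hits_without[OF sc x S])
        show "?S \<subseteq> V" using hits_subset[OF S] up_V[OF y(1)] by auto
        fix u z assume "u \<in> L" "x \<in> up u" "z \<in> up u" "z \<noteq> x"
        then show "u \<in> ?S \<or> z \<in> ?S" using only sub by auto
      next
        fix a b assume ab: "T_triangle x a b"
        show "a \<in> ?S \<or> b \<in> ?S"
        proof (rule ccontr)
          assume n: "\<not> ?thesis"
          have ab': "a \<in> up x" "b \<in> up x" "a \<noteq> b" "a \<in> T \<or> b \<in> T" using ab V by (auto simp: T_triangle_def)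
          moreover have "y \<in> up x" using y fst by auto
          ultimately have "a \<in> S \<or> b \<in> S \<or> y \<in> S" using hits_three_up[OF S x(1), of a b y] n by auto
          moreover have "a \<noteq> x" "b \<noteq> x" using ab' not_in_own_up by auto
          ultimately show False using n y by auto
        qed
      qed auto
      moreover have "card ?S \<le> card S" by (rule card_exchange_le[OF hits_finite[OF S] xS])
      ultimately show ?thesis using sub by (intro exI[of _ ?S]) auto
    qed
  qed
qed

lemma three_up:
  assumes "card (up v) = 3" "x \<in> up v" "w \<in> up v" "w \<noteq> x"
  obtains b where "up v = {x, w, b}" "b \<noteq> x" "b \<noteq> w"
proof -
  have "card (up v - {x} - {w}) = 1" using assms finite_up by (simp add: card_Diff_singleton)
  then obtain b where "up v - {x} - {w} = {b}" by (auto simp: card_1_singleton_iff)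
  then show ?thesis using assms by (intro that[of b]) auto
qed

text \<open>With \<open>w\<close> and \<open>b\<close> chosen, at most one later neighbour of
  \<open>v\<close> survives, so no T-triangle depends on \<open>v\<close> any more.\<close>

lemma hits_exchange_star:
  assumes sc: "scanned i L" and v: "v \<in> L" "up v = {x, w, b}" and S: "hits S" "v \<in> S" "w \<in> S"
  shows "hits (insert b (S - {v}))"
proof (rule hits_without_star[OF sc v(1) S(1)])
  show "insert b (S - {v}) \<subseteq> V" using hits_subset[OF S(1)] up_V[of b v] v by auto
  have "w \<noteq> v" using not_in_own_up[of v] v by auto
  then show "p \<in> insert b (S - {v}) \<or> q \<in> insert b (S - {v})" if "p \<in> up v" "q \<in> up v" "p \<noteq> q" for p q
    using that S v by auto
qed auto

text \<open>\<open>v\<close> and \<open>v2\<close> meet at \<open>w\<close>, \<open>v\<close> and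
  \<open>v'\<close> at \<open>x\<close>. The saving comes from \<open>v\<close>: if \<open>v\<close>
  and \<open>w\<close> are both chosen, \<open>v\<close> can be traded for the remaining vertex of
  \<open>up v\<close>, which gives \<open>up v - {x}\<close>. A solution that keeps \<open>v\<close>
  therefore avoids \<open>w\<close>, and the star \<open>v2\<close> contributes further vertices.
  The weights are at most 8 + 2 + 1 + 2 + 2 + 1, with nothing to spare.\<close>

lemma branching_linked_stars:
  assumes sc: "scanned i L" and v: "v \<in> L" "card (up v) = 3" "x \<in> up v" "w \<in> up v" "w \<noteq> x"
    and v2: "v2 \<in> L" "w \<in> up v2" "x \<notin> up v2" and ne: "v \<noteq> v2"
    and v': "v' \<in> L" "x \<in> up v'" and ne': "v \<noteq> v'"
    and disj: "4 \<le> card ((up v - {x}) \<union> (up v' - {x}))"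
  shows "branching [{x}, {v, v2, v'}, {v, v2} \<union> (up v' - {x}), {v} \<union> (up v2 - {w}),
    (up v - {x}) \<union> {v'}, (up v - {x}) \<union> (up v' - {x})]" (is "branching ?F")
  unfolding branching_def
proof (intro conjI)
  have st: "star v" "star v2" "star v'" using scanned_star[OF sc] v v2 v' by auto
  then have V: "v \<in> V" "v2 \<in> V" "v' \<in> V" "x \<in> V" using up_V[OF v(3)] by (auto simp: star_def)
  have T: "v \<in> T" "v2 \<in> T" "v' \<in> T" "up v \<inter> T = {}" "up v2 \<inter> T = {}" "up v' \<inter> T = {}"
    using st by (auto simp: star_def)
  have ne2: "v2 \<noteq> v'" using v2 v' by auto
  have c0: "1 \<le> card {x}" by simp
  have c: "3 \<le> card {v, v2, v'}" using ne ne' ne2 by auto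
  have c2: "4 \<le> card ({v, v2} \<union> (up v' - {x}))"
  proof -
    have "card ({v, v2} \<union> (up v' - {x})) = card {v, v2} + card (up v' - {x})"
      using finite_up T by (intro card_Un_disjoint) auto
    then show ?thesis using card_star_rest[OF st(3) v'(2)] ne by simp
  qed
  have c3: "3 \<le> card ({v} \<union> (up v2 - {w}))"
  proof -
    have "card ({v} \<union> (up v2 - {w})) = card {v} + card (up v2 - {w})"
      using finite_up T by (intro card_Un_disjoint) auto
    then show ?thesis using card_star_rest[OF st(2) v2(2)] by simp
  qed
  have c4: "3 \<le> card ((up v - {x}) \<union> {v'})"
  proof -
    have "card ((up v - {x}) \<union> {v'}) = card (up v - {x}) + card {v'}"
      using finite_up T by (intro card_Un_disjoint) auto
    then show ?thesis using card_star_rest[OF st(1) v(3)] by simp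
  qed
  show "light ?F"
    using card_weight(1)[OF c0] card_weight(3)[OF c] card_weight(4)[OF c2] card_weight(3)[OF c3]
      card_weight(3)[OF c4] card_weight(4)[OF disj] unfolding light_def list.map sum_list.Cons sum_list.Nil by linarith
  have "1 \<le> card {x}" "1 \<le> card {v, v2, v'}" "1 \<le> card ({v, v2} \<union> (up v' - {x}))"
    "1 \<le> card ({v} \<union> (up v2 - {w}))" "1 \<le> card ((up v - {x}) \<union> {v'})" "1 \<le> card ((up v - {x}) \<union> (up v' - {x}))"
    using c0 c c2 c3 c4 disj by linarith+
  then show "\<forall>X\<in>set ?F. X \<subseteq> V \<and> 1 \<le> card X"
    using V up_subset[of v] up_subset[of v'] up_subset[of v2] unfolding list.set by blast
  obtain b where b: "up v = {x, w, b}" "b \<noteq> x" "b \<noteq> w" using three_up[OF v(2-5)] .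
  show "covering ?F"
    unfolding covering_def
  proof (intro allI impI)
    fix S assume S: "hits S"
    show "\<exists>S'. hits S' \<and> card S' \<le> card S \<and> (\<exists>X\<in>set ?F. X \<subseteq> S')"
    proof (cases "x \<in> S")
      case True
      then show ?thesis using S by auto
    next
      case False
      obtain S1 where S1: "hits S1" "card S1 \<le> card S" "x \<notin> S1"
        and opt: "{v, v2} \<subseteq> S1 \<or> {v} \<union> (up v2 - {w}) \<subseteq> S1 \<or> up v - {x} \<subseteq> S1"
      proof (cases "v \<in> S \<and> w \<in> S")
        case True
        let ?S = "insert b (S - {v})"
        have "hits ?S" using hits_exchange_star[OF sc v(1) b(1) S] True by auto
        moreover have "card ?S \<le> card S" using card_exchange_le[OF hits_finite[OF S]] True by auto
        moreover have "up v - {x} \<subseteq> ?S" using True b not_in_own_up[of v] by auto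
        ultimately show ?thesis using that[of ?S] False b by auto
      next
        case nvw: False
        have "{v, v2} \<subseteq> S \<or> {v} \<union> (up v2 - {w}) \<subseteq> S \<or> up v - {x} \<subseteq> S"
          using nvw star_rest[OF S st(1) _ v(3) False] star_rest[OF S st(2) _ v2(2)] by auto
        then show ?thesis using that[of S] S False by auto
      qed
      have "v' \<in> S1 \<or> up v' - {x} \<subseteq> S1" using star_rest[OF S1(1) st(3) _ v'(2) S1(3)] by auto
      then show ?thesis using opt S1(1,2) by (intro exI[of _ S1]) auto
    qed
  qed
qed

text \<open>As \<open>v\<close> is the only star at \<open>x\<close>, a chosen \<open>x\<close> can
  be traded away, so no branch on \<open>{x}\<close> occurs. The weights are at most 4 + 2 + 4 +
  1.\<close>

lemma branching_linked_star:
  assumes sc: "scanned i L" and x: "x \<in> V" "pos x = i"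
    and v: "v \<in> L" "card (up v) = 3" "x \<in> up v" "w \<in> up v" "w \<noteq> x" "up v - {x, w} \<subseteq> up x"
    and v2: "v2 \<in> L" "card (up v2) = 3" "w \<in> up v2" "up v2 - {w} \<subseteq> up x" and ne: "v \<noteq> v2"
    and disj: "4 \<le> card ((up v - {w}) \<union> (up v2 - {w}))"
    and only: "\<And>u. u \<in> L \<Longrightarrow> x \<in> up u \<Longrightarrow> u = v"
  shows "branching [{v, v2}, {v} \<union> (up v2 - {w}), up v - {x}, (up v - {w}) \<union> (up v2 - {w})]" (is "branching ?F")
  unfolding branching_def
proof (intro conjI)
  have st: "star v" "star v2" using scanned_star[OF sc] v v2 by auto
  then have V: "v \<in> V" "v2 \<in> V" "w \<in> V" using up_V[OF v(4)] by (auto simp: star_def)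
  have T: "v \<in> T" "v2 \<in> T" "up v \<inter> T = {}" "up v2 \<inter> T = {}" using st by (auto simp: star_def)
  have c1: "2 \<le> card {v, v2}" using ne by auto
  have c2: "3 \<le> card ({v} \<union> (up v2 - {w}))"
  proof -
    have "card ({v} \<union> (up v2 - {w})) = card {v} + card (up v2 - {w})"
      using finite_up T by (intro card_Un_disjoint) auto
    then show ?thesis using card_star_rest[OF st(2) v2(3)] by simp
  qed
  have c3: "2 \<le> card (up v - {x})" by (rule card_star_rest[OF st(1) v(3)])
  show "light ?F"
    using card_weight(2)[OF c1] card_weight(3)[OF c2] card_weight(2)[OF c3] card_weight(4)[OF disj]
    unfolding light_def list.map sum_list.Cons sum_list.Nil by linarith
  have "1 \<le> card {v, v2}" "1 \<le> card ({v} \<union> (up v2 - {w}))" "1 \<le> card (up v - {x})"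
    "1 \<le> card ((up v - {w}) \<union> (up v2 - {w}))"
    using c1 c2 c3 disj by linarith+
  then show "\<forall>X\<in>set ?F. X \<subseteq> V \<and> 1 \<le> card X"
    using V up_subset[of v] up_subset[of v2] unfolding list.set by blast
  obtain b where b: "up v = {x, w, b}" "b \<noteq> x" "b \<noteq> w" using three_up[OF v(2-5)] .
  have b_up: "b \<in> up x" using v(6) b by auto
  have rest_v: "up v - {x} = {w, b}" "up v - {w} = {x, b}" using b v(5) by auto
  show "covering ?F"
    unfolding covering_def
  proof (intro allI impI)
    fix S assume S: "hits S"
    \<comment> \<open>\<open>x\<close> is no terminal, so a T-triangle \<open>x\<close>,
      \<open>p\<close>, \<open>q\<close> has a terminal among \<open>p\<close>, \<open>q\<close>,
      and \<open>p\<close>, \<open>q\<close>, \<open>y\<close> is a T-triangle too. Adding an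
      unchosen \<open>y\<close> from \<open>up x\<close> thus makes up for removing \<open>x\<close>
      in all triangles that start there.\<close>
    have own: "p \<in> S' \<or> q \<in> S'" if t: "T_triangle x p q" and y: "y \<in> up x" "y \<notin> S" and S': "S - {x} \<subseteq> S'" "y \<in> S'" for p q y S'
    proof (rule ccontr)
      assume n: "\<not> ?thesis"
      have "x \<notin> T" using v T by auto
      then have pq: "p \<in> up x" "q \<in> up x" "p \<noteq> q" "p \<in> T \<or> q \<in> T" using t by (auto simp: T_triangle_def)
      then have "p \<in> S \<or> q \<in> S \<or> y \<in> S" using hits_three_up[OF S x(1), of p q y] y n S' by auto
      moreover have "p \<noteq> x" "q \<noteq> x" using pq not_in_own_up by auto
      ultimately show False using n y S' by auto
    qed
    have two: "v \<in> S \<or> x \<in> S \<and> w \<in> S \<or> x \<in> S \<and> b \<in> S \<or> w \<in> S \<and> b \<in> S"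
      using star_rest[OF S st(1), of x] star_rest[OF S st(1), of w] b v(5) by auto
    have "v2 \<in> S \<or> w \<in> S \<or> up v2 - {w} \<subseteq> S" using star_rest[OF S st(2) _ v2(3)] by auto
    with two consider (direct) "{v, v2} \<subseteq> S \<or> {v} \<union> (up v2 - {w}) \<subseteq> S \<or> {w, b} \<subseteq> S \<or> {x, b} \<union> (up v2 - {w}) \<subseteq> S"
      | (vw) "v \<in> S" "w \<in> S" | (b) "b \<notin> S" "w \<in> S" "x \<in> S" | (w) "w \<notin> S" "x \<in> S" "b \<in> S" "v2 \<in> S" "\<not> up v2 - {w} \<subseteq> S"
      by auto
    then show "\<exists>S'. hits S' \<and> card S' \<le> card S \<and> (\<exists>X\<in>set ?F. X \<subseteq> S')"
    proof cases
      case direct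
      then show ?thesis using S rest_v by (intro exI[of _ S]) auto
    next
      case vw
      let ?S = "insert b (S - {v})"
      have "hits ?S" using hits_exchange_star[OF sc v(1) b(1) S vw] .
      moreover have "card ?S \<le> card S" using card_exchange_le[OF hits_finite[OF S]] vw by auto
      moreover have "up v - {x} \<subseteq> ?S" using vw b not_in_own_up[of v] by auto
      ultimately show ?thesis by (intro exI[of _ ?S]) auto
    next
      case b
      let ?S = "insert b (S - {x})"
      have "hits ?S"
      proof (rule hits_without[OF sc x S])
        show "?S \<subseteq> V" using hits_subset[OF S] up_V[OF b_up] by auto
        show "u \<in> ?S \<or> z \<in> ?S" if "u \<in> L" "x \<in> up u" "z \<in> up u" "z \<noteq> x" for u z
          using only[OF that(1,2)] that b rest_v v(5) by auto
        show "p \<in> ?S \<or> q \<in> ?S" if "T_triangle x p q" for p q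
          by (rule own[OF that b_up b(1)]) auto
      qed auto
      moreover have "card ?S \<le> card S" using card_exchange_le[OF hits_finite[OF S]] b by auto
      moreover have "up v - {x} \<subseteq> ?S" using b rest_v v(5) by auto
      ultimately show ?thesis by (intro exI[of _ ?S]) auto
    next
      case w
      then obtain y where y: "y \<in> up v2" "y \<noteq> w" "y \<notin> S" by auto
      have y_up: "y \<in> up x" using y v2 by auto
      obtain z where z: "up v2 = {w, y, z}" using three_up[OF v2(2) v2(3) y(1) y(2)] by metis
      let ?S1 = "insert y (insert w (S - {x}))"
      let ?S = "insert y (insert w (S - {x} - {v2}))"
      have ne2: "x \<noteq> v2" "b \<noteq> v2" using v b T rest_v by auto
      have wx: "w \<noteq> v2" "y \<noteq> v2" using not_in_own_up[of v2] v2 y by auto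
      have "hits ?S1"
      proof (rule hits_without[OF sc x S])
        show "?S1 \<subseteq> V" using hits_subset[OF S] up_V[OF y_up] V by auto
        show "u \<in> ?S1 \<or> z \<in> ?S1" if "u \<in> L" "x \<in> up u" "z \<in> up u" "z \<noteq> x" for u z
          using only[OF that(1,2)] that w b rest_v v(5) by auto
        show "p \<in> ?S1 \<or> q \<in> ?S1" if "T_triangle x p q" for p q
          by (rule own[OF that y_up y(3)]) auto
      qed auto
      then have "hits ?S"
      proof (rule hits_without_star[OF sc v2(1)])
        show "?S \<subseteq> V" using hits_subset[OF S] up_V[OF y_up] V by auto
        show "p \<in> ?S \<or> q \<in> ?S" if "p \<in> up v2" "q \<in> up v2" "p \<noteq> q" for p q
          using that z by auto
      qed auto
      moreover have "card ?S \<le> card S"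
      proof -
        have "card ?S \<le> card (S - {x} - {v2}) + 2"
          using hits_finite[OF S] card_insert_le_m1 by (simp add: card_insert_if)
        also have "card (S - {x} - {v2}) + 2 = card S"
          using hits_finite[OF S] w ne2 card_Suc_Diff1[of S x] card_Suc_Diff1[of "S - {x}" v2] by auto
        finally show ?thesis .
      qed
      moreover have "up v - {x} \<subseteq> ?S" using w rest_v b ne2 by auto
      ultimately show ?thesis by (intro exI[of _ ?S]) auto
    qed
  qed
qed

end

section \<open>Maximum cardinality search\<close>

definition adjacent :: "'a set set \<Rightarrow> 'a \<Rightarrow> 'a \<Rightarrow> bool" where
  "adjacent E a b \<longleftrightarrow> {a, b} \<in> E"

lemma adjacent_sym: "adjacent E a b \<Longrightarrow> adjacent E b a"
  by (simp add: adjacent_def insert_commute)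

lemma simple_graph_adjacent:
  assumes "simple_graph V E" "adjacent E a b"
  shows "a \<in> V" "b \<in> V" "a \<noteq> b"
  using assms unfolding simple_graph_def adjacent_def by (fastforce simp: card_insert_if)+

text \<open>Positions are assigned from high to low. The condition says that \<open>v\<close>, when
  chosen, had at least as many visited neighbours as every vertex \<open>w\<close> still
  unvisited.\<close>

definition search_order :: "'a set \<Rightarrow> 'a set set \<Rightarrow> ('a \<Rightarrow> nat) \<Rightarrow> bool" where
  "search_order V E pos \<longleftrightarrow> inj_on pos V \<and>
     (\<forall>v\<in>V. \<forall>w\<in>V. pos w < pos v \<longrightarrow>
        card {u\<in>V. adjacent E w u \<and> pos v < pos u} \<le> card {u\<in>V. adjacent E v u \<and> pos v < pos u})"

text \<open>An induced path whose inner vertices all precede both ends. With three vertices it is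
  exactly a violation of the elimination property, which longer paths generalise so that the
  extremal argument below applies.\<close>

definition low_path :: "'a set \<Rightarrow> 'a set set \<Rightarrow> ('a \<Rightarrow> nat) \<Rightarrow> 'a list \<Rightarrow> bool" where
  "low_path V E pos xs \<longleftrightarrow> 3 \<le> length xs \<and> distinct xs \<and> set xs \<subseteq> V \<and>
     (\<forall>i. Suc i < length xs \<longrightarrow> adjacent E (xs ! i) (xs ! Suc i)) \<and>
     (\<forall>i j. Suc i < j \<and> j < length xs \<longrightarrow> \<not> adjacent E (xs ! i) (xs ! j)) \<and>
     (\<forall>i. 0 < i \<and> Suc i < length xs \<longrightarrow> pos (xs ! i) < pos (hd xs) \<and> pos (xs ! i) < pos (last xs))"

lemma low_path_rev:
  assumes "low_path V E pos xs" shows "low_path V E pos (rev xs)"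
proof -
  let ?l = "length xs"
  have l: "3 \<le> ?l" and d: "distinct xs" and V: "set xs \<subseteq> V"
    and e: "\<And>i. Suc i < ?l \<Longrightarrow> adjacent E (xs ! i) (xs ! Suc i)"
    and c: "\<And>i j. Suc i < j \<Longrightarrow> j < ?l \<Longrightarrow> \<not> adjacent E (xs ! i) (xs ! j)"
    and p: "\<And>i. 0 < i \<Longrightarrow> Suc i < ?l \<Longrightarrow> pos (xs ! i) < pos (hd xs) \<and> pos (xs ! i) < pos (last xs)"
    using assms by (auto simp: low_path_def)
  have ne: "xs \<noteq> []" using l by auto
  have "adjacent E (rev xs ! i) (rev xs ! Suc i)" if "Suc i < ?l" for i
    using that adjacent_sym[OF e[of "?l - Suc (Suc i)"]] by (simp add: rev_nth Suc_diff_Suc)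
  moreover have "\<not> adjacent E (rev xs ! i) (rev xs ! j)" if "Suc i < j" "j < ?l" for i j
  proof -
    have "Suc (?l - Suc j) < ?l - Suc i" "?l - Suc i < ?l" using that by linarith+
    then have "\<not> adjacent E (xs ! (?l - Suc i)) (xs ! (?l - Suc j))"
      using c adjacent_sym[of E "xs ! (?l - Suc i)" "xs ! (?l - Suc j)"] by blast
    then show ?thesis using that by (simp add: rev_nth)
  qed
  moreover have "pos (rev xs ! i) < pos (hd (rev xs)) \<and> pos (rev xs ! i) < pos (last (rev xs))" if "0 < i" "Suc i < ?l" for i
    using that p[of "?l - Suc i"] ne by (simp add: rev_nth hd_rev last_rev)
  ultimately show ?thesis using l d V by (simp add: low_path_def)
qed

text \<open>\<open>xs ! 1\<close> has the neighbour \<open>hd xs\<close> after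
  \<open>last xs\<close>, which \<open>last xs\<close> lacks. The search order compensates with a
  neighbour \<open>y\<close> of \<open>last xs\<close> after it that is not adjacent to
  \<open>xs ! 1\<close>. Following the path to the first vertex adjacent to \<open>y\<close> and
  ending in \<open>y\<close> gives a low path, and both its ends are later than
  \<open>last xs\<close>.\<close>

lemma low_path_improve:
  assumes ch: "chordal_graph V E" and so: "search_order V E pos" and low: "low_path V E pos xs"
    and ends: "pos (last xs) < pos (hd xs)"
  shows "\<exists>ys. low_path V E pos ys \<and> pos (last xs) < min (pos (hd ys)) (pos (last ys))"
proof -
  have sg: "simple_graph V E" and fin: "finite V" using ch by (auto simp: chordal_graph_def simple_graph_def)
  let ?r = "length xs - 1"
  have l: "3 \<le> length xs" and d: "distinct xs" and V: "set xs \<subseteq> V"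
    and e: "\<And>i. Suc i < length xs \<Longrightarrow> adjacent E (xs ! i) (xs ! Suc i)"
    and c: "\<And>i j. Suc i < j \<Longrightarrow> j < length xs \<Longrightarrow> \<not> adjacent E (xs ! i) (xs ! j)"
    and p: "\<And>i. 0 < i \<Longrightarrow> Suc i < length xs \<Longrightarrow> pos (xs ! i) < pos (hd xs) \<and> pos (xs ! i) < pos (last xs)"
    using low by (auto simp: low_path_def)
  have ne: "xs \<noteq> []" using l by auto
  then have hd: "hd xs = xs ! 0" and la: "last xs = xs ! ?r" by (auto simp: hd_conv_nth last_conv_nth)
  have inV: "xs ! i \<in> V" if "i < length xs" for i using that V by auto
  let ?N = "\<lambda>w. {u\<in>V. adjacent E w u \<and> pos (last xs) < pos u}"
  have "card (?N (xs ! 1)) \<le> card (?N (last xs))"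
    using so p[of 1] l la inV[of ?r] inV[of 1] unfolding search_order_def by auto
  moreover have "hd xs \<in> ?N (xs ! 1)" using adjacent_sym[OF e[of 0]] l hd inV[of 0] ends ne by auto
  moreover have "hd xs \<notin> ?N (last xs)" using c[of 0 ?r] adjacent_sym[of E "last xs" "hd xs"] l hd la by auto
  moreover have "finite (?N (xs ! 1))" using fin by auto
  ultimately have "\<not> ?N (last xs) \<subseteq> ?N (xs ! 1)"
    by (metis (no_types, lifting) card_subset_eq card_mono le_antisym)
  then obtain y where y: "y \<in> V" "adjacent E (last xs) y" "pos (last xs) < pos y" "\<not> adjacent E (xs ! 1) y" by auto
  \<comment> \<open>First contact of the path with \<open>y\<close> from index 1 on. Since
    \<open>xs ! 1\<close> is not adjacent to \<open>y\<close>, \<open>j\<close> is at least 2, so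
    the cycle considered below has length \<open>j + 2\<close>, at least 4.\<close>
  define j where "j = (LEAST j. 1 \<le> j \<and> j < length xs \<and> adjacent E (xs ! j) y)"
  have ex: "1 \<le> ?r \<and> ?r < length xs \<and> adjacent E (xs ! ?r) y" using y l la by auto
  have j: "1 \<le> j \<and> j < length xs \<and> adjacent E (xs ! j) y" unfolding j_def by (rule LeastI, rule ex)
  have j_min: "\<not> adjacent E (xs ! i) y" if "1 \<le> i" "i < j" for i
    using not_less_Least[of i "\<lambda>j. 1 \<le> j \<and> j < length xs \<and> adjacent E (xs ! j) y"] that j unfolding j_def by auto
  have j2: "2 \<le> j" using j y(4) by (cases "j = 1") auto
  have pj: "pos (xs ! i) \<le> pos (last xs)" if "1 \<le> i" "i \<le> j" for i
  proof (cases "i = ?r")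
    case False
    then have "Suc i < length xs" using that j by linarith
    then show ?thesis using p[of i] that by auto
  qed (use la in auto)
  have yxs: "y \<noteq> xs ! i" if "i \<le> j" for i
  proof (cases "i = 0")
    case True
    moreover have "\<not> adjacent E (xs ! 0) (xs ! ?r)" using l by (intro c) auto
    ultimately show ?thesis using y(2) adjacent_sym[of E "last xs" y] la by auto
  next
    case False
    then show ?thesis using pj[of i] that y(3) by auto
  qed
  let ?ys = "take (Suc j) xs @ [y]"
  have len: "length ?ys = j + 2" using j by simp
  have nth: "?ys ! i = (if i \<le> j then xs ! i else y)" if "i < j + 2" for i
    using that j by (auto simp: nth_append)
  have dist: "distinct ?ys"
  proof -
    have "y \<notin> set (take (Suc j) xs)" 
    proof
      assume "y \<in> set (take (Suc j) xs)"
      then obtain i where "i \<le> j" "y = xs ! i" by (auto simp: in_set_conv_nth less_Suc_eq_le)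
      then show False using yxs[of i] by simp
    qed
    then show ?thesis using d by simp
  qed
  have edge: "adjacent E (?ys ! i) (?ys ! Suc i)" if "Suc i < j + 2" for i
    using that nth[of i] nth[of "Suc i"] e[of i] j by (cases "i = j") auto
  have nochord: "\<not> adjacent E (?ys ! a) (?ys ! b)" if "Suc a < b" "b < j + 2" "a \<noteq> 0 \<or> b \<noteq> j + 1" for a b
  proof (cases "b = j + 1")
    case True
    then show ?thesis using that nth[of a] nth[of b] j_min[of a] by auto
  next
    case False
    then show ?thesis using that nth[of a] nth[of b] c[of a b] j by auto
  qed
  \<comment> \<open>This edge would close a cycle, and \<open>nochord\<close> excludes every pair of
    vertices that are not consecutive on it.\<close>
  have "\<not> adjacent E (xs ! 0) y"
  proof
    assume a: "adjacent E (xs ! 0) y"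
    have "is_cycle E ?ys" unfolding is_cycle_def
    proof (intro conjI allI impI)
      fix i assume i: "i < length ?ys"
      show "{?ys ! i, ?ys ! (Suc i mod length ?ys)} \<in> E"
      proof (cases "Suc i < j + 2")
        case True
        then show ?thesis using edge[of i] len by (simp add: adjacent_def)
      next
        case False
        then have "Suc i = j + 2" using i len by simp
        then have "Suc i mod length ?ys = 0" using len by simp
        moreover have "?ys ! 0 = xs ! 0" "?ys ! i = y" using nth[of 0] nth[of i] \<open>Suc i = j + 2\<close> by auto
        ultimately show ?thesis using a by (simp add: adjacent_def insert_commute)
      qed
    qed (use len j2 dist in auto)
    then have "has_chord E ?ys" using ch len j2 unfolding chordal_graph_def by auto
    then obtain a b where ab: "a < j + 2" "b < j + 2" "a \<noteq> b" "b \<noteq> Suc a mod (j + 2)" "a \<noteq> Suc b mod (j + 2)" "adjacent E (?ys ! a) (?ys ! b)"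
      unfolding has_chord_def len adjacent_def by blast
    have *: "Suc a' mod (j + 2) = (if a' = j + 1 then 0 else Suc a')" if "a' < j + 2" for a' using that by auto
    show False
    proof (cases "a < b")
      case True
      then show False using ab nochord[of a b] *[of a] *[of b] by (auto split: if_splits)
    next
      case False
      then show False using ab nochord[of b a] *[of a] *[of b] adjacent_sym[of E "?ys ! a" "?ys ! b"] by (auto split: if_splits)
    qed
  qed
  then have nochord': "\<not> adjacent E (?ys ! a) (?ys ! b)" if "Suc a < b" "b < j + 2" for a b
    using nochord[OF that] that nth[of 0] nth[of "j + 1"] by (cases "a = 0 \<and> b = j + 1") auto
  have hy: "hd ?ys = hd xs" using ne by (cases xs) auto
  have "low_path V E pos ?ys"
    unfolding low_path_def len
  proof (intro conjI allI impI)
    show "set ?ys \<subseteq> V" using V y(1) set_take_subset[of "Suc j" xs] by auto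
    fix i assume i: "0 < i \<and> Suc i < j + 2"
    then have "pos (?ys ! i) \<le> pos (last xs)" using pj[of i] nth[of i] by auto
    then show "pos (?ys ! i) < pos (hd ?ys)" "pos (?ys ! i) < pos (last ?ys)" using hy ends y(3) by auto
  qed (use j2 dist edge nochord' in auto)
  moreover have "pos (last xs) < min (pos (hd ?ys)) (pos (last ?ys))" using hy ends y(3) by auto
  ultimately show ?thesis by blast
qed

text \<open>The position of the earlier end can always be increased, after reversing the path if
  necessary, but it is bounded by the largest position.\<close>

lemma no_low_path:
  assumes "chordal_graph V E" "search_order V E pos" "low_path V E pos xs"
  shows False
proof -
  have fin: "finite V" using assms(1) by (simp add: chordal_graph_def simple_graph_def)
  let ?m = "\<lambda>xs. min (pos (hd xs)) (pos (last xs))"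
  have step: "\<exists>ys. low_path V E pos ys \<and> ?m xs < ?m ys" if low: "low_path V E pos xs" for xs
  proof -
    have "3 \<le> length xs" "distinct xs" "set xs \<subseteq> V" using low by (auto simp: low_path_def)
    moreover from this have "xs \<noteq> []" by auto
    ultimately have "hd xs \<in> V" "last xs \<in> V" "hd xs \<noteq> last xs"
      by (auto simp: hd_conv_nth last_conv_nth nth_eq_iff_index_eq)
    then have "pos (hd xs) \<noteq> pos (last xs)" using assms(2) by (auto simp: search_order_def inj_on_def)
    then consider "pos (last xs) < pos (hd xs)" | "pos (last (rev xs)) < pos (hd (rev xs))"
      by (metis hd_rev last_rev nat_neq_iff)
    then show ?thesis
    proof cases
      case 1
      then show ?thesis using low_path_improve[OF assms(1,2) low] by force
    next
      case 2
      then show ?thesis using low_path_improve[OF assms(1,2) low_path_rev[OF low]] by (force simp: hd_rev last_rev)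
    qed
  qed
  have bound: "?m xs \<le> Max (pos ` V)" if "low_path V E pos xs" for xs
  proof -
    have "hd xs \<in> V" using that by (cases xs) (auto simp: low_path_def)
    then have "pos (hd xs) \<le> Max (pos ` V)" using fin by simp
    then show ?thesis by simp
  qed
  obtain ys where "low_path V E pos ys" "\<forall>zs. low_path V E pos zs \<longrightarrow> ?m zs \<le> ?m ys"
    using ex_has_greatest_nat[of "low_path V E pos" xs ?m "Suc (Max (pos ` V))"] assms(3) bound by (metis le_imp_less_Suc)
  then show False using step by (meson not_le)
qed

text \<open>Two nonadjacent later neighbours \<open>b\<close>, \<open>c\<close> of \<open>a\<close>
  would form the low path \<open>[b, a, c]\<close>.\<close>

lemma search_order_elimination_order:
  assumes ch: "chordal_graph V E" and so: "search_order V E pos"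
  shows "elimination_order V (adjacent E) pos"
proof
  have sg: "simple_graph V E" using ch by (simp add: chordal_graph_def)
  then show "finite V" by (simp add: simple_graph_def)
  show "adjacent E b a" if "adjacent E a b" for a b using adjacent_sym[OF that] .
  show "\<not> adjacent E a a" for a using simple_graph_adjacent[OF sg, of a a] by auto
  show "inj_on pos V" using so by (simp add: search_order_def)
  fix a b c assume h: "a \<in> V" "b \<in> V" "c \<in> V" "adjacent E a b" "adjacent E a c" "pos a < pos b" "pos a < pos c" "b \<noteq> c"
  show "adjacent E b c"
  proof (rule ccontr)
    assume n: "\<not> adjacent E b c"
    have "low_path V E pos [b, a, c]"
      using h n adjacent_sym[OF h(4)] by (auto simp: low_path_def less_Suc_eq nth_Cons split: nat.split)
    then show False using no_low_path[OF ch so] by blast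
  qed
qed

section \<open>From T-cycles to T-triangles\<close>

lemma is_cycle_rotate:
  assumes "is_cycle E C" shows "is_cycle E (rotate m C)"
  unfolding is_cycle_def
proof (intro conjI allI impI)
  let ?l = "length C"
  fix i assume i: "i < length (rotate m C)"
  then have l: "0 < ?l" "i < ?l" by auto
  have "rotate m C ! i = C ! ((m + i) mod ?l)" using l by (simp add: nth_rotate)
  moreover have "rotate m C ! (Suc i mod ?l) = C ! (Suc ((m + i) mod ?l) mod ?l)"
    using l by (simp add: nth_rotate mod_simps)
  ultimately show "{rotate m C ! i, rotate m C ! (Suc i mod length (rotate m C))} \<in> E"
    using assms l by (simp add: is_cycle_def)
qed (use assms in \<open>auto simp: is_cycle_def\<close>)

text \<open>The earliest vertex \<open>u\<close> of the cycle has both its cycle neighbours in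
  \<open>up u\<close>, so they are adjacent. As \<open>S\<close> misses the resulting triangle, it
  contains no terminal. Cutting off \<open>u\<close> then gives a shorter cycle that keeps its
  terminals.\<close>

lemma (in elimination_order) no_T_cycle:
  assumes adj: "adj = adjacent E" and S: "hits S" and sg: "simple_graph V E"
  shows "\<not> is_T_cycle (induced_edges E (V - S)) T C"
proof (induction "length C" arbitrary: C rule: less_induct)
  case less
  show ?case
  proof
    let ?D = "induced_edges E (V - S)"
    assume T: "is_T_cycle ?D T C"
    then have cyc: "is_cycle ?D C" and ter: "set C \<inter> T \<noteq> {}" by (auto simp: is_T_cycle_def)
    then have l: "3 \<le> length C" by (simp add: is_cycle_def)
    define u where "u = arg_min_on pos (set C)"
    have u: "u \<in> set C" "\<And>v. v \<in> set C \<Longrightarrow> pos u \<le> pos v"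
      using arg_min_if_finite[of "set C" pos] l unfolding u_def by (cases "C = []", auto simp: not_less)+
    then obtain m where m: "m < length C" "C ! m = u" by (auto simp: in_set_conv_nth)
    define C' where "C' = rotate m C"
    have cyc': "is_cycle ?D C'" unfolding C'_def by (rule is_cycle_rotate[OF cyc])
    have cne: "C \<noteq> []" using l by auto
    then have C': "set C' = set C" "length C' = length C" "C' ! 0 = u" using m nth_rotate[of 0 C m] by (auto simp: C'_def)
    let ?l = "length C'"
    have edge: "{C' ! i, C' ! (Suc i mod ?l)} \<in> ?D" if "i < ?l" for i using cyc' that by (simp add: is_cycle_def)
    have dist: "distinct C'" using cyc' by (simp add: is_cycle_def)
    have inV: "C' ! i \<in> V - S" if "i < ?l" for i using edge[OF that] by (auto simp: induced_edges_def)
    let ?p = "C' ! 1" and ?q = "C' ! (?l - 1)"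
    have up: "adj u ?p" using edge[of 0] l C' cne by (auto simp: adj adjacent_def induced_edges_def)
    have uq: "adj u ?q" using edge[of "?l - 1"] l C' cne by (auto simp: adj adjacent_def induced_edges_def insert_commute)
    have pq: "?p \<noteq> ?q" using dist l C' by (simp add: nth_eq_iff_index_eq)
    have "?p \<noteq> u" "?q \<noteq> u" using up uq adj_irrefl by auto
    moreover have "?p \<in> set C" "?q \<in> set C" using l C' nth_mem[of 1 C'] nth_mem[of "?l - 1" C'] cne by auto
    moreover have V: "u \<in> V - S" "?p \<in> V - S" "?q \<in> V - S" using inV[of 0] inV[of 1] inV[of "?l - 1"] l C' cne by auto
    ultimately have "pos u < pos ?p" "pos u < pos ?q" using u(2) inj_pos by (metis DiffD1 inj_onD le_neq_implies_less)+
    then have in_up: "?p \<in> up u" "?q \<in> up u" using up uq V by (auto simp: up_def)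
    have pq_adj: "adj ?p ?q" using later_clique[of u ?p ?q] in_up V pq by (auto simp: up_def)
    have nT: "u \<notin> T" "?p \<notin> T" "?q \<notin> T" using hits_up[OF S _ in_up pq] V by auto
    obtain t i where t: "t \<in> T" "i < ?l" "C' ! i = t" using ter C' by (metis disjoint_iff in_set_conv_nth)
    have i: "0 < i" "i \<noteq> 1" "i \<noteq> ?l - 1" using nT t C' by (auto intro: gr0I)
    \<comment> \<open>The terminal is none of \<open>u\<close>, \<open>?p\<close>,
      \<open>?q\<close>, so there is a fourth vertex and the shortened cycle still has at least
      three.\<close>
    have l4: "4 \<le> ?l" using i t by linarith
    have nth: "tl C' ! a = C' ! Suc a" if "a < ?l - 1" for a using that by (simp add: nth_tl)
    have "is_cycle ?D (tl C')" unfolding is_cycle_def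
    proof (intro conjI allI impI)
      fix a assume a: "a < length (tl C')"
      show "{tl C' ! a, tl C' ! (Suc a mod length (tl C'))} \<in> ?D"
      proof (cases "Suc a = ?l - 1")
        case True
        then have "{tl C' ! a, tl C' ! (Suc a mod length (tl C'))} = {?q, ?p}" using nth[of a] nth[of 0] l4 by auto
        then show ?thesis using pq_adj V by (simp add: adj adjacent_def induced_edges_def insert_commute)
      next
        case False
        then have "Suc a < ?l - 1" using a by simp
        then show ?thesis using edge[of "Suc a"] nth[of a] nth[of "Suc a"] by simp
      qed
    qed (use l4 dist in \<open>auto simp: distinct_tl\<close>)
    moreover have "t \<in> set (tl C')" using nth[of "i - 1"] i t nth_mem[of "i - 1" "tl C'"] by auto
    ultimately have "is_T_cycle ?D T (tl C')" using t by (auto simp: is_T_cycle_def)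
    then show False using less[of "tl C'"] l4 C' by auto
  qed
qed

lemma (in elimination_order) subset_FVS_iff_solvable:
  assumes adj: "adj = adjacent E" and sg: "simple_graph V E"
  shows "subset_FVS V E T k \<longleftrightarrow> solvable k"
proof
  assume "solvable k"
  then obtain S where S: "hits S" "card S \<le> k" by (auto simp: solvable_def)
  have "\<nexists>C. is_T_cycle (induced_edges E (V - S)) T C" using no_T_cycle[OF adj S(1) sg] by blast
  then show "subset_FVS V E T k" unfolding subset_FVS_def using S hits_subset[OF S(1)] by blast
next
  assume "subset_FVS V E T k"
  then obtain S where S: "S \<subseteq> V" "card S \<le> k" "\<And>C. \<not> is_T_cycle (induced_edges E (V - S)) T C"
    unfolding subset_FVS_def by blast
  have "hits S" unfolding hits_def
  proof (intro conjI allI impI S(1))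
    fix v a b assume t: "T_triangle v a b"
    show "v \<in> S \<or> a \<in> S \<or> b \<in> S"
    proof (rule ccontr)
      assume n: "\<not> ?thesis"
      have V: "v \<in> V" "a \<in> V" "b \<in> V" and vab: "v \<noteq> a" "v \<noteq> b" "a \<noteq> b" "adj v a" "adj v b"
        using t by (auto simp: T_triangle_def up_def)
      have "adj a b" using t later_clique[of v a b] by (auto simp: T_triangle_def up_def)
      moreover have "v \<in> T \<or> a \<in> T \<or> b \<in> T" using t by (simp add: T_triangle_def)
      ultimately have "is_T_cycle (induced_edges E (V - S)) T [v, a, b]"
        using vab V n unfolding is_T_cycle_def is_cycle_def induced_edges_def adj adjacent_def
        by (auto simp: less_Suc_eq insert_commute)
      then show False using S(3) by blast
    qed
  qed
  then show "solvable k" using S(2) by (auto simp: solvable_def)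
qed

section \<open>Recursion over branching families\<close>

lemma elimination_order_mono:
  assumes "elimination_order V adj pos" "W \<subseteq> V"
  shows "elimination_order W adj pos"
proof -
  interpret elimination_order V adj pos by fact
  show ?thesis
  proof
    show "finite W" using assms(2) finite_V finite_subset by auto
    show "inj_on pos W" using assms(2) inj_pos inj_on_subset by auto
    show "adj b c" if "a \<in> W" "b \<in> W" "c \<in> W" "adj a b" "adj a c" "pos a < pos b" "pos a < pos c" "b \<noteq> c" for a b c
      using that assms(2) by (intro later_clique[of a b c]) auto
  qed (use adj_sym adj_irrefl in auto)
qed

context elimination_order
begin

lemma hits_Diff_iff:
  assumes "X \<subseteq> V" "S \<subseteq> V - X"
  shows "elimination_order.hits (V - X) adj pos T S \<longleftrightarrow> hits (S \<union> X)"
proof -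
  interpret W: elimination_order "V - X" adj pos T
    by (rule elimination_order_mono[OF elimination_order_axioms]) auto
  have up: "W.up v = up v - X" for v by (auto simp: W.up_def up_def)
  have "T_triangle v a b \<Longrightarrow> v \<notin> X \<Longrightarrow> a \<notin> X \<Longrightarrow> b \<notin> X \<Longrightarrow> W.T_triangle v a b"
    and "W.T_triangle v a b \<Longrightarrow> T_triangle v a b \<and> v \<notin> X \<and> a \<notin> X \<and> b \<notin> X" for v a b
    by (auto simp: W.T_triangle_def T_triangle_def up)
  then show ?thesis using assms unfolding W.hits_def hits_def by blast
qed

lemma solvable_branching:
  assumes "branching F"
  shows "solvable k \<longleftrightarrow>
    (\<exists>X\<in>set F. card X \<le> k \<and> elimination_order.solvable (V - X) adj pos T (k - card X))"
proof
  assume "solvable k"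
  then obtain S where "hits S" "card S \<le> k" by (auto simp: solvable_def)
  then obtain S' X where S: "hits S'" "card S' \<le> k" "X \<in> set F" "X \<subseteq> S'"
    using assms unfolding branching_def covering_def by (meson le_trans)
  interpret W: elimination_order "V - X" adj pos T
    by (rule elimination_order_mono[OF elimination_order_axioms]) auto
  have sub: "X \<subseteq> V" "S' - X \<subseteq> V - X" using S hits_subset by auto
  have c: "card (S' - X) = card S' - card X" "card X \<le> card S'"
    using S hits_finite card_Diff_subset card_mono finite_subset by metis+
  have "W.hits (S' - X)" using hits_Diff_iff[OF sub] S by (simp add: Un_absorb2 Un_commute)
  then have "W.solvable (k - card X)" unfolding W.solvable_def using c S by (intro exI[of _ "S' - X"]) auto
  then show "\<exists>X\<in>set F. card X \<le> k \<and> elimination_order.solvable (V - X) adj pos T (k - card X)"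
    using S c by (intro bexI[of _ X] conjI) auto
next
  assume "\<exists>X\<in>set F. card X \<le> k \<and> elimination_order.solvable (V - X) adj pos T (k - card X)"
  then obtain X where X: "X \<in> set F" "card X \<le> k" "elimination_order.solvable (V - X) adj pos T (k - card X)" by auto
  then have sub: "X \<subseteq> V" using assms by (auto simp: branching_def)
  interpret W: elimination_order "V - X" adj pos T
    by (rule elimination_order_mono[OF elimination_order_axioms]) auto
  obtain S where S: "W.hits S" "card S \<le> k - card X" using X by (auto simp: W.solvable_def)
  then have "hits (S \<union> X)" using hits_Diff_iff[OF sub] W.hits_subset by auto
  moreover have "card (S \<union> X) \<le> k" using card_Un_le[of S X] S X by linarith
  ultimately show "solvable k" by (auto simp: solvable_def)
qed

text \<open>Lightness bounds the sum of 2 ^ (budget + 1) over the children by 2 ^ (k + 1). With at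
  least two children, the ones subtracted from their potentials pay for the parent; a lone child has
  a smaller budget, and without children the parent's own potential of at least one
  suffices.\<close>

lemma light_potential:
  assumes "branching F"
  shows "Suc (sum_list (map (\<lambda>X. if card X \<le> k then 2 * 2 ^ (k - card X) - 1 else 0) F)) \<le> 2 * 2 ^ k - (1 :: nat)"
proof -
  let ?G = "filter (\<lambda>X. card X \<le> k) F"
  let ?p = "\<lambda>X. (2 :: nat) * 2 ^ (k - card X)"
  \<comment> \<open>Both sides are powers of two; the factor 8 turns \<open>?p X\<close> into 2 ^ (k
    - card X + 4), matching the scaled weights.\<close>
  have w: "8 * ?p X \<le> 2 ^ k * 2 ^ (4 - min 4 (card X))" if "card X \<le> k" for X
  proof -
    have "(4::nat) \<le> card X + (4 - min 4 (card X))" by auto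
    then have "k + 4 \<le> k - card X + (card X + (card X + (4 - min 4 (card X))))" using that by linarith
    then have "k - card X + 4 \<le> k + (4 - min 4 (card X))" using that by linarith
    then have "(2::nat) ^ (k - card X + 4) \<le> 2 ^ (k + (4 - min 4 (card X)))" by (intro power_increasing) auto
    then show ?thesis unfolding power_add by simp
  qed
  have pos: "1 \<le> card X" if "X \<in> set F" for X using assms that by (auto simp: branching_def)
  have sum_filter: "sum_list (map (\<lambda>X. if card X \<le> k then 2 * 2 ^ (k - card X) - 1 else 0) F)
      = sum_list (map (\<lambda>X. ?p X - 1) ?G)"
    by (induction F) auto
  have minus: "sum_list (map (\<lambda>X. ?p X - 1) H) + length H = sum_list (map ?p H)" for H
  proof (induction H)
    case (Cons X H)
    have "1 \<le> ?p X" by simp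
    then show ?case using Cons unfolding list.map sum_list.Cons list.size by linarith
  qed simp
  have "8 * sum_list (map ?p ?G) \<le> 2 ^ k * sum_list (map (\<lambda>X. 2 ^ (4 - min 4 (card X))) F)"
  proof (induction F)
    case (Cons X F)
    then show ?case using w[of X] by (auto simp: algebra_simps)
  qed simp
  also have "\<dots> \<le> 2 ^ k * 16" using assms by (intro mult_left_mono) (auto simp: branching_def light_def)
  finally have le: "sum_list (map ?p ?G) \<le> 2 * 2 ^ k" by simp
  have k1: "(1::nat) \<le> 2 ^ k" by simp
  show ?thesis
  proof (cases "length ?G \<le> 1")
    case False
    then show ?thesis using minus[of ?G] le sum_filter by linarith
  next
    case True
    then consider "?G = []" | X where "?G = [X]" by (cases ?G) auto
    then show ?thesis
    proof cases
      case 1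
      have "Suc 0 \<le> 2 * 2 ^ k - 1" using k1 by linarith
      then show ?thesis unfolding sum_filter 1 by simp
    next
      case 2
      then have "X \<in> set ?G" by simp
      then have X: "X \<in> set F" "card X \<le> k" by auto
      then have "k - card X + 1 \<le> k" using pos[of X] by linarith
      then have "(2::nat) ^ (k - card X + 1) \<le> 2 ^ k" by (intro power_increasing) auto
      then have "?p X \<le> 2 ^ k" by simp
      then have "Suc (?p X - 1) \<le> 2 * 2 ^ k - 1" using k1 by linarith
      then show ?thesis unfolding sum_filter 2 by simp
    qed
  qed
qed

section \<open>Invariant of the scan\<close>

text \<open>
  \<open>L\<close> is the set of stars met so far, \<open>mm v\<close> the first vertex of \<open>up v\<close>, and \<open>s1 w\<close>, \<open>s2 w\<close> are
  two stars at a vertex \<open>w\<close> that was passed over although it has stars.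
\<close>

definition scan_inv :: "nat \<Rightarrow> 'a set \<Rightarrow> ('a \<Rightarrow> 'a) \<Rightarrow> ('a \<Rightarrow> nat) \<Rightarrow> ('a \<Rightarrow> 'a) \<Rightarrow> ('a \<Rightarrow> 'a) \<Rightarrow> bool" where
  "scan_inv i L mm dg s1 s2 \<longleftrightarrow> scanned i L \<and>
     (\<forall>v\<in>L. mm v \<in> up v \<and> (\<forall>u\<in>up v. pos (mm v) \<le> pos u) \<and> dg v = card (up v) \<and>
        (pos (mm v) < i \<longrightarrow> s1 (mm v) \<noteq> s2 (mm v) \<and> s1 (mm v) \<in> L \<and> s2 (mm v) \<in> L \<and>
           mm (s1 (mm v)) = mm v \<and> mm (s2 (mm v)) = mm v \<and> (\<forall>u\<in>up v - {mm v}. i \<le> pos u)))"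

text \<open>The invariant reads the four functions only at vertices before position
  \<open>i\<close>. Hence entries may be written for the vertex currently scanned.\<close>

lemma scan_inv_cong:
  assumes "scan_inv i L mm dg s1 s2"
    and "\<And>v. v \<in> V \<Longrightarrow> pos v < i \<Longrightarrow> mm' v = mm v \<and> dg' v = dg v \<and> s1' v = s1 v \<and> s2' v = s2 v"
  shows "scan_inv i L mm' dg' s1' s2'"
proof -
  have L: "v \<in> V" "pos v < i" if "v \<in> L" for v using assms(1) that by (auto simp: scan_inv_def scanned_def)
  show ?thesis
    unfolding scan_inv_def
  proof (intro conjI ballI)
    show "scanned i L" using assms(1) by (simp add: scan_inv_def)
    fix v assume v: "v \<in> L"
    then have e: "mm' v = mm v" "dg' v = dg v" using assms(2) L by auto
    have m: "mm v \<in> up v" using assms(1) v by (simp add: scan_inv_def)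
    show "mm' v \<in> up v" "\<And>u. u \<in> up v \<Longrightarrow> pos (mm' v) \<le> pos u" "dg' v = card (up v)"
      using assms(1) v e by (simp_all add: scan_inv_def)
    show "pos (mm' v) < i \<longrightarrow> s1' (mm' v) \<noteq> s2' (mm' v) \<and> s1' (mm' v) \<in> L \<and> s2' (mm' v) \<in> L \<and>
           mm' (s1' (mm' v)) = mm' v \<and> mm' (s2' (mm' v)) = mm' v \<and> (\<forall>u\<in>up v - {mm' v}. i \<le> pos u)"
    proof
      assume p: "pos (mm' v) < i"
      then have "s1' (mm v) = s1 (mm v)" "s2' (mm v) = s2 (mm v)" using assms(2)[of "mm v"] up_V[OF m] e by auto
      moreover have "s1 (mm v) \<in> L" "s2 (mm v) \<in> L" using assms(1) v p e by (auto simp: scan_inv_def)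
      moreover from this have "mm' (s1 (mm v)) = mm (s1 (mm v))" "mm' (s2 (mm v)) = mm (s2 (mm v))" using assms(2) L by auto
      ultimately show "s1' (mm' v) \<noteq> s2' (mm' v) \<and> s1' (mm' v) \<in> L \<and> s2' (mm' v) \<in> L \<and>
           mm' (s1' (mm' v)) = mm' v \<and> mm' (s2' (mm' v)) = mm' v \<and> (\<forall>u\<in>up v - {mm' v}. i \<le> pos u)"
        using assms(1) v p e by (simp add: scan_inv_def)
    qed
  qed
qed

lemma scan_inv_first_one:
  assumes "\<And>v. v \<in> V \<Longrightarrow> 1 \<le> pos v" shows "scan_inv 1 {} mm dg s1 s2"
  using assms by (fastforce simp: scan_inv_def scanned_def)

text \<open>Deleted vertices leave gaps, as the surviving ones keep their positions in the whole
  graph.\<close>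

lemma scan_inv_gap:
  assumes inv: "scan_inv i L mm dg s1 s2" and gap: "\<And>v. v \<in> V \<Longrightarrow> pos v \<noteq> i"
  shows "scan_inv (Suc i) L mm dg s1 s2"
proof -
  have lt: "pos v < Suc i \<longleftrightarrow> pos v < i" if "v \<in> V" for v using gap[OF that] by auto
  have ge: "Suc i \<le> pos v \<longleftrightarrow> i \<le> pos v" if "v \<in> V" for v using gap[OF that] by auto
  have ge_up: "(\<forall>u\<in>up v - {mm v}. i \<le> pos u) \<longleftrightarrow> (\<forall>u\<in>up v - {mm v}. Suc i \<le> pos u)" for v
    using ge up_V by (metis DiffD1)
  have "scanned (Suc i) L" using inv lt unfolding scan_inv_def scanned_def by auto
  moreover have "pos (mm v) < i \<longleftrightarrow> pos (mm v) < Suc i" if "v \<in> L" for v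
    using inv that lt up_V by (auto simp: scan_inv_def)
  ultimately show ?thesis using inv ge_up unfolding scan_inv_def by auto
qed

lemma scan_inv_inert:
  assumes inv: "scan_inv i L mm dg s1 s2" and x: "x \<in> V" "pos x = i" and inert: "inert x"
    and nostar: "\<And>v. v \<in> L \<Longrightarrow> x \<notin> up v"
  shows "scan_inv (Suc i) L mm dg s1 s2"
proof -
  have only: "v = x" if "v \<in> V" "pos v = i" for v using inj_pos that x by (auto simp: inj_on_def)
  have xL: "x \<notin> L" using inv x by (auto simp: scan_inv_def scanned_def)
  have "scanned (Suc i) L" using inv inert only xL unfolding scan_inv_def scanned_def by (auto simp: less_Suc_eq)
  moreover have "u \<noteq> x" if "v \<in> L" "u \<in> up v" for u v using nostar that by auto
  then have ne: "pos u \<noteq> i" if "v \<in> L" "u \<in> up v" for u v using only that up_V by blast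
  moreover have "pos (mm v) < i \<longleftrightarrow> pos (mm v) < Suc i" if "v \<in> L" for v
    using ne[OF that] inv that by (auto simp: scan_inv_def less_Suc_eq)
  moreover have "(\<forall>u\<in>up v - {mm v}. i \<le> pos u) \<longleftrightarrow> (\<forall>u\<in>up v - {mm v}. Suc i \<le> pos u)" if "v \<in> L" for v
    using ne[OF that] by (auto simp: Suc_le_eq order.strict_iff_order)
  ultimately show ?thesis using inv unfolding scan_inv_def by auto
qed

text \<open>\<open>x\<close> is a terminal and so no later neighbour of an earlier star; the
  conditions on the old stars do not notice the step from \<open>i\<close> to
  \<open>Suc i\<close>.\<close>

lemma scan_inv_star:
  assumes inv: "scan_inv i L mm dg s1 s2" and x: "x \<in> V" "pos x = i" and st: "star x"
    and m: "mm x \<in> up x" "\<And>u. u \<in> up x \<Longrightarrow> pos (mm x) \<le> pos u" "dg x = card (up x)"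
  shows "scan_inv (Suc i) (insert x L) mm dg s1 s2"
proof -
  have only: "v = x" if "v \<in> V" "pos v = i" for v using inj_pos that x by (auto simp: inj_on_def)
  have Lst: "star v" if "v \<in> L" for v using inv that scanned_star by (auto simp: scan_inv_def)
  have ne: "pos u \<noteq> i" if "v \<in> L" "u \<in> up v" for u v
    using only[OF up_V[OF that(2)]] Lst[OF that(1)] st that(2) by (auto simp: star_def)
  have "scanned (Suc i) (insert x L)"
  proof -
    have "scanned i L" using inv by (simp add: scan_inv_def)
    then show ?thesis using st only x unfolding scanned_def by (metis insert_iff less_Suc_eq)
  qed
  moreover have "pos (mm v) < i \<longleftrightarrow> pos (mm v) < Suc i" if "v \<in> L" for v
    using ne[OF that] inv that by (auto simp: scan_inv_def less_Suc_eq)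
  moreover have "(\<forall>u\<in>up v - {mm v}. i \<le> pos u) \<longleftrightarrow> (\<forall>u\<in>up v - {mm v}. Suc i \<le> pos u)" if "v \<in> L" for v
    using ne[OF that] by (auto simp: Suc_le_eq order.strict_iff_order)
  moreover have "\<not> pos (mm x) < Suc i" using up_pos[OF m(1)] x by simp
  ultimately show ?thesis using inv m unfolding scan_inv_def by auto
qed

text \<open>As a later neighbour of a star, \<open>x\<close> is no terminal, and neither is any
  vertex of \<open>up x\<close>, so \<open>x\<close> is inert. The pair recorded here is what
  \<open>linked_star\<close> retrieves when the second vertex of a star at \<open>x\<close> is
  reached.\<close>

lemma scan_inv_hub:
  assumes inv: "scan_inv i L mm dg s1 s2" and x: "x \<in> V" "pos x = i"
    and stars: "\<And>v. v \<in> L \<Longrightarrow> x \<in> up v \<Longrightarrow> mm v = x" and noT: "up x \<inter> T = {}"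
    and two: "s1 x \<in> L" "x \<in> up (s1 x)" "s2 x \<in> L" "x \<in> up (s2 x)" "s1 x \<noteq> s2 x"
  shows "scan_inv (Suc i) L mm dg s1 s2"
proof -
  have only: "v = x" if "v \<in> V" "pos v = i" for v using inj_pos that x by (auto simp: inj_on_def)
  have xL: "x \<notin> L" using inv x by (auto simp: scan_inv_def scanned_def)
  have xT: "x \<notin> T" using inv two scanned_star by (auto simp: scan_inv_def star_def)
  have "inert x" using noT xT by (auto simp: inert_def T_triangle_def)
  then have "scanned (Suc i) L" using inv only xL unfolding scan_inv_def scanned_def by (auto simp: less_Suc_eq)
  moreover have "s1 (mm v) \<noteq> s2 (mm v) \<and> s1 (mm v) \<in> L \<and> s2 (mm v) \<in> L \<and>
           mm (s1 (mm v)) = mm v \<and> mm (s2 (mm v)) = mm v \<and> (\<forall>u\<in>up v - {mm v}. Suc i \<le> pos u)"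
    if v: "v \<in> L" and p: "pos (mm v) < Suc i" for v
  proof (cases "mm v = x")
    case True
    have "Suc i \<le> pos u" if "u \<in> up v - {x}" for u
    proof -
      have "pos x \<le> pos u" using inv v True that by (auto simp: scan_inv_def)
      moreover have "pos u \<noteq> i" using only[of u] that up_V by auto
      ultimately show ?thesis using x by simp
    qed
    then show ?thesis using True two stars by auto
  next
    case False
    have "mm v \<in> V" using inv v up_V by (auto simp: scan_inv_def)
    then have p': "pos (mm v) < i" using only[of "mm v"] False p by (auto simp: less_Suc_eq)
    have "x \<notin> up v" using stars[OF v] False by auto
    then have "pos u \<noteq> i" if "u \<in> up v" for u using only[of u] that up_V by auto
    then show ?thesis using inv v p' by (auto simp: scan_inv_def Suc_le_eq order.strict_iff_order)
  qed
  ultimately show ?thesis using inv unfolding scan_inv_def by auto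
qed

text \<open>A star left over at the end would have its first later neighbour passed and all others
  still ahead. Nothing is ahead, contradicting its degree, so \<open>L\<close> is empty and every
  vertex is inert.\<close>

lemma scan_inv_final:
  assumes inv: "scan_inv i L mm dg s1 s2" and all: "\<And>v. v \<in> V \<Longrightarrow> pos v < i"
  shows "hits {}"
proof -
  have "v \<notin> L" for v
  proof
    assume v: "v \<in> L"
    then have m: "mm v \<in> up v" "pos (mm v) < i" using inv all up_V by (auto simp: scan_inv_def)
    have "u = mm v" if u: "u \<in> up v" for u
    proof (rule ccontr)
      assume "u \<noteq> mm v"
      then have "i \<le> pos u" using inv v m(2) u unfolding scan_inv_def by blast
      then show False using all[OF up_V[OF u]] by simp
    qed
    then have "card (up v) \<le> card {mm v}" by (intro card_mono) auto
    then show False using inv v scanned_star[of i L v] by (auto simp: scan_inv_def star_def)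
  qed
  then have "inert v" if "v \<in> V" for v using inv all[OF that] that by (auto simp: scan_inv_def scanned_def)
  then show ?thesis by (auto simp: hits_def inert_def T_triangle_def)
qed

lemma first_star_rest:
  assumes inv: "scan_inv i L mm dg s1 s2" and v: "v \<in> L" "mm v = x"
  shows "up v - {x} \<subseteq> up x"
proof
  fix u assume u: "u \<in> up v - {x}"
  have m: "x \<in> up v" "pos x \<le> pos u" "v \<in> V" using inv v u by (auto simp: scan_inv_def scanned_def)
  then have "pos x < pos u" using u up_linear[of x v u] by auto
  then show "u \<in> up x" using up_clique[OF m(3) m(1)] u by auto
qed

text \<open>\<open>w\<close> lies before position \<open>i\<close>, so it was passed over and two
  stars were recorded at it, one of which is not \<open>v\<close>. By the invariant the other later
  neighbours of these stars are not before \<open>x\<close>, and the clique \<open>up w\<close> then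
  places those different from \<open>x\<close> into \<open>up x\<close>.\<close>

lemma linked_star:
  assumes inv: "scan_inv i L mm dg s1 s2" and x: "x \<in> V" "pos x = i" and v: "v \<in> L" "x \<in> up v" "mm v \<noteq> x"
    and w: "w = mm v" and v2: "v2 = (if s1 w = v then s2 w else s1 w)"
  shows "v2 \<in> L" "v \<noteq> v2" "w \<in> up v2" "w \<in> up v" "w \<noteq> x" "up v - {x, w} \<subseteq> up x"
    "x \<notin> up v2 \<Longrightarrow> up v2 - {w} \<subseteq> up x"
proof -
  have vV: "v \<in> V" and m: "w \<in> up v" "\<And>u. u \<in> up v \<Longrightarrow> pos w \<le> pos u" using inv v w by (auto simp: scan_inv_def scanned_def)
  have wV: "w \<in> V" using up_V[OF m(1)] .
  have "pos w \<noteq> pos x" using inj_pos wV x v(3) w by (auto simp: inj_on_def)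
  then have p: "pos w < i" using m(2)[OF v(2)] x by simp
  have h: "s1 w \<noteq> s2 w" "s1 w \<in> L" "s2 w \<in> L" "mm (s1 w) = w" "mm (s2 w) = w" "\<And>u. u \<in> up v - {w} \<Longrightarrow> i \<le> pos u"
    using inv v p w by (auto simp: scan_inv_def)
  show v2L: "v2 \<in> L" and "v \<noteq> v2" using h v2 by auto
  have mv2: "mm v2 = w" using h v2 by auto
  show wv2: "w \<in> up v2" using inv v2L mv2 by (auto simp: scan_inv_def)
  show "w \<in> up v" "w \<noteq> x" using m v w by auto
  have rest: "u \<in> up x" if "u \<in> up w" "i \<le> pos u" "u \<noteq> x" for u
  proof -
    have "pos u \<noteq> pos x" using inj_pos up_V[OF that(1)] x that(3) by (auto simp: inj_on_def)
    moreover have "x \<in> up w" using up_clique[OF vV m(1) v(2)] p x by simp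
    ultimately show ?thesis using up_clique[OF wV, of x u] that x by simp
  qed
  show "up v - {x, w} \<subseteq> up x"
  proof
    fix u assume u: "u \<in> up v - {x, w}"
    then have "i \<le> pos u" using h(6) by auto
    moreover have "u \<in> up w" using up_clique[OF vV m(1), of u] u calculation p by auto
    ultimately show "u \<in> up x" using rest u by auto
  qed
  assume nx: "x \<notin> up v2"
  show "up v2 - {w} \<subseteq> up x"
  proof
    fix u assume u: "u \<in> up v2 - {w}"
    have "pos (mm v2) < i" using mv2 p by simp
    then have "i \<le> pos u" using inv v2L u mv2 unfolding scan_inv_def by blast
    moreover have "v2 \<in> V" using inv v2L by (auto simp: scan_inv_def scanned_def)
    then have "u \<in> up w" using up_clique[of v2 w u] wv2 u calculation p by auto
    ultimately show "u \<in> up x" using rest u nx by auto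
  qed
qed

end

section \<open>A programming language with arrays\<close>

text \<open>
  \<open>IN\<close> is a copy of the input and \<open>ST\<close> locates the adjacency lists in it; \<open>HD\<close>, \<open>CV\<close>, \<open>CN\<close>, \<open>CT\<close>
  belong to the maximum cardinality search, which leaves the order in \<open>PO\<close> and its inverse in \<open>OD\<close>;
  \<open>SN\<close> is the stack of subproblems and \<open>DE\<close> the deletion flags of the current one; \<open>LF\<close> marks the stars,
  and \<open>MM\<close>, \<open>DG\<close>, \<open>S1\<close>, \<open>S2\<close> are the functions of \<open>scan_inv\<close>.
\<close>

datatype reg = RES | NN | KK | SP | KC | XX | II | PP | EE | UU | VV | WW | V2 | V3 | TT | DD | MN | CS
  | SA | SB | SW | SZ | JJ | FP | CC | BR | QQ

datatype arr = IN | ST | HD | CV | CN | CT | PO | OD | SN | DE | LF | MM | DG | S1 | S2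

definition reg_list :: "reg list" where
  "reg_list = [RES, NN, KK, SP, KC, XX, II, PP, EE, UU, VV, WW, V2, V3, TT, DD, MN, CS,
     SA, SB, SW, SZ, JJ, FP, CC, BR, QQ]"

definition arr_list :: "arr list" where
  "arr_list = [IN, ST, HD, CV, CN, CT, PO, OD, SN, DE, LF, MM, DG, S1, S2]"

text \<open>Reading the index off a list makes injectivity a matter of looking the index up again,
  without comparing all pairs of constructors.\<close>

definition reg_index :: "reg \<Rightarrow> nat" where
  "reg_index r = (LEAST i. i < length reg_list \<and> reg_list ! i = r)"

definition arr_index :: "arr \<Rightarrow> nat" where
  "arr_index a = (LEAST i. i < length arr_list \<and> arr_list ! i = a)"

lemma reg_list_index: "reg_index r < length reg_list \<and> reg_list ! reg_index r = r"
proof -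
  have "r \<in> set reg_list" by (cases r) (simp_all add: reg_list_def)
  then have "\<exists>i. i < length reg_list \<and> reg_list ! i = r" by (auto simp: in_set_conv_nth)
  then show ?thesis unfolding reg_index_def by (rule LeastI_ex)
qed

lemma arr_list_index: "arr_index a < length arr_list \<and> arr_list ! arr_index a = a"
proof -
  have "a \<in> set arr_list" by (cases a) (simp_all add: arr_list_def)
  then have "\<exists>i. i < length arr_list \<and> arr_list ! i = a" by (auto simp: in_set_conv_nth)
  then show ?thesis unfolding arr_index_def by (rule LeastI_ex)
qed

lemma reg_index_eq_iff [simp]: "reg_index r = reg_index r' \<longleftrightarrow> r = r'"
  by (metis reg_list_index)

lemma arr_index_eq_iff [simp]: "arr_index a = arr_index a' \<longleftrightarrow> a = a'"
  by (metis arr_list_index)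

lemma arr_index_less: "arr_index a < 16"
  using arr_list_index[of a] by (simp add: arr_list_def)

text \<open>\<open>accepts\<close> inspects machine register 0.\<close>

lemma reg_index_RES: "reg_index RES = 0"
  unfolding reg_index_def by (rule Least_equality) (simp_all add: reg_list_def)

datatype ex = Num nat | Var reg | Elt arr ex | Plus ex ex | Minus ex ex

datatype tst = Below ex ex | Fails tst | Both tst tst

datatype prog =
    Nop
  | Set_Reg reg ex  ("_ ::= _" [70, 65] 61)
  | Set_Elt arr ex ex  ("_\<langle>_\<rangle> ::= _" [70, 0, 65] 61)
  | Then prog prog  (infixr ";;" 60)
  | Branch tst prog prog  ("(IF _/ THEN _/ ELSE _)" [0, 0, 61] 61)
  | Loop tst prog  ("(WHILE _/ DO _)" [0, 61] 61)

fun ev :: "ex \<Rightarrow> (reg \<Rightarrow> nat) \<Rightarrow> (arr \<Rightarrow> nat \<Rightarrow> nat) \<Rightarrow> nat" where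
  "ev (Num k) R A = k"
| "ev (Var r) R A = R r"
| "ev (Elt a e) R A = A a (ev e R A)"
| "ev (Plus e e') R A = ev e R A + ev e' R A"
| "ev (Minus e e') R A = ev e R A - ev e' R A"

fun holds :: "tst \<Rightarrow> (reg \<Rightarrow> nat) \<Rightarrow> (arr \<Rightarrow> nat \<Rightarrow> nat) \<Rightarrow> bool" where
  "holds (Below e e') R A \<longleftrightarrow> ev e R A < ev e' R A"
| "holds (Fails b) R A \<longleftrightarrow> \<not> holds b R A"
| "holds (Both b b') R A \<longleftrightarrow> holds b R A \<and> holds b' R A"

text \<open>Only loop iterations are charged; all other steps are absorbed by the constant in \<open>compile_correct\<close>.\<close>

inductive runs :: "prog \<Rightarrow> (reg \<Rightarrow> nat) \<Rightarrow> (arr \<Rightarrow> nat \<Rightarrow> nat) \<Rightarrow> nat \<Rightarrow>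
    (reg \<Rightarrow> nat) \<Rightarrow> (arr \<Rightarrow> nat \<Rightarrow> nat) \<Rightarrow> bool" where
  Nop: "runs Nop R A 0 R A"
| Set_Reg: "runs (r ::= e) R A 0 (R(r := ev e R A)) A"
| Set_Elt: "runs (a\<langle>i\<rangle> ::= e) R A 0 R (A(a := (A a)(ev i R A := ev e R A)))"
| Then: "runs c R A t R' A' \<Longrightarrow> runs c' R' A' t' R'' A'' \<Longrightarrow> runs (c ;; c') R A (t + t') R'' A''"
| Branch_True: "holds b R A \<Longrightarrow> runs c R A t R' A' \<Longrightarrow> runs (IF b THEN c ELSE c') R A t R' A'"
| Branch_False: "\<not> holds b R A \<Longrightarrow> runs c' R A t R' A' \<Longrightarrow> runs (IF b THEN c ELSE c') R A t R' A'"
| Loop_False: "\<not> holds b R A \<Longrightarrow> runs (WHILE b DO c) R A 0 R A"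
| Loop_True: "holds b R A \<Longrightarrow> runs c R A t R' A' \<Longrightarrow> runs (WHILE b DO c) R' A' t' R'' A'' \<Longrightarrow>
    runs (WHILE b DO c) R A (Suc (t + t')) R'' A''"

subsection \<open>Compilation to the random access machine\<close>

text \<open>The machine cannot multiply, but a stride of 16, enough for the 15 arrays, needs only
  four doublings. They copy the index expression 16 times, a constant factor fixed by the program
  text.\<close>

definition times16 :: "aexp \<Rightarrow> aexp" where
  "times16 e = (let d = (\<lambda>e. Add e e) in d (d (d (d e))))"

lemma aval_times16 [simp]: "aval (times16 e) s = 16 * aval e s"
  by (simp add: times16_def Let_def)

definition address :: "arr \<Rightarrow> aexp \<Rightarrow> aexp" where
  "address a e = Add (Reg 1) (Add (Const (arr_index a)) (times16 e))"

text \<open>Even machine registers hold the program variables; odd ones stay free for the base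
  address (1) and the counter of the copy loop (3).\<close>

fun compile_ex :: "ex \<Rightarrow> aexp" where
  "compile_ex (Num k) = Const k"
| "compile_ex (Var r) = Reg (2 * reg_index r)"
| "compile_ex (Elt a e) = Mem (address a (compile_ex e))"
| "compile_ex (Plus e e') = Add (compile_ex e) (compile_ex e')"
| "compile_ex (Minus e e') = Sub (compile_ex e) (compile_ex e')"

fun compile_tst :: "tst \<Rightarrow> bexp" where
  "compile_tst (Below e e') = Less (compile_ex e) (compile_ex e')"
| "compile_tst (Fails b) = Neg (compile_tst b)"
| "compile_tst (Both b b') = Conj (compile_tst b) (compile_tst b')"

fun compile :: "prog \<Rightarrow> com" where
  "compile Nop = Skip"
| "compile (r ::= e) = Assign (2 * reg_index r) (compile_ex e)"
| "compile (a\<langle>i\<rangle> ::= e) = Store (address a (compile_ex i)) (compile_ex e)"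
| "compile (c ;; c') = Seq (compile c) (compile c')"
| "compile (IF b THEN c ELSE c') = Cond (compile_tst b) (compile c) (compile c')"
| "compile (WHILE b DO c) = While (compile_tst b) (compile c)"

text \<open>Register 1 holds the base address \<open>B\<close> of the interleaved arrays.\<close>

definition represents :: "nat \<Rightarrow> (reg \<Rightarrow> nat) \<Rightarrow> (arr \<Rightarrow> nat \<Rightarrow> nat) \<Rightarrow> state \<Rightarrow> bool" where
  "represents B R A s \<longleftrightarrow> fst s 1 = B \<and> (\<forall>r. fst s (2 * reg_index r) = R r) \<and>
     (\<forall>a i. snd s (B + (arr_index a + 16 * i)) = A a i)"

lemma array_address_eq_iff:
  "B + (arr_index a + 16 * i) = B + (arr_index a' + 16 * i') \<longleftrightarrow> a = a' \<and> i = i'"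
proof
  assume "B + (arr_index a + 16 * i) = B + (arr_index a' + 16 * i')"
  then have *: "arr_index a + 16 * i = arr_index a' + 16 * i'" by simp
  then have "(arr_index a + 16 * i) mod 16 = (arr_index a' + 16 * i') mod 16" by simp
  then have "arr_index a = arr_index a'" using arr_index_less[of a] arr_index_less[of a'] by simp
  with * show "a = a' \<and> i = i'" by simp
qed simp

lemma compile_ex_correct:
  "represents B R A s \<Longrightarrow> aval (compile_ex e) s = ev e R A"
  by (induction e) (auto simp: represents_def address_def)

lemma compile_tst_correct:
  "represents B R A s \<Longrightarrow> bval (compile_tst b) s = holds b R A"
  by (induction b) (auto simp: compile_ex_correct)

fun step_cost :: "prog \<Rightarrow> nat" where
  "step_cost Nop = 1"
| "step_cost (r ::= e) = 1 + acost (compile_ex e)"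
| "step_cost (a\<langle>i\<rangle> ::= e) = 1 + acost (address a (compile_ex i)) + acost (compile_ex e)"
| "step_cost (c ;; c') = 1 + step_cost c + step_cost c'"
| "step_cost (IF b THEN c ELSE c') = 1 + bcost (compile_tst b) + step_cost c + step_cost c'"
| "step_cost (WHILE b DO c) = 1 + bcost (compile_tst b) + step_cost c"

lemma mult_Suc_add_le:
  fixes a b x y :: nat
  shows "a * Suc x + b * Suc y \<le> (a + b) * Suc (x + y)"
  by (simp add: algebra_simps)

text \<open>\<open>step_cost\<close> counts every node of the program once and so bounds the work
  between two charged iterations. The successor of \<open>t\<close> pays for what runs outside of
  iterations, such as the failing last test of a loop.\<close>

lemma compile_correct:
  "runs c R A t R' A' \<Longrightarrow> represents B R A s \<Longrightarrow>
   \<exists>t' s'. exec (compile c) s t' s' \<and> represents B R' A' s' \<and> t' \<le> step_cost c * Suc t"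
proof (induction arbitrary: s rule: runs.induct)
  case (Nop R A)
  then show ?case using exec.Skip[of s] by fastforce
next
  case (Set_Reg r e R A)
  let ?s = "((fst s)(2 * reg_index r := aval (compile_ex e) s), snd s)"
  have "represents B (R(r := ev e R A)) A ?s"
    using Set_Reg compile_ex_correct[OF Set_Reg, of e] by (auto simp: represents_def)
  then show ?case using exec.Assign[of "2 * reg_index r" "compile_ex e" s] by fastforce
next
  case (Set_Elt a i e R A)
  let ?s = "(fst s, (snd s)(aval (address a (compile_ex i)) s := aval (compile_ex e) s))"
  have *: "aval (address a (compile_ex i)) s = B + (arr_index a + 16 * ev i R A)"
    using Set_Elt compile_ex_correct[OF Set_Elt, of i] by (simp add: address_def represents_def)
  have "represents B R (A(a := (A a)(ev i R A := ev e R A))) ?s"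
    unfolding * using Set_Elt compile_ex_correct[OF Set_Elt, of e]
    unfolding represents_def fst_conv snd_conv fun_upd_apply array_address_eq_iff by auto
  then show ?case using exec.Store[of "address a (compile_ex i)" "compile_ex e" s] by fastforce
next
  case (Then c R A t R' A' c' t' R'' A'')
  obtain u s' where 1: "exec (compile c) s u s'" "represents B R' A' s'" "u \<le> step_cost c * Suc t"
    using Then.IH(1)[OF Then.prems] by blast
  obtain u' s'' where 2: "exec (compile c') s' u' s''" "represents B R'' A'' s''" "u' \<le> step_cost c' * Suc t'"
    using Then.IH(2)[OF 1(2)] by blast
  have "1 + u + u' \<le> step_cost (c ;; c') * Suc (t + t')"
    using 1(3) 2(3) mult_Suc_add_le[of "step_cost c" t "step_cost c'" t'] by (simp add: algebra_simps)
  moreover have "exec (compile (c ;; c')) s (1 + u + u') s''" using exec.Seq[OF 1(1) 2(1)] by simp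
  ultimately show ?case using 2(2) by blast
next
  case (Branch_True b R A c t R' A' c')
  obtain u s' where 1: "exec (compile c) s u s'" "represents B R' A' s'" "u \<le> step_cost c * Suc t"
    using Branch_True.IH[OF Branch_True.prems] by blast
  have "bval (compile_tst b) s" using Branch_True.hyps Branch_True.prems compile_tst_correct by blast
  then have "exec (compile (IF b THEN c ELSE c')) s (1 + bcost (compile_tst b) + u) s'"
    using exec.CondTrue[OF _ 1(1)] by simp
  moreover have "1 + bcost (compile_tst b) + u \<le> step_cost (IF b THEN c ELSE c') * Suc t"
    using 1(3) by (simp add: algebra_simps)
  ultimately show ?case using 1(2) by blast
next
  case (Branch_False b R A c' t R' A' c)
  obtain u s' where 1: "exec (compile c') s u s'" "represents B R' A' s'" "u \<le> step_cost c' * Suc t"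
    using Branch_False.IH[OF Branch_False.prems] by blast
  have "\<not> bval (compile_tst b) s" using Branch_False.hyps Branch_False.prems compile_tst_correct by blast
  then have "exec (compile (IF b THEN c ELSE c')) s (1 + bcost (compile_tst b) + u) s'"
    using exec.CondFalse[OF _ 1(1)] by simp
  moreover have "1 + bcost (compile_tst b) + u \<le> step_cost (IF b THEN c ELSE c') * Suc t"
    using 1(3) by (simp add: algebra_simps)
  ultimately show ?case using 1(2) by blast
next
  case (Loop_False b R A c)
  have "\<not> bval (compile_tst b) s" using Loop_False compile_tst_correct by blast
  from exec.WhileFalse[OF this, of "compile c"] Loop_False.prems show ?case by fastforce
next
  case (Loop_True b R A c t R' A' t' R'' A'')
  obtain u s' where 1: "exec (compile c) s u s'" "represents B R' A' s'" "u \<le> step_cost c * Suc t"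
    using Loop_True.IH(1)[OF Loop_True.prems] by blast
  obtain u' s'' where 2: "exec (compile (WHILE b DO c)) s' u' s''" "represents B R'' A'' s''"
      "u' \<le> step_cost (WHILE b DO c) * Suc t'"
    using Loop_True.IH(2)[OF 1(2)] by blast
  have "bval (compile_tst b) s" using Loop_True.hyps Loop_True.prems compile_tst_correct by blast
  then have "exec (compile (WHILE b DO c)) s (1 + bcost (compile_tst b) + u + u') s''"
    using exec.WhileTrue[OF _ 1(1)] 2(1) by simp
  moreover have "1 + bcost (compile_tst b) + u + u' \<le> step_cost (WHILE b DO c) * Suc (Suc (t + t'))"
    using 1(3) 2(3) by (simp add: algebra_simps)
  ultimately show ?case using 2(2) by blast
qed

subsection \<open>Weakest preconditions with time credits\<close>

text \<open>\<open>Q\<close> receives the unspent credits, so amortised time bounds become ordinary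
  assertions.\<close>

definition wp :: "prog \<Rightarrow> ((reg \<Rightarrow> nat) \<Rightarrow> (arr \<Rightarrow> nat \<Rightarrow> nat) \<Rightarrow> nat \<Rightarrow> bool) \<Rightarrow>
    (reg \<Rightarrow> nat) \<Rightarrow> (arr \<Rightarrow> nat \<Rightarrow> nat) \<Rightarrow> nat \<Rightarrow> bool" where
  "wp c Q R A f \<longleftrightarrow> (\<exists>t R' A'. runs c R A t R' A' \<and> t \<le> f \<and> Q R' A' (f - t))"

inductive_cases NopE: "runs Nop R A t R' A'"
  and Set_RegE: "runs (r ::= e) R A t R' A'"
  and Set_EltE: "runs (a\<langle>i\<rangle> ::= e) R A t R' A'"
  and ThenE: "runs (c ;; c') R A t R' A'"
  and BranchE: "runs (IF b THEN c ELSE c') R A t R' A'"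

lemma wp_immediate:
  assumes "runs c R A 0 R' A'" "\<And>t R'' A''. runs c R A t R'' A'' \<Longrightarrow> t = 0 \<and> R'' = R' \<and> A'' = A'"
  shows "wp c Q R A f \<longleftrightarrow> Q R' A' f"
  unfolding wp_def using assms by (metis diff_zero le0)

lemma wp_Nop [simp]: "wp Nop Q R A f \<longleftrightarrow> Q R A f"
  by (rule wp_immediate[OF runs.Nop]) (auto elim: NopE)

lemma wp_Set_Reg [simp]: "wp (r ::= e) Q R A f \<longleftrightarrow> Q (R(r := ev e R A)) A f"
  by (rule wp_immediate[OF runs.Set_Reg]) (auto elim: Set_RegE)

lemma wp_Set_Elt [simp]:
  "wp (a\<langle>i\<rangle> ::= e) Q R A f \<longleftrightarrow> Q R (A(a := (A a)(ev i R A := ev e R A))) f"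
  by (rule wp_immediate[OF runs.Set_Elt]) (auto elim: Set_EltE)

lemma wp_Then [simp]: "wp (c ;; c') Q R A f \<longleftrightarrow> wp c (wp c' Q) R A f"
proof
  assume "wp (c ;; c') Q R A f"
  then obtain t R1 A1 t' R' A' where "runs c R A t R1 A1" "runs c' R1 A1 t' R' A'" "t + t' \<le> f" "Q R' A' (f - (t + t'))"
    unfolding wp_def by (blast elim: ThenE)
  then show "wp c (wp c' Q) R A f" unfolding wp_def
    by (intro exI[of _ t] exI[of _ R1] exI[of _ A1] conjI exI[of _ t'] exI[of _ R'] exI[of _ A']) auto
next
  assume "wp c (wp c' Q) R A f"
  then obtain t R1 A1 t' R' A' where "runs c R A t R1 A1" "runs c' R1 A1 t' R' A'" "t \<le> f" "t' \<le> f - t" "Q R' A' (f - t - t')"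
    unfolding wp_def by blast
  then show "wp (c ;; c') Q R A f" unfolding wp_def
    by (intro exI[of _ "t + t'"] exI[of _ R'] exI[of _ A'] conjI) (auto intro: runs.Then)
qed

lemma wp_Then_fun: "wp (c ;; c') Q = wp c (wp c' Q)"
  by (intro ext) simp

lemma wp_Branch [simp]:
  "wp (IF b THEN c ELSE c') Q R A f \<longleftrightarrow> (if holds b R A then wp c Q R A f else wp c' Q R A f)"
  unfolding wp_def by (auto elim!: BranchE intro: runs.intros)

lemma wp_mono:
  "wp c Q R A f \<Longrightarrow> (\<And>R' A' f'. Q R' A' f' \<Longrightarrow> f' \<le> f \<Longrightarrow> Q' R' A' f') \<Longrightarrow> wp c Q' R A f"
  unfolding wp_def by (meson diff_le_self)

text \<open>Every iteration gives up a credit, so the credits also serve as the termination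
  measure.\<close>

lemma wp_Loop:
  assumes init: "I R A f"
    and body: "\<And>R A f. I R A f \<Longrightarrow> holds b R A \<Longrightarrow> \<exists>g. f = Suc g \<and> wp c I R A g"
    and final: "\<And>R A f. I R A f \<Longrightarrow> \<not> holds b R A \<Longrightarrow> Q R A f"
  shows "wp (WHILE b DO c) Q R A f"
  using init
proof (induction f arbitrary: R A rule: less_induct)
  case (less f)
  show ?case
  proof (cases "holds b R A")
    case False
    then show ?thesis using final[OF less.prems False] runs.Loop_False[OF False, of c]
      unfolding wp_def by (intro exI[of _ 0] exI[of _ R] exI[of _ A]) auto
  next
    case True
    obtain g where g: "f = Suc g" "wp c I R A g" using body[OF less.prems True] by blast
    then obtain t R' A' where 1: "runs c R A t R' A'" "t \<le> g" "I R' A' (g - t)" unfolding wp_def by blast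
    have "wp (WHILE b DO c) Q R' A' (g - t)" using less.IH[of "g - t"] 1 g by auto
    then obtain t' R'' A'' where 2: "runs (WHILE b DO c) R' A' t' R'' A''" "t' \<le> g - t" "Q R'' A'' (g - t - t')"
      unfolding wp_def by blast
    have "runs (WHILE b DO c) R A (Suc (t + t')) R'' A''" using runs.Loop_True[OF True 1(1) 2(1)] .
    then show ?thesis unfolding wp_def g using 1 2
      by (intro exI[of _ "Suc (t + t')"] exI[of _ R''] exI[of _ A'']) auto
  qed
qed

fun reg_writes :: "prog \<Rightarrow> reg set" where
  "reg_writes Nop = {}"
| "reg_writes (r ::= e) = {r}"
| "reg_writes (a\<langle>i\<rangle> ::= e) = {}"
| "reg_writes (c ;; c') = reg_writes c \<union> reg_writes c'"
| "reg_writes (IF b THEN c ELSE c') = reg_writes c \<union> reg_writes c'"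
| "reg_writes (WHILE b DO c) = reg_writes c"

fun arr_writes :: "prog \<Rightarrow> arr set" where
  "arr_writes Nop = {}"
| "arr_writes (r ::= e) = {}"
| "arr_writes (a\<langle>i\<rangle> ::= e) = {a}"
| "arr_writes (c ;; c') = arr_writes c \<union> arr_writes c'"
| "arr_writes (IF b THEN c ELSE c') = arr_writes c \<union> arr_writes c'"
| "arr_writes (WHILE b DO c) = arr_writes c"

text \<open>A syntactic frame condition: invariants have to mention only what the code
  writes.\<close>

definition same_off :: "prog \<Rightarrow> (reg \<Rightarrow> nat) \<Rightarrow> (arr \<Rightarrow> nat \<Rightarrow> nat) \<Rightarrow>
    (reg \<Rightarrow> nat) \<Rightarrow> (arr \<Rightarrow> nat \<Rightarrow> nat) \<Rightarrow> bool" where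
  "same_off c R A R' A' \<longleftrightarrow> (\<forall>r. r \<notin> reg_writes c \<longrightarrow> R' r = R r) \<and> (\<forall>a. a \<notin> arr_writes c \<longrightarrow> A' a = A a)"

lemma runs_same_off: "runs c R A t R' A' \<Longrightarrow> same_off c R A R' A'"
  by (induction rule: runs.induct) (auto simp: same_off_def)

lemma wp_frame:
  assumes "wp c (\<lambda>R' A' f'. same_off c R A R' A' \<longrightarrow> Q R' A' f') R A f"
  shows "wp c Q R A f"
  using assms runs_same_off unfolding wp_def by blast

lemma wp_conseq:
  assumes "wp c Q R A f"
    and "\<And>R' A' f'. Q R' A' f' \<Longrightarrow> f' \<le> f \<Longrightarrow> same_off c R A R' A' \<Longrightarrow> Q' R' A' f'"
  shows "wp c Q' R A f"
  by (rule wp_frame, rule wp_mono[OF assms(1)]) (use assms(2) in blast)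

section \<open>Loops over index ranges and adjacency lists\<close>

definition count_loop :: "reg \<Rightarrow> ex \<Rightarrow> prog \<Rightarrow> prog" where
  "count_loop r b c = (WHILE Below (Var r) b DO (c ;; r ::= Plus (Var r) (Num 1)))"

lemma same_off_refl: "same_off c R A R A" by (simp add: same_off_def)

lemma wp_count_loop:
  assumes r: "r \<notin> reg_writes c" and start: "R r = m" "m \<le> N"
    and bound: "\<And>R' A'. same_off (count_loop r b c) R A R' A' \<Longrightarrow> ev b R' A' = N"
    and init: "I m R A f"
    and step: "\<And>i R' A' g. \<lbrakk>m \<le> i; i < N; R' r = i; I i R' A' (Suc g); same_off (count_loop r b c) R A R' A'\<rbrakk>
      \<Longrightarrow> wp c (\<lambda>R'' A'' f''. I (Suc i) (R''(r := Suc i)) A'' f'') R' A' g"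
    and cost: "\<And>i R' A' f'. I i R' A' f' \<Longrightarrow> i < N \<Longrightarrow> 0 < f'"
    and final: "\<And>R' A' f'. \<lbrakk>R' r = N; I N R' A' f'; same_off (count_loop r b c) R A R' A'\<rbrakk> \<Longrightarrow> Q R' A' f'"
  shows "wp (count_loop r b c) Q R A f"
  unfolding count_loop_def
proof (rule wp_Loop[where I = "\<lambda>R' A' f'. m \<le> R' r \<and> R' r \<le> N \<and> I (R' r) R' A' f' \<and> same_off (count_loop r b c) R A R' A'"])
  show "m \<le> R r \<and> R r \<le> N \<and> I (R r) R A f \<and> same_off (count_loop r b c) R A R A"
    using start init by (simp add: same_off_refl)
next
  fix R' A' f'
  assume I: "m \<le> R' r \<and> R' r \<le> N \<and> I (R' r) R' A' f' \<and> same_off (count_loop r b c) R A R' A'"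
    and h: "holds (Below (Var r) b) R' A'"
  have lt: "R' r < N" using h bound I by simp
  then obtain g where g: "f' = Suc g" using cost I by (metis gr0_implies_Suc)
  have "wp c (\<lambda>R'' A'' f''. I (Suc (R' r)) (R''(r := Suc (R' r))) A'' f'') R' A' g"
    using step[of "R' r" R' A' g] I lt g by simp
  then have "wp (c ;; r ::= Plus (Var r) (Num 1))
     (\<lambda>R' A' f'. m \<le> R' r \<and> R' r \<le> N \<and> I (R' r) R' A' f' \<and> same_off (count_loop r b c) R A R' A') R' A' g"
    unfolding wp_Then wp_Set_Reg
  proof (rule wp_conseq)
    fix R'' A'' f''
    assume 1: "I (Suc (R' r)) (R''(r := Suc (R' r))) A'' f''" and so: "same_off c R' A' R'' A''"
    have "R'' r = R' r" using so r by (simp add: same_off_def)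
    moreover have "same_off (count_loop r b c) R A (R''(r := Suc (R' r))) A''"
      using so I by (auto simp: same_off_def count_loop_def)
    ultimately show "m \<le> (R''(r := ev (Plus (Var r) (Num 1)) R'' A'')) r \<and> (R''(r := ev (Plus (Var r) (Num 1)) R'' A'')) r \<le> N \<and>
       I ((R''(r := ev (Plus (Var r) (Num 1)) R'' A'')) r) (R''(r := ev (Plus (Var r) (Num 1)) R'' A'')) A'' f'' \<and>
       same_off (count_loop r b c) R A (R''(r := ev (Plus (Var r) (Num 1)) R'' A'')) A''"
      using 1 lt I by simp
  qed
  then show "\<exists>g. f' = Suc g \<and> wp (c ;; r ::= Plus (Var r) (Num 1))
     (\<lambda>R' A' f'. m \<le> R' r \<and> R' r \<le> N \<and> I (R' r) R' A' f' \<and> same_off (count_loop r b c) R A R' A') R' A' g"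
    using g by blast
next
  fix R' A' f'
  assume I: "m \<le> R' r \<and> R' r \<le> N \<and> I (R' r) R' A' f' \<and> same_off (count_loop r b c) R A R' A'"
    and h: "\<not> holds (Below (Var r) b) R' A'"
  have "R' r = N" using h bound I by fastforce
  then show "Q R' A' f'" using final I by auto
qed

text \<open>\<open>ST\<close> points at the length cell in front of the list. \<open>PP\<close>
  starts there and is advanced before each read, so the last neighbour is read when
  \<open>PP\<close> equals \<open>EE\<close>.\<close>

definition scan_nbrs :: "reg \<Rightarrow> prog \<Rightarrow> prog" where
  "scan_nbrs x c = (PP ::= Elt ST (Var x) ;; EE ::= Plus (Var PP) (Elt IN (Var PP)) ;;
     (WHILE Below (Var PP) (Var EE) DO (PP ::= Plus (Var PP) (Num 1) ;; UU ::= Elt IN (Var PP) ;; c)))"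

lemma writes_scan_nbrs [simp]:
  "reg_writes (scan_nbrs x c) = {PP, EE, UU} \<union> reg_writes c" "arr_writes (scan_nbrs x c) = arr_writes c"
  by (auto simp: scan_nbrs_def)

lemma writes_count_loop [simp]:
  "reg_writes (count_loop r b c) = insert r (reg_writes c)" "arr_writes (count_loop r b c) = arr_writes c"
  by (auto simp: count_loop_def)

locale input_graph =
  fixes n k :: nat and E :: "nat set set" and T :: "nat set" and nbr :: "nat list list"
  assumes chordal: "chordal_graph {0..<n} E" and T: "T \<subseteq> {0..<n}" and nbr: "adjacency_lists n E nbr"
begin

text \<open>The 3 skips the header of the input: \<open>n\<close>, the number of edges and
  \<open>k\<close>.\<close>

definition loaded :: "(arr \<Rightarrow> nat \<Rightarrow> nat) \<Rightarrow> bool" where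
  "loaded A \<longleftrightarrow> (\<forall>v<n. A IN (3 + v) = (if v \<in> T then 1 else 0)) \<and>
     (\<forall>v<n. A IN (A ST v) = length (nbr ! v) \<and> (\<forall>i<length (nbr ! v). A IN (A ST v + Suc i) = nbr ! v ! i))"

lemma loaded_cong: "loaded A \<Longrightarrow> A' IN = A IN \<Longrightarrow> A' ST = A ST \<Longrightarrow> loaded A'"
  by (simp add: loaded_def)

lemma simple: "simple_graph {0..<n} E" using chordal by (simp add: chordal_graph_def)

lemma set_nbr: "v < n \<Longrightarrow> set (nbr ! v) = {u. adjacent E v u}"
  using nbr by (simp add: adjacency_lists_def adjacent_def)

lemma distinct_nbr: "v < n \<Longrightarrow> distinct (nbr ! v)"
  using nbr by (simp add: adjacency_lists_def)

lemma nbr_less: "v < n \<Longrightarrow> u \<in> set (nbr ! v) \<Longrightarrow> u < n"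
  using set_nbr simple_graph_adjacent[OF simple] by fastforce

lemma length_nbr_le: "v < n \<Longrightarrow> length (nbr ! v) \<le> n"
proof -
  assume v: "v < n"
  have "card (set (nbr ! v)) \<le> card {0..<n}" using nbr_less[OF v] by (intro card_mono) auto
  then show ?thesis using distinct_card[OF distinct_nbr[OF v]] by simp
qed

lemma wp_scan_nbrs:
  assumes ld: "loaded A" and v: "R x = v" "v < n"
    and c: "PP \<notin> reg_writes c" "EE \<notin> reg_writes c" "IN \<notin> arr_writes c" "ST \<notin> arr_writes c"
    and init: "\<And>p e. I [] (R(PP := p, EE := e)) A f"
    and step: "\<And>ys u zs R' A' g p. \<lbrakk>nbr ! v = ys @ u # zs; I ys R' A' (Suc g); same_off (scan_nbrs x c) R A R' A'\<rbrakk>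
      \<Longrightarrow> wp c (I (ys @ [u])) (R'(PP := p, UU := u)) A' g"
    and cost: "\<And>ys R' A' f'. I ys R' A' f' \<Longrightarrow> length ys < length (nbr ! v) \<Longrightarrow> 0 < f'"
    and final: "\<And>R' A' f'. \<lbrakk>I (nbr ! v) R' A' f'; same_off (scan_nbrs x c) R A R' A'\<rbrakk> \<Longrightarrow> Q R' A' f'"
  shows "wp (scan_nbrs x c) Q R A f"
proof -
  let ?xs = "nbr ! v" and ?s = "A ST v"
  define J where "J = (\<lambda>R' A' f'. \<exists>i\<le>length ?xs. R' PP = ?s + i \<and> R' EE = ?s + length ?xs \<and> I (take i ?xs) R' A' f' \<and>
      same_off (scan_nbrs x c) R A R' A')"
  let ?R = "R(PP := ?s, EE := ?s + length ?xs)"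
  have IN: "A IN ?s = length ?xs" "\<And>i. i < length ?xs \<Longrightarrow> A IN (?s + Suc i) = ?xs ! i"
    using ld v by (auto simp: loaded_def)
  have "wp (WHILE Below (Var PP) (Var EE) DO (PP ::= Plus (Var PP) (Num 1) ;; UU ::= Elt IN (Var PP) ;; c)) Q ?R A f"
  proof (rule wp_Loop[where I = J])
    show "J ?R A f" unfolding J_def using init[of ?s "?s + length ?xs"]
      by (intro exI[of _ 0]) (auto simp: same_off_def)
  next
    fix R' A' f' assume "J R' A' f'" and h: "holds (Below (Var PP) (Var EE)) R' A'"
    then obtain i where i: "i \<le> length ?xs" "R' PP = ?s + i" "R' EE = ?s + length ?xs" "I (take i ?xs) R' A' f'"
      and so: "same_off (scan_nbrs x c) R A R' A'" by (auto simp: J_def)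
    have lt: "i < length ?xs" using h i by simp
    then obtain g where g: "f' = Suc g" using cost i by (metis gr0_implies_Suc length_take min.absorb2)
    have AIN: "A' IN = A IN" using so c by (simp add: same_off_def)
    have split: "?xs = take i ?xs @ ?xs ! i # drop (Suc i) ?xs" using lt by (rule id_take_nth_drop)
    have "wp c (I (take i ?xs @ [?xs ! i])) (R'(PP := ?s + Suc i, UU := ?xs ! i)) A' g"
      using step[OF split, of R' A' g] i g so by simp
    then have "wp c J (R'(PP := ?s + Suc i, UU := ?xs ! i)) A' g"
    proof (rule wp_conseq)
      fix R'' A'' f''
      assume I: "I (take i ?xs @ [?xs ! i]) R'' A'' f''" and so': "same_off c (R'(PP := ?s + Suc i, UU := ?xs ! i)) A' R'' A''"
      have "R'' PP = ?s + Suc i" "R'' EE = ?s + length ?xs" using so' c i by (auto simp: same_off_def)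
      moreover have "same_off (scan_nbrs x c) R A R'' A''" using so so' by (auto simp: same_off_def)
      ultimately show "J R'' A'' f''" unfolding J_def using I lt
        by (intro exI[of _ "Suc i"]) (auto simp: take_Suc_conv_app_nth)
    qed
    then have "wp (PP ::= Plus (Var PP) (Num 1) ;; UU ::= Elt IN (Var PP) ;; c) J R' A' g"
      using i AIN IN(2)[OF lt] by simp
    then show "\<exists>g. f' = Suc g \<and> wp (PP ::= Plus (Var PP) (Num 1) ;; UU ::= Elt IN (Var PP) ;; c) J R' A' g"
      using g by blast
  next
    fix R' A' f' assume "J R' A' f'" and h: "\<not> holds (Below (Var PP) (Var EE)) R' A'"
    then obtain i where "i \<le> length ?xs" "R' PP = ?s + i" "R' EE = ?s + length ?xs" "I (take i ?xs) R' A' f'"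
      "same_off (scan_nbrs x c) R A R' A'" by (auto simp: J_def)
    then show "Q R' A' f'" using final h by simp
  qed
  then show ?thesis using v IN(1) by (simp add: scan_nbrs_def)
qed

end

section \<open>Reading the input\<close>

definition load_prog :: prog where
  "load_prog = (NN ::= Elt IN (Num 0) ;; KK ::= Elt IN (Num 2) ;; PP ::= Plus (Var NN) (Num 3) ;; II ::= Num 0 ;;
     count_loop II (Var NN) (ST\<langle>Var II\<rangle> ::= Var PP ;; PP ::= Plus (Var PP) (Plus (Elt IN (Var PP)) (Num 1))))"

context input_graph
begin

definition offset :: "nat \<Rightarrow> nat" where
  "offset v = 3 + n + (\<Sum>u<v. Suc (length (nbr ! u)))"

lemma length_nbr: "length nbr = n" using nbr by (simp add: adjacency_lists_def)

lemma encode_split: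
  assumes "v < n"
  shows "\<exists>xs ys. encode_instance n E T k nbr = xs @ (length (nbr ! v) # nbr ! v) @ ys \<and> length xs = offset v"
proof -
  let ?f = "\<lambda>xs :: nat list. length xs # xs"
  have "nbr = take v nbr @ nbr ! v # drop (Suc v) nbr" using assms length_nbr by (intro id_take_nth_drop) simp
  then have "concat (map ?f nbr) = concat (map ?f (take v nbr @ nbr ! v # drop (Suc v) nbr))" by (rule arg_cong)
  then have "concat (map ?f nbr) = concat (map ?f (take v nbr)) @ ?f (nbr ! v) @ concat (map ?f (drop (Suc v) nbr))"
    unfolding map_append concat_append list.map concat.simps .
  moreover have "length (concat (map ?f (take v nbr))) = (\<Sum>u<v. Suc (length (nbr ! u)))"
    using assms length_nbr by (simp add: length_concat sum_list_sum_nth atLeast0LessThan)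
  ultimately show ?thesis unfolding encode_instance_def offset_def
    by (intro exI[of _ "[n, card E, k] @ map (\<lambda>v. if v \<in> T then 1 else 0) [0..<n] @ concat (map ?f (take v nbr))"]
        exI[of _ "concat (map ?f (drop (Suc v) nbr))"]) simp
qed

definition input_array :: "nat \<Rightarrow> nat" where
  "input_array i = (let xs = encode_instance n E T k nbr in if i < length xs then xs ! i else 0)"

lemma input_array_simps:
  "input_array 0 = n" "input_array 2 = k"
  "v < n \<Longrightarrow> input_array (3 + v) = (if v \<in> T then 1 else 0)"
  "v < n \<Longrightarrow> input_array (offset v) = length (nbr ! v)"
  "v < n \<Longrightarrow> i < length (nbr ! v) \<Longrightarrow> input_array (offset v + Suc i) = nbr ! v ! i"
proof -
  show "input_array 0 = n" "input_array 2 = k"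
    by (simp_all add: input_array_def encode_instance_def)
  show "input_array (3 + v) = (if v \<in> T then 1 else 0)" if "v < n"
    using that by (simp add: input_array_def encode_instance_def nth_append)
  show "input_array (offset v) = length (nbr ! v)" if v: "v < n"
  proof -
    obtain xs ys where e: "encode_instance n E T k nbr = xs @ (length (nbr ! v) # nbr ! v) @ ys" "length xs = offset v"
      using encode_split[OF v] by blast
    show ?thesis unfolding input_array_def e(1) e(2)[symmetric] by (simp add: nth_append)
  qed
  show "input_array (offset v + Suc i) = nbr ! v ! i" if v: "v < n" and i: "i < length (nbr ! v)"
  proof -
    obtain xs ys where e: "encode_instance n E T k nbr = xs @ (length (nbr ! v) # nbr ! v) @ ys" "length xs = offset v"
      using encode_split[OF v] by blast
    show ?thesis unfolding input_array_def e(1) e(2)[symmetric] using i by (simp add: nth_append)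
  qed
qed

lemma wp_load_prog:
  assumes A: "A IN = input_array" and f: "f = n + g"
    and post: "\<And>R' A'. \<lbrakk>loaded A'; R' NN = n; R' KK = k; same_off load_prog R A R' A'\<rbrakk> \<Longrightarrow> Q R' A' g"
  shows "wp load_prog Q R A f"
proof -
  let ?c = "ST\<langle>Var II\<rangle> ::= Var PP ;; PP ::= Plus (Var PP) (Plus (Elt IN (Var PP)) (Num 1))"
  let ?R = "R(NN := n, KK := k, PP := n + 3, II := 0)"
  have "wp (count_loop II (Var NN) ?c) Q ?R A f"
  proof (rule wp_count_loop[where m = 0 and N = n and
        I = "\<lambda>i R' A' f'. f' = n - i + g \<and> R' PP = offset i \<and> (\<forall>v<i. A' ST v = offset v)"])
    fix R' A' f' assume so: "same_off (count_loop II (Var NN) ?c) ?R A R' A'"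
      and I: "f' = n - n + g \<and> R' PP = offset n \<and> (\<forall>v<n. A' ST v = offset v)"
    have "A' IN = input_array" "R' NN = n" "R' KK = k" using so A by (simp_all add: same_off_def)
    moreover from this have "loaded A'" unfolding loaded_def using I input_array_simps by simp
    moreover have "same_off load_prog R A R' A'" using so by (auto simp: same_off_def load_prog_def)
    ultimately show "Q R' A' f'" using post I by auto
  next
    fix i R' A' g' assume i: "i < n" "R' II = i"
      and I: "Suc g' = n - i + g \<and> R' PP = offset i \<and> (\<forall>v<i. A' ST v = offset v)"
      and so: "same_off (count_loop II (Var NN) ?c) ?R A R' A'"
    have "A' IN = input_array" using so A by (simp add: same_off_def)
    then show "wp ?c (\<lambda>R'' A'' f''. f'' = n - Suc i + g \<and> (R''(II := Suc i)) PP = offset (Suc i) \<and> (\<forall>v<Suc i. A'' ST v = offset v)) R' A' g'"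
      using I i input_array_simps(4)[of i] by (auto simp: offset_def less_Suc_eq)
  qed (use f in \<open>auto simp: same_off_def offset_def\<close>)
  then show ?thesis using A input_array_simps by (simp add: load_prog_def numeral_3_eq_3 eval_nat_numeral)
qed

end

section \<open>Maximum cardinality search as a program\<close>

text \<open>
  \<open>HD\<langle>j\<rangle>\<close> heads a linked list of vertices with \<open>j\<close> visited neighbours. A vertex is never removed
  from the list of a smaller count; such stale entries are skipped once the vertex has been visited.
\<close>

definition push :: "ex \<Rightarrow> ex \<Rightarrow> prog" where
  "push u j = (FP ::= Plus (Var FP) (Num 1) ;; CV\<langle>Var FP\<rangle> ::= u ;; CN\<langle>Var FP\<rangle> ::= Elt HD j ;; HD\<langle>j\<rangle> ::= Var FP)"

definition visit_nbrs :: prog where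
  "visit_nbrs = scan_nbrs VV (IF Below (Elt PO (Var UU)) (Num 1)
      THEN CT\<langle>Var UU\<rangle> ::= Plus (Elt CT (Var UU)) (Num 1) ;; push (Var UU) (Elt CT (Var UU))
      ELSE Nop)"

text \<open>\<open>JJ\<close> is an upper bound for the indices of nonempty lists. A visit raises
  counts by at most one, so \<open>JJ\<close> grows by one per visit and otherwise only descends
  past empty lists. In \<open>PO\<close>, 0 means unvisited; positions are handed out from
  \<open>n\<close> downwards.\<close>

definition mcs_body :: prog where
  "mcs_body = (IF Below (Elt HD (Var JJ)) (Num 1) THEN JJ ::= Minus (Var JJ) (Num 1)
        ELSE
         (QQ ::= Elt HD (Var JJ) ;; VV ::= Elt CV (Var QQ) ;; HD\<langle>Var JJ\<rangle> ::= Elt CN (Var QQ) ;;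
          IF Below (Elt PO (Var VV)) (Num 1)
          THEN (PO\<langle>Var VV\<rangle> ::= Var CC ;; OD\<langle>Var CC\<rangle> ::= Var VV ;; CC ::= Minus (Var CC) (Num 1) ;;
                visit_nbrs ;; JJ ::= Plus (Var JJ) (Num 1))
          ELSE Nop))"

definition mcs_prog :: prog where
  "mcs_prog = (II ::= Num 0 ;; count_loop II (Var NN) (push (Var II) (Num 0)) ;;
     CC ::= Var NN ;; JJ ::= Num 0 ;;
     (WHILE Below (Num 0) (Var CC) DO
       mcs_body))"

text \<open>0 is the null pointer, and \<open>l\<close> is the number of cells allocated so far,
  numbered from 1.\<close>

fun chain :: "nat \<Rightarrow> (nat \<Rightarrow> nat) \<Rightarrow> (nat \<Rightarrow> nat) \<Rightarrow> nat \<Rightarrow> nat list \<Rightarrow> bool" where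
  "chain l cv cn p [] \<longleftrightarrow> p = 0"
| "chain l cv cn p (x # xs) \<longleftrightarrow> 0 < p \<and> p \<le> l \<and> cv p = x \<and> chain l cv cn (cn p) xs"

text \<open>No existing list passes through the cell \<open>Suc l\<close>, which is not yet
  allocated.\<close>

lemma chain_fresh:
  "chain l cv cn p xs \<Longrightarrow> chain (Suc l) (cv(Suc l := a)) (cn(Suc l := b)) p xs"
  by (induction xs arbitrary: p) auto

lemma chain_0: "chain l cv cn 0 xs \<longleftrightarrow> xs = []"
  by (cases xs) auto

definition buckets :: "(arr \<Rightarrow> nat \<Rightarrow> nat) \<Rightarrow> nat \<Rightarrow> (nat \<Rightarrow> nat list) \<Rightarrow> bool" where
  "buckets A l bl \<longleftrightarrow> (\<forall>j. chain l (A CV) (A CN) (A HD j) (bl j))"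

text \<open>\<open>push\<close> evaluates the index \<open>j\<close> again after advancing
  \<open>FP\<close> and writing the new cell; the condition on \<open>CT\<close> and
  \<open>PO\<close> keeps its value stable.\<close>

lemma wp_push:
  assumes "buckets A l bl" "R FP = l" "ev u (R(FP := Suc l)) A = a" "ev j R A = b"
    "\<And>A'. A' CT = A CT \<Longrightarrow> A' PO = A PO \<Longrightarrow> ev j (R(FP := Suc l)) A' = b"
    "\<And>A'. \<lbrakk>buckets A' (Suc l) (bl(b := a # bl b)); \<And>x. x \<notin> {CV, CN, HD} \<Longrightarrow> A' x = A x\<rbrakk> \<Longrightarrow> Q (R(FP := Suc l)) A' f"
  shows "wp (push u j) Q R A f"
proof -
  let ?A1 = "A(CV := (A CV)(Suc l := a))"
  let ?A2 = "?A1(CN := (A CN)(Suc l := A HD b))"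
  let ?A = "?A2(HD := (A HD)(b := Suc l))"
  have j1: "ev j (R(FP := Suc l)) ?A1 = b" "ev j (R(FP := Suc l)) ?A2 = b" by (rule assms(5); simp)+
  have "chain l (A CV) (A CN) (A HD i) (bl i)" for i using assms(1) by (simp add: buckets_def)
  then have "chain (Suc l) ((A CV)(Suc l := a)) ((A CN)(Suc l := A HD b)) (A HD i) (bl i)" for i by (rule chain_fresh)
  then have "buckets ?A (Suc l) (bl(b := a # bl b))" by (auto simp: buckets_def)
  then have "Q (R(FP := Suc l)) ?A f" by (rule assms(6)) auto
  then show ?thesis using assms(2,3) j1 by (simp add: push_def)
qed

context input_graph
begin

definition numbered :: "(nat \<Rightarrow> nat) \<Rightarrow> (nat \<Rightarrow> nat) \<Rightarrow> nat \<Rightarrow> bool" where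
  "numbered po od c \<longleftrightarrow> (\<forall>v<n. po v \<noteq> 0 \<longrightarrow> c < po v \<and> po v \<le> n \<and> od (po v) = v) \<and>
     (\<forall>i. c < i \<and> i \<le> n \<longrightarrow> od i < n \<and> po (od i) = i)"

text \<open>The condition of \<open>search_order\<close> for the visited \<open>v\<close> only.
  Unvisited vertices have \<open>po\<close> 0 and so count as earlier than all visited ones.\<close>

definition greedy :: "(nat \<Rightarrow> nat) \<Rightarrow> bool" where
  "greedy po \<longleftrightarrow> (\<forall>v<n. po v \<noteq> 0 \<longrightarrow> (\<forall>w<n. po w < po v \<longrightarrow>
     card {u\<in>{0..<n}. adjacent E w u \<and> po v < po u} \<le> card {u\<in>{0..<n}. adjacent E v u \<and> po v < po u}))"

text \<open>This is what remains true in the presence of stale entries: an unvisited vertex may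
  occur in lists of smaller counts, but never of larger ones, and does occur in the list of its
  current count.\<close>

definition entries :: "(nat \<Rightarrow> nat) \<Rightarrow> (nat \<Rightarrow> nat) \<Rightarrow> (nat \<Rightarrow> nat list) \<Rightarrow> bool" where
  "entries po ct bl \<longleftrightarrow> (\<forall>j. \<forall>v\<in>set (bl j). v < n \<and> (po v = 0 \<longrightarrow> j \<le> ct v)) \<and>
     (\<forall>u<n. po u = 0 \<longrightarrow> u \<in> set (bl (ct u)))"

definition visited_nbrs :: "(nat \<Rightarrow> nat) \<Rightarrow> nat \<Rightarrow> nat set" where
  "visited_nbrs po u = {w\<in>{0..<n}. adjacent E u w \<and> po w \<noteq> 0}"

definition bucket_size :: "(nat \<Rightarrow> nat list) \<Rightarrow> nat" where
  "bucket_size bl = (\<Sum>j\<le>n. length (bl j))"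

text \<open>Prepaid cost of future visits: two credits for each adjacency entry, one for raising
  \<open>JJ\<close>, and one spare that keeps the main loop supplied while a vertex is
  unvisited.\<close>

definition unvisited_cost :: "(nat \<Rightarrow> nat) \<Rightarrow> nat" where
  "unvisited_cost po = (\<Sum>u | u < n \<and> po u = 0. 2 * length (nbr ! u) + 2)"

lemma bucket_size_upd:
  assumes "b \<le> n" shows "bucket_size (bl(b := xs)) + length (bl b) = bucket_size bl + length xs"
proof -
  have "bucket_size bl = length (bl b) + (\<Sum>j\<in>{..n} - {b}. length (bl j))"
    unfolding bucket_size_def using assms by (intro sum.remove) auto
  moreover have "bucket_size (bl(b := xs)) = length xs + (\<Sum>j\<in>{..n} - {b}. length (bl j))"
    unfolding bucket_size_def using assms by (subst sum.remove[of _ b]) auto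
  ultimately show ?thesis by simp
qed

lemma unvisited_cost_upd:
  assumes "v < n" "po v = 0" "c \<noteq> 0"
  shows "unvisited_cost po = unvisited_cost (po(v := c)) + (2 * length (nbr ! v) + 2)"
proof -
  have "{u. u < n \<and> (po(v := c)) u = 0} = {u. u < n \<and> po u = 0} - {v}" using assms by auto
  then show ?thesis unfolding unvisited_cost_def using assms by (subst sum.remove[of _ v]) auto
qed

text \<open>A neighbour costs two credits, one for the iteration and one stored with the entry it
  may push. Unvisited vertices have counts at most \<open>J\<close>, so pushes reach no list beyond
  \<open>Suc J\<close>.\<close>

lemma wp_visit_nbrs:
  assumes ld: "loaded A" and v: "R VV = v" "v < n" and bk: "buckets A (R FP) bl" and en: "entries (A PO) (A CT) bl"
    and high: "\<forall>j>Suc J. bl j = []" and J: "Suc J \<le> n"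
    and ct: "\<forall>u<n. A PO u = 0 \<longrightarrow> A CT u = cnt u" and cnt: "\<forall>u<n. A PO u = 0 \<longrightarrow> cnt u \<le> J"
    and f: "bucket_size bl + 2 * length (nbr ! v) + g \<le> f"
    and post: "\<And>R' A' bl' f'. \<lbrakk>buckets A' (R' FP) bl'; entries (A' PO) (A' CT) bl'; \<forall>j>Suc J. bl' j = [];
       \<forall>u<n. A PO u = 0 \<longrightarrow> A' CT u = cnt u + (if u \<in> set (nbr ! v) then 1 else 0);
       bucket_size bl' + g \<le> f'; same_off visit_nbrs R A R' A'\<rbrakk> \<Longrightarrow> Q R' A' f'"
  shows "wp visit_nbrs Q R A f"
  unfolding visit_nbrs_def
proof (rule wp_scan_nbrs[where v = v and I = "\<lambda>ys R' A' f'. length ys \<le> length (nbr ! v) \<and>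
     (\<exists>bl'. buckets A' (R' FP) bl' \<and> entries (A' PO) (A' CT) bl' \<and> (\<forall>j>Suc J. bl' j = []) \<and>
       (\<forall>u<n. A PO u = 0 \<longrightarrow> A' CT u = cnt u + (if u \<in> set ys then 1 else 0)) \<and>
       bucket_size bl' + 2 * (length (nbr ! v) - length ys) + g \<le> f')"])
  fix p e
  show "length [] \<le> length (nbr ! v) \<and> (\<exists>bl'. buckets A ((R(PP := p, EE := e)) FP) bl' \<and> entries (A PO) (A CT) bl' \<and> (\<forall>j>Suc J. bl' j = []) \<and>
       (\<forall>u<n. A PO u = 0 \<longrightarrow> A CT u = cnt u + (if u \<in> set [] then 1 else 0)) \<and>
       bucket_size bl' + 2 * (length (nbr ! v) - length []) + g \<le> f)"
    using bk en high ct f by (intro conjI exI[of _ bl]) auto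
next
  let ?c = "IF Below (Elt PO (Var UU)) (Num 1)
      THEN CT\<langle>Var UU\<rangle> ::= Plus (Elt CT (Var UU)) (Num 1) ;; push (Var UU) (Elt CT (Var UU)) ELSE Nop"
  fix ys u zs R' A' g' p
  assume split: "nbr ! v = ys @ u # zs"
    and "length ys \<le> length (nbr ! v) \<and> (\<exists>bl'. buckets A' (R' FP) bl' \<and> entries (A' PO) (A' CT) bl' \<and> (\<forall>j>Suc J. bl' j = []) \<and>
       (\<forall>u<n. A PO u = 0 \<longrightarrow> A' CT u = cnt u + (if u \<in> set ys then 1 else 0)) \<and>
       bucket_size bl' + 2 * (length (nbr ! v) - length ys) + g \<le> Suc g')"
    and so: "same_off (scan_nbrs VV ?c) R A R' A'"
  then obtain bl' where bk': "buckets A' (R' FP) bl'" and en': "entries (A' PO) (A' CT) bl'" and hi': "\<forall>j>Suc J. bl' j = []"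
    and ct': "\<forall>u<n. A PO u = 0 \<longrightarrow> A' CT u = cnt u + (if u \<in> set ys then 1 else 0)"
    and f': "bucket_size bl' + 2 * (length (nbr ! v) - length ys) + g \<le> Suc g'" by auto
  have PO: "A' PO = A PO" using so by (simp add: same_off_def push_def)
  have u: "u < n" "u \<notin> set ys" using nbr_less[OF v(2), of u] distinct_nbr[OF v(2)] split by auto
  have len: "length (nbr ! v) - length ys = Suc (length (nbr ! v) - length (ys @ [u]))" "length (ys @ [u]) \<le> length (nbr ! v)"
    using split by auto
  let ?I = "\<lambda>R' A' f'. length (ys @ [u]) \<le> length (nbr ! v) \<and> (\<exists>bl'. buckets A' (R' FP) bl' \<and> entries (A' PO) (A' CT) bl' \<and> (\<forall>j>Suc J. bl' j = []) \<and>
       (\<forall>u'<n. A PO u' = 0 \<longrightarrow> A' CT u' = cnt u' + (if u' \<in> set (ys @ [u]) then 1 else 0)) \<and>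
       bucket_size bl' + 2 * (length (nbr ! v) - length (ys @ [u])) + g \<le> f')"
  show "wp ?c ?I (R'(PP := p, UU := u)) A' g'"
  proof (cases "A' PO u = 0")
    case False
    then have "?I (R'(PP := p, UU := u)) A' g'" using bk' en' hi' ct' f' len PO by (intro conjI exI[of _ bl']) auto
    then show ?thesis using False by simp
  next
    case True
    let ?b = "Suc (A' CT u)"
    let ?A = "A'(CT := (A' CT)(u := ?b))"
    have ctu: "A' CT u = cnt u" using ct' u True PO by simp
    have b: "?b \<le> Suc J" using ctu cnt u True PO by simp
    have "buckets ?A (R' FP) bl'" using bk' by (simp add: buckets_def)
    then have "wp (push (Var UU) (Elt CT (Var UU))) ?I (R'(PP := p, UU := u)) ?A g'"
    proof (rule wp_push[where a = u and b = ?b])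
      fix A'' assume bk'': "buckets A'' (Suc (R' FP)) (bl'(?b := u # bl' ?b))" and oth: "\<And>x. x \<notin> {CV, CN, HD} \<Longrightarrow> A'' x = ?A x"
      have A'': "A'' CT = (A' CT)(u := ?b)" "A'' PO = A' PO" using oth by auto
      have "entries (A'' PO) (A'' CT) (bl'(?b := u # bl' ?b))"
        using en' u unfolding entries_def A'' by (auto simp: le_Suc_eq)
      moreover have "bucket_size (bl'(?b := u # bl' ?b)) = Suc (bucket_size bl')"
        using bucket_size_upd[of ?b bl' "u # bl' ?b"] b J by simp
      moreover have "\<forall>j>Suc J. (bl'(?b := u # bl' ?b)) j = []" using hi' b by auto
      moreover have "\<forall>u'<n. A PO u' = 0 \<longrightarrow> A'' CT u' = cnt u' + (if u' \<in> set (ys @ [u]) then 1 else 0)"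
        using ct' ctu unfolding A'' by auto
      ultimately show "?I (R'(PP := p, UU := u, FP := Suc (R' FP))) A'' g'"
        using bk'' f' len by (intro conjI exI[of _ "bl'(?b := u # bl' ?b)"]) auto
    qed auto
    then show ?thesis using True by simp
  qed
next
  fix R' A' f'
  assume "length (nbr ! v) \<le> length (nbr ! v) \<and> (\<exists>bl'. buckets A' (R' FP) bl' \<and> entries (A' PO) (A' CT) bl' \<and> (\<forall>j>Suc J. bl' j = []) \<and>
       (\<forall>u<n. A PO u = 0 \<longrightarrow> A' CT u = cnt u + (if u \<in> set (nbr ! v) then 1 else 0)) \<and>
       bucket_size bl' + 2 * (length (nbr ! v) - length (nbr ! v)) + g \<le> f')"
    and "same_off (scan_nbrs VV (IF Below (Elt PO (Var UU)) (Num 1)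
      THEN CT\<langle>Var UU\<rangle> ::= Plus (Elt CT (Var UU)) (Num 1) ;; push (Var UU) (Elt CT (Var UU)) ELSE Nop)) R A R' A'"
  then show "Q R' A' f'" using post[of A' R'] by (auto simp: visit_nbrs_def)
qed (use ld v in \<open>auto simp: push_def\<close>)

text \<open>Each remaining entry pays for its removal and each unit of \<open>JJ\<close> for a later
  descent. \<open>R JJ + R CC \<le> n\<close> is kept because a visit raises one and lowers the
  other; it confines the nonempty lists to the range summed by \<open>bucket_size\<close>.\<close>

definition mcs_inv :: "nat \<Rightarrow> (reg \<Rightarrow> nat) \<Rightarrow> (arr \<Rightarrow> nat \<Rightarrow> nat) \<Rightarrow> nat \<Rightarrow> bool" where
  "mcs_inv g R A f \<longleftrightarrow> loaded A \<and> numbered (A PO) (A OD) (R CC) \<and> greedy (A PO) \<and> R JJ + R CC \<le> n \<and>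
     (\<forall>u<n. A PO u = 0 \<longrightarrow> A CT u = card (visited_nbrs (A PO) u)) \<and>
     (\<exists>bl. buckets A (R FP) bl \<and> entries (A PO) (A CT) bl \<and> (\<forall>j>R JJ. bl j = []) \<and>
        bucket_size bl + R JJ + unvisited_cost (A PO) + g \<le> f)"

lemma numbered_visit:
  assumes "numbered po od c" "v < n" "po v = 0" "0 < c" "c \<le> n"
  shows "numbered (po(v := c)) (od(c := v)) (c - 1)"
  unfolding numbered_def
proof (intro conjI allI impI)
  have po: "c < po u" "po u \<le> n" "od (po u) = u" if "u < n" "po u \<noteq> 0" for u using assms(1) that by (auto simp: numbered_def)
  have od: "od i < n" "po (od i) = i" if "c < i" "i \<le> n" for i using assms(1) that by (auto simp: numbered_def)
  show "c - 1 < (po(v := c)) u" "(po(v := c)) u \<le> n" "(od(c := v)) ((po(v := c)) u) = u"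
    if "u < n" "(po(v := c)) u \<noteq> 0" for u
    using that po[of u] assms by (auto split: if_splits)
  show "(od(c := v)) i < n" "(po(v := c)) ((od(c := v)) i) = i" if "c - 1 < i \<and> i \<le> n" for i
    using that od[of i] assms by (cases "i = c"; auto)+
qed

lemma greedy_visit:
  assumes num: "numbered po od c" and gr: "greedy po" and v: "v < n" "po v = 0" and c: "0 < c"
    and max: "\<And>w. w < n \<Longrightarrow> po w = 0 \<Longrightarrow> card (visited_nbrs po w) \<le> card (visited_nbrs po v)"
  shows "greedy (po(v := c))"
  unfolding greedy_def
proof (intro allI impI)
  let ?po = "po(v := c)"
  fix a w assume a: "a < n" "?po a \<noteq> 0" and w: "w < n" "?po w < ?po a"
  have gt: "c < po u" if "u < n" "po u \<noteq> 0" for u using num that by (auto simp: numbered_def)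
  show "card {u\<in>{0..<n}. adjacent E w u \<and> ?po a < ?po u} \<le> card {u\<in>{0..<n}. adjacent E a u \<and> ?po a < ?po u}"
  proof (cases "a = v")
    case True
    have eq: "{u\<in>{0..<n}. adjacent E x u \<and> ?po a < ?po u} = visited_nbrs po x" for x
      unfolding visited_nbrs_def using True v gt by auto
    have "po w = 0" using w True gt[OF w(1)] v by (cases "w = v") auto
    then show ?thesis unfolding eq using True max w by auto
  next
    case False
    then have pa: "c < po a" using gt a by auto
    have eq: "{u\<in>{0..<n}. adjacent E x u \<and> ?po a < ?po u} = {u\<in>{0..<n}. adjacent E x u \<and> po a < po u}" for x
      using False pa v by auto
    have "po w < po a" using w False pa v by (cases "w = v") auto
    then show ?thesis unfolding eq using gr a w False by (auto simp: greedy_def)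
  qed
qed

lemma card_visited_nbrs_visit:
  assumes "v < n" "po v = 0" "c \<noteq> 0"
  shows "card (visited_nbrs (po(v := c)) u) = card (visited_nbrs po u) + (if adjacent E u v then 1 else 0)"
proof -
  have "visited_nbrs (po(v := c)) u = (if adjacent E u v then insert v (visited_nbrs po u) else visited_nbrs po u)"
    using assms by (auto simp: visited_nbrs_def)
  moreover have "v \<notin> visited_nbrs po u" "finite (visited_nbrs po u)" using assms by (auto simp: visited_nbrs_def)
  ultimately show ?thesis by auto
qed

lemma mcs_step:
  assumes inv: "mcs_inv g R A (Suc f)" and C: "0 < R CC"
  shows "wp mcs_body (mcs_inv g) R A f"
proof -
  let ?J = "R JJ" and ?c = "R CC"
  obtain bl where ld: "loaded A" and num: "numbered (A PO) (A OD) ?c" and gr: "greedy (A PO)" and JC: "?J + ?c \<le> n"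
    and ct: "\<forall>u<n. A PO u = 0 \<longrightarrow> A CT u = card (visited_nbrs (A PO) u)"
    and bk: "buckets A (R FP) bl" and en: "entries (A PO) (A CT) bl" and hi: "\<forall>j>?J. bl j = []"
    and f: "bucket_size bl + ?J + unvisited_cost (A PO) + g \<le> Suc f"
    using inv by (auto simp: mcs_inv_def)
  have ch: "chain (R FP) (A CV) (A CN) (A HD ?J) (bl ?J)" using bk by (simp add: buckets_def)
  have le_J: "A CT u \<le> ?J" if "u < n" "A PO u = 0" for u
  proof (rule ccontr)
    assume "\<not> A CT u \<le> ?J"
    then have "bl (A CT u) = []" using hi by simp
    then show False using en that by (auto simp: entries_def)
  qed
  show ?thesis
  proof (cases "A HD ?J = 0")
    case True
    then have e: "bl ?J = []" using ch chain_0 by simp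
    \<comment> \<open>Too few positions have been assigned for all vertices to be visited. With
      index 0, an unvisited vertex would have count 0 and stand in the list just found
      empty.\<close>
    have "?J \<noteq> 0"
    proof
      assume J: "?J = 0"
      have "\<exists>u<n. A PO u = 0"
      proof (rule ccontr)
        assume "\<not> ?thesis"
        then have "A PO ` {0..<n} \<subseteq> {?c<..n}" using num by (auto simp: numbered_def)
        then have "card (A PO ` {0..<n}) \<le> card {?c<..n}" by (intro card_mono) auto
        moreover have "inj_on (A PO) {0..<n}"
          using num \<open>\<not> (\<exists>u<n. A PO u = 0)\<close> unfolding numbered_def inj_on_def by (metis atLeastLessThan_iff)
        ultimately show False using C JC by (simp add: card_image)
      qed
      then obtain u where u: "u < n" "A PO u = 0" by blast
      then have "A CT u = 0" using le_J J by fastforce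
      then have "u \<in> set (bl ?J)" using en u J by (auto simp: entries_def)
      then show False using e by simp
    qed
    moreover have "bl j = []" if "?J - 1 < j" for j using that hi e by (cases "j = ?J") auto
    ultimately have "mcs_inv g (R(JJ := ?J - 1)) A f"
      unfolding mcs_inv_def using ld num gr JC ct bk en f by (auto intro!: exI[of _ bl])
    then show ?thesis using True by (simp add: mcs_body_def)
  next
    case False
    then obtain v xs where bl: "bl ?J = v # xs" using ch by (cases "bl ?J") auto
    then have v: "A CV (A HD ?J) = v" and xs: "chain (R FP) (A CV) (A CN) (A CN (A HD ?J)) xs" using ch by auto
    have v_in: "v \<in> set (bl ?J)" using bl by simp
    then have vn: "v < n" using en unfolding entries_def by blast
    let ?R = "R(QQ := A HD ?J, VV := v)" and ?A = "A(HD := (A HD)(?J := A CN (A HD ?J)))" and ?bl = "bl(?J := xs)"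
    have bk': "buckets ?A (R FP) ?bl" using bk xs by (auto simp: buckets_def)
    have hi': "\<forall>j>?J. ?bl j = []" using hi by auto
    have size: "bucket_size bl = Suc (bucket_size ?bl)" using bucket_size_upd[of ?J bl xs] bl JC by simp
    have sub: "set (bl j) \<subseteq> insert v (set (?bl j))" for j using bl by auto
    have en_gen: "entries po (A CT) ?bl" if po: "\<And>u. po u = 0 \<Longrightarrow> A PO u = 0 \<and> u \<noteq> v" for po
      unfolding entries_def
    proof (intro conjI allI ballI impI)
      fix j u assume u: "u \<in> set (?bl j)"
      have "set (?bl j) \<subseteq> set (bl j)" using bl by auto
      with u have "u \<in> set (bl j)" by (rule set_rev_mp)
      then have h: "u < n" "A PO u = 0 \<longrightarrow> j \<le> A CT u" using en unfolding entries_def by auto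
      then show "u < n" by simp
      show "j \<le> A CT u" if "po u = 0" using h po[OF that] by simp
    next
      fix u assume u: "u < n" "po u = 0"
      then have "u \<in> set (bl (A CT u))" "u \<noteq> v" using en po[OF u(2)] by (auto simp: entries_def)
      then show "u \<in> set (?bl (A CT u))" using sub by blast
    qed
    show ?thesis
    proof (cases "A PO v = 0")
      case visited: False
      have "entries (A PO) (A CT) ?bl" using visited by (intro en_gen) auto
      then have "mcs_inv g ?R ?A f"
        unfolding mcs_inv_def using ld num gr JC ct bk' hi' f size by (auto simp: loaded_def intro!: exI[of _ ?bl])
      then show ?thesis using False visited v by (simp add: mcs_body_def)
    next
      case new: True
      let ?R2 = "?R(CC := ?c - 1)" and ?A2 = "?A(PO := (A PO)(v := ?c), OD := (A OD)(?c := v))"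
      let ?po = "(A PO)(v := ?c)"
      have cn: "?c \<le> n" using JC by simp
      \<comment> \<open>The count is at least \<open>?J\<close> by \<open>entries\<close> and at
        most \<open>?J\<close> by \<open>le_J\<close>, so the vertex taken from the list has a
        maximum number of visited neighbours.\<close>
      have Jv: "A CT v = ?J" using le_J[OF vn new] en v_in new unfolding entries_def by (metis le_antisym)
      have num': "numbered ?po ((A OD)(?c := v)) (?c - 1)" by (rule numbered_visit[OF num vn new C cn])
      have gr': "greedy ?po"
      proof (rule greedy_visit[OF num gr vn new C])
        show "card (visited_nbrs (A PO) w) \<le> card (visited_nbrs (A PO) v)" if "w < n" "A PO w = 0" for w
          using ct that vn new le_J[OF that] Jv by auto
      qed
      have en': "entries ?po (A CT) ?bl" using C by (intro en_gen) (auto split: if_splits)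
      have "wp visit_nbrs (wp (JJ ::= Plus (Var JJ) (Num 1)) (mcs_inv g)) ?R2 ?A2 f"
      proof (rule wp_visit_nbrs[where bl = ?bl and J = ?J and cnt = "\<lambda>u. card (visited_nbrs (A PO) u)" and v = v
            and g = "Suc ?J + unvisited_cost ?po + g"])
        show "bucket_size ?bl + 2 * length (nbr ! v) + (Suc ?J + unvisited_cost ?po + g) \<le> f"
          using f size unvisited_cost_upd[of v "A PO" ?c] vn new C by simp
        show "\<forall>u<n. ?A2 PO u = 0 \<longrightarrow> card (visited_nbrs (A PO) u) \<le> ?J"
          using ct le_J C by (auto split: if_splits)
        fix R' A' bl' f'
        assume post: "buckets A' (R' FP) bl'" "entries (A' PO) (A' CT) bl'" "\<forall>j>Suc ?J. bl' j = []"
          "\<forall>u<n. ?A2 PO u = 0 \<longrightarrow> A' CT u = card (visited_nbrs (A PO) u) + (if u \<in> set (nbr ! v) then 1 else 0)"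
          "bucket_size bl' + (Suc ?J + unvisited_cost ?po + g) \<le> f'" and so: "same_off visit_nbrs ?R2 ?A2 R' A'"
        have e: "A' PO = ?po" "A' OD = (A OD)(?c := v)" "A' IN = A IN" "A' ST = A ST" "R' CC = ?c - 1" "R' JJ = ?J"
          using so by (simp_all add: same_off_def visit_nbrs_def push_def)
        have ct': "A' CT u = card (visited_nbrs ?po u)" if "u < n" "?po u = 0" for u
        proof -
          have "u \<in> set (nbr ! v) \<longleftrightarrow> adjacent E u v" using set_nbr[OF vn] adjacent_sym by auto
          then show ?thesis using post(4) that card_visited_nbrs_visit[of v "A PO" ?c u] vn new C by simp
        qed
        show "wp (JJ ::= Plus (Var JJ) (Num 1)) (mcs_inv g) R' A' f'"
          unfolding wp_Set_Reg mcs_inv_def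
          using post(1-3,5) e num' gr' JC C loaded_cong[OF ld e(3,4)] ct' by (auto intro!: exI[of _ bl'])
      qed (use ld vn bk' en' hi' JC C ct in \<open>auto simp: loaded_def buckets_def split: if_splits\<close>)
      then show ?thesis using False new v by (simp add: mcs_body_def)
    qed
  qed
qed

text \<open>Of the \<open>4 * n\<close>, one \<open>n\<close> fills the first list, one is stored in
  its entries, and two go with the degree sum into \<open>unvisited_cost\<close>.\<close>

lemma wp_mcs_prog:
  assumes ld: "loaded A" and N: "R NN = n" and FP: "R FP = 0"
    and zero: "\<And>i. A HD i = 0" "\<And>i. A PO i = 0" "\<And>i. A CT i = 0"
    and f: "4 * n + 2 * (\<Sum>u<n. length (nbr ! u)) + g \<le> f"
    and post: "\<And>R' A' f'. \<lbrakk>search_order {0..<n} E (A' PO); \<And>v. v < n \<Longrightarrow> 0 < A' PO v \<and> A' PO v \<le> n;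
        \<And>i. 0 < i \<Longrightarrow> i \<le> n \<Longrightarrow> A' OD i < n \<and> A' PO (A' OD i) = i; g \<le> f'; same_off mcs_prog R A R' A'\<rbrakk> \<Longrightarrow> Q R' A' f'"
  shows "wp mcs_prog Q R A f"
proof -
  let ?rest = "CC ::= Var NN ;; JJ ::= Num 0 ;; (WHILE Below (Num 0) (Var CC) DO mcs_body)"
  let ?init = "count_loop II (Var NN) (push (Var II) (Num 0))"
  define bl :: "nat \<Rightarrow> nat \<Rightarrow> nat list" where "bl i = (\<lambda>j. if j = 0 then rev [0..<i] else [])" for i
  have "wp ?init (\<lambda>R' A' f'. same_off mcs_prog R A R' A' \<longrightarrow> wp ?rest Q R' A' f') (R(II := 0)) A f"
  proof (rule wp_count_loop[where m = 0 and N = n and I = "\<lambda>i R' A' f'. R' FP = i \<and> buckets A' i (bl i) \<and>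
       n - i + 3 * n + 2 * (\<Sum>u<n. length (nbr ! u)) + g \<le> f'"])
    show "(R(II := 0)) FP = 0 \<and> buckets A 0 (bl 0) \<and> n - 0 + 3 * n + 2 * (\<Sum>u<n. length (nbr ! u)) + g \<le> f"
      using FP zero f by (auto simp: buckets_def bl_def)
  next
    fix i R' A' g' assume i: "i < n" "R' II = i"
      and I: "R' FP = i \<and> buckets A' i (bl i) \<and> n - i + 3 * n + 2 * (\<Sum>u<n. length (nbr ! u)) + g \<le> Suc g'"
    have "buckets A' i (bl i)" "R' FP = i" using I by auto
    then show "wp (push (Var II) (Num 0)) (\<lambda>R'' A'' f''. (R''(II := Suc i)) FP = Suc i \<and> buckets A'' (Suc i) (bl (Suc i)) \<and>
        n - Suc i + 3 * n + 2 * (\<Sum>u<n. length (nbr ! u)) + g \<le> f'') R' A' g'"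
    proof (rule wp_push[where a = i and b = 0])
      fix A'' assume "buckets A'' (Suc i) ((bl i)(0 := i # bl i 0))"
      moreover have "(bl i)(0 := i # bl i 0) = bl (Suc i)" by (auto simp: bl_def)
      ultimately show "((R'(FP := Suc i))(II := Suc i)) FP = Suc i \<and> buckets A'' (Suc i) (bl (Suc i)) \<and>
        n - Suc i + 3 * n + 2 * (\<Sum>u<n. length (nbr ! u)) + g \<le> g'"
        using I i by auto
    qed (use i in auto)
  next
    fix R' A' f'
    assume I: "R' FP = n \<and> buckets A' n (bl n) \<and> n - n + 3 * n + 2 * (\<Sum>u<n. length (nbr ! u)) + g \<le> f'"
      and so: "same_off ?init (R(II := 0)) A R' A'"
    have e: "A' PO = A PO" "A' CT = A CT" "A' IN = A IN" "A' ST = A ST" "R' NN = n" using so N by (simp_all add: same_off_def push_def)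
    let ?R = "R'(CC := n, JJ := 0)"
    have bl_pos: "bl n j = []" if "0 < j" for j using that by (simp add: bl_def)
    have "bucket_size (bl n) = n"
      unfolding bucket_size_def bl_def by (subst sum.remove[of _ 0]) auto
    moreover have "unvisited_cost (A' PO) = 2 * (\<Sum>u<n. length (nbr ! u)) + 2 * n"
    proof -
      have "{u. u < n \<and> A' PO u = 0} = {..<n}" using zero e by auto
      then show ?thesis unfolding unvisited_cost_def by (simp only: sum.distrib sum_distrib_left) simp
    qed
    moreover have "numbered (A' PO) (A' OD) n" "greedy (A' PO)" using zero e by (auto simp: numbered_def greedy_def)
    moreover have "visited_nbrs (A' PO) u = {}" for u using zero e by (auto simp: visited_nbrs_def)
    moreover have "entries (A' PO) (A' CT) (bl n)" using zero e by (auto simp: entries_def bl_def)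
    ultimately have inv: "mcs_inv g ?R A' f'"
      unfolding mcs_inv_def using loaded_cong[OF ld e(3,4)] I zero e(1,2) bl_pos
      by (auto intro!: exI[of _ "bl n"])
    show "same_off mcs_prog R A R' A' \<longrightarrow> wp ?rest Q R' A' f'"
    proof
      assume so': "same_off mcs_prog R A R' A'"
      have "wp (WHILE Below (Num 0) (Var CC) DO mcs_body) (\<lambda>R A f. mcs_inv g R A f \<and> R CC = 0) ?R A' f'"
      proof (rule wp_Loop[where I = "mcs_inv g", OF inv])
        fix R1 A1 f1 assume inv: "mcs_inv g R1 A1 f1" and h: "holds (Below (Num 0) (Var CC)) R1 A1"
        obtain f2 where f2: "f1 = Suc f2"
        proof (cases f1)
          case 0
          then have z: "unvisited_cost (A1 PO) = 0" using inv by (auto simp: mcs_inv_def)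
          have "A1 PO u \<noteq> 0" if "u < n" for u
          proof
            assume "A1 PO u = 0"
            then have "2 * length (nbr ! u) + 2 \<le> unvisited_cost (A1 PO)"
              unfolding unvisited_cost_def using that by (intro member_le_sum) auto
            then show False using z by simp
          qed
          then have "A1 PO ` {0..<n} \<subseteq> {R1 CC<..n}" "inj_on (A1 PO) {0..<n}"
            using inv unfolding mcs_inv_def numbered_def inj_on_def by (auto, metis)
          then have "card {0..<n} \<le> card {R1 CC<..n}" using card_mono[of "{R1 CC<..n}" "A1 PO ` {0..<n}"] by (simp add: card_image)
          moreover have "R1 CC \<le> n" using inv by (auto simp: mcs_inv_def)
          ultimately show ?thesis using h by simp
        qed
        then show "\<exists>g'. f1 = Suc g' \<and> wp mcs_body (mcs_inv g) R1 A1 g'" using mcs_step inv h by auto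
      qed auto
      then have "wp (WHILE Below (Num 0) (Var CC) DO mcs_body) Q ?R A' f'"
      proof (rule wp_conseq)
        fix R1 A1 f1 assume inv: "mcs_inv g R1 A1 f1 \<and> R1 CC = 0"
          and so1: "same_off (WHILE Below (Num 0) (Var CC) DO mcs_body) ?R A' R1 A1"
        have num: "numbered (A1 PO) (A1 OD) 0" and gr: "greedy (A1 PO)" and g: "g \<le> f1" using inv by (auto simp: mcs_inv_def)
        have od: "A1 OD i < n \<and> A1 PO (A1 OD i) = i" if "0 < i" "i \<le> n" for i using num that by (auto simp: numbered_def)
        \<comment> \<open>\<open>numbered\<close> gives a vertex for each position; comparing
          cardinalities shows that every vertex received a position.\<close>
        have sub: "A1 OD ` {1..n} = {0..<n}"
        proof (rule card_subset_eq)
          have "inj_on (A1 OD) {1..n}" using od by (intro inj_on_inverseI[of _ "A1 PO"]) auto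
          then show "card (A1 OD ` {1..n}) = card {0..<n}" by (simp add: card_image)
        qed (use od in auto)
        have po: "0 < A1 PO v \<and> A1 PO v \<le> n \<and> A1 OD (A1 PO v) = v" if v: "v < n" for v
        proof -
          obtain i where "i \<in> {1..n}" "v = A1 OD i" using sub v by (metis atLeastLessThan_iff imageE le0)
          then show ?thesis using od by auto
        qed
        have "inj_on (A1 PO) {0..<n}" using po by (intro inj_on_inverseI[of _ "A1 OD"]) auto
        then have "search_order {0..<n} E (A1 PO)"
          unfolding search_order_def using gr po by (auto simp: greedy_def)
        moreover have "same_off mcs_prog R A R1 A1"
          using so' so1 unfolding same_off_def mcs_prog_def by auto
        ultimately show "Q R1 A1 f1" using post[of A1 f1 R1] od po g by blast
      qed
      then show "wp ?rest Q R' A' f'" using e by simp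
    qed
  qed (use N in \<open>auto simp: same_off_def push_def\<close>)
  then have "wp ?init (wp ?rest Q) (R(II := 0)) A f"
  proof (rule wp_conseq)
    fix R' A' f' assume "same_off mcs_prog R A R' A' \<longrightarrow> wp ?rest Q R' A' f'" "same_off ?init (R(II := 0)) A R' A'"
    then show "wp ?rest Q R' A' f'" by (auto simp: same_off_def mcs_prog_def)
  qed
  then show ?thesis by (simp add: mcs_prog_def)
qed

end

section \<open>Writing the children of a node\<close>

text \<open>
  The search keeps a stack of subproblems in \<open>SN\<close>: each entry has \<open>n\<close> deletion flags followed by the
  remaining budget. A child is written directly above the stack and kept only if its budget suffices.
\<close>

datatype del = Del reg | DelN reg reg

definition same :: "ex \<Rightarrow> ex \<Rightarrow> tst" where
  "same a b = Both (Fails (Below a b)) (Fails (Below b a))"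

lemma holds_same [simp]: "holds (same a b) R A \<longleftrightarrow> ev a R A = ev b R A"
  by (auto simp: same_def)

text \<open>Only the first deletion of a vertex is counted, so \<open>SZ\<close> is the cardinality
  of a union even when its parts overlap.\<close>

definition mark :: prog where
  "mark = (IF Below (Elt SN (Plus (Var SP) (Var UU))) (Num 1)
     THEN SN\<langle>Plus (Var SP) (Var UU)\<rangle> ::= Num 1 ;; SZ ::= Plus (Var SZ) (Num 1) ELSE Nop)"

fun del_prog :: "del \<Rightarrow> prog" where
  "del_prog (Del r) = (UU ::= Var r ;; mark)"
| "del_prog (DelN r r') = scan_nbrs r
     (IF Both (Below (Elt DE (Var UU)) (Num 1)) (Both (Below (Elt PO (Var r)) (Elt PO (Var UU))) (Fails (same (Var UU) (Var r'))))
      THEN mark ELSE Nop)"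

fun dels_prog :: "del list \<Rightarrow> prog" where
  "dels_prog [] = Nop"
| "dels_prog (d # ds) = (del_prog d ;; dels_prog ds)"

text \<open>\<open>SN\<close> is changed only from \<open>SP\<close> upwards and \<open>SP\<close>
  stays in place, so the same code also serves to measure a union without creating a child.\<close>

definition mark_prog :: "del list \<Rightarrow> prog" where
  "mark_prog ds = (SZ ::= Num 0 ;; QQ ::= Num 0 ;;
     count_loop QQ (Var NN) (SN\<langle>Plus (Var SP) (Var QQ)\<rangle> ::= Elt DE (Var QQ)) ;; dels_prog ds)"

definition child_prog :: "del list \<Rightarrow> prog" where
  "child_prog ds = (mark_prog ds ;; IF Below (Var KC) (Var SZ) THEN Nop
     ELSE (SN\<langle>Plus (Var SP) (Var NN)\<rangle> ::= Minus (Var KC) (Var SZ) ;; SP ::= Plus (Var SP) (Plus (Var NN) (Num 1))))"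

fun family_prog :: "del list list \<Rightarrow> prog" where
  "family_prog [] = (BR ::= Num 1)"
| "family_prog (ds # F) = (child_prog ds ;; family_prog F)"

lemma reg_writes_del_prog: "reg_writes (del_prog d) \<subseteq> {PP, EE, UU, SZ}"
  by (cases d) (auto simp: mark_def)

lemma arr_writes_del_prog: "arr_writes (del_prog d) \<subseteq> {SN}"
  by (cases d) (auto simp: mark_def)

lemma reg_writes_dels_prog: "reg_writes (dels_prog ds) \<subseteq> {PP, EE, UU, SZ}"
  using reg_writes_del_prog by (induction ds) auto

lemma arr_writes_dels_prog: "arr_writes (dels_prog ds) \<subseteq> {SN}"
  using arr_writes_del_prog by (induction ds) auto

lemma reg_writes_mark_prog: "reg_writes (mark_prog ds) \<subseteq> {PP, EE, UU, SZ, QQ}"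
  using reg_writes_dels_prog[of ds] by (auto simp: mark_prog_def)

lemma arr_writes_mark_prog: "arr_writes (mark_prog ds) \<subseteq> {SN}"
  using arr_writes_dels_prog[of ds] by (auto simp: mark_prog_def)

lemma reg_writes_child_prog: "reg_writes (child_prog ds) \<subseteq> {PP, EE, UU, SZ, QQ, SP}"
  using reg_writes_mark_prog[of ds] by (auto simp: child_prog_def)

lemma arr_writes_child_prog: "arr_writes (child_prog ds) \<subseteq> {SN}"
  using arr_writes_mark_prog[of ds] by (auto simp: child_prog_def)

lemma reg_writes_family_prog: "reg_writes (family_prog F) \<subseteq> {PP, EE, UU, SZ, QQ, SP, BR}"
  by (induction F) (use reg_writes_child_prog in force)+

lemma arr_writes_family_prog: "arr_writes (family_prog F) \<subseteq> {SN}"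
  using arr_writes_child_prog by (induction F) auto

fun del_regs :: "del \<Rightarrow> reg set" where
  "del_regs (Del r) = {r}"
| "del_regs (DelN r r') = {r, r'}"

definition scratch :: "reg set" where
  "scratch = {PP, EE, UU, SZ, QQ, SP, BR}"

section \<open>Subproblems as deletion sets in a fixed order\<close>

locale ordered_graph = input_graph +
  fixes pos :: "nat \<Rightarrow> nat" and od :: "nat \<Rightarrow> nat"
  assumes order: "search_order {0..<n} E pos"
    and pos_range: "\<And>v. v < n \<Longrightarrow> 0 < pos v \<and> pos v \<le> n"
    and od: "\<And>i. 0 < i \<Longrightarrow> i \<le> n \<Longrightarrow> od i < n \<and> pos (od i) = i"
begin

definition alive :: "nat set \<Rightarrow> nat set" where
  "alive D = {0..<n} - D"

sublocale whole: elimination_order "{0..<n}" "adjacent E" pos T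
  by (rule search_order_elimination_order[OF chordal order])

lemma elimination_order_alive: "elimination_order (alive D) (adjacent E) pos"
  by (rule elimination_order_mono[OF whole.elimination_order_axioms]) (auto simp: alive_def)

definition later :: "nat set \<Rightarrow> nat \<Rightarrow> nat set" where
  "later D v = elimination_order.up (alive D) (adjacent E) pos v"

lemma later_iff: "u \<in> later D v \<longleftrightarrow> u < n \<and> u \<notin> D \<and> adjacent E v u \<and> pos v < pos u"
proof -
  interpret W: elimination_order "alive D" "adjacent E" pos T by (rule elimination_order_alive)
  show ?thesis unfolding later_def W.up_def by (auto simp: alive_def)
qed

definition ready :: "nat set \<Rightarrow> (arr \<Rightarrow> nat \<Rightarrow> nat) \<Rightarrow> bool" where
  "ready D A \<longleftrightarrow> loaded A \<and> A PO = pos \<and> A OD = od \<and> (\<forall>v<n. A DE v = 0 \<longleftrightarrow> v \<notin> D)"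

lemma ready_cong: "ready D A \<Longrightarrow> (\<And>a. a \<in> {IN, ST, PO, OD, DE} \<Longrightarrow> A' a = A a) \<Longrightarrow> ready D A'"
  by (auto simp: ready_def loaded_def)

fun del_set :: "nat set \<Rightarrow> (reg \<Rightarrow> nat) \<Rightarrow> del \<Rightarrow> nat set" where
  "del_set D R (Del r) = {R r}"
| "del_set D R (DelN r r') = later D (R r) - {R r'}"

definition dels_set :: "nat set \<Rightarrow> (reg \<Rightarrow> nat) \<Rightarrow> del list \<Rightarrow> nat set" where
  "dels_set D R ds = (\<Union>d\<in>set ds. del_set D R d)"

fun del_ok :: "nat set \<Rightarrow> (reg \<Rightarrow> nat) \<Rightarrow> del \<Rightarrow> bool" where
  "del_ok D R (Del r) \<longleftrightarrow> R r \<in> alive D \<and> r \<notin> scratch"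
| "del_ok D R (DelN r r') \<longleftrightarrow> R r \<in> alive D \<and> r \<notin> scratch \<and> r' \<notin> scratch"

lemma del_ok_cong: "(\<And>r. r \<notin> scratch \<Longrightarrow> R' r = R r) \<Longrightarrow> del_ok D R d \<Longrightarrow> del_ok D R' d"
  by (cases d) auto

lemma del_set_cong: "(\<And>r. r \<notin> scratch \<Longrightarrow> R' r = R r) \<Longrightarrow> del_ok D R d \<Longrightarrow> del_set D R' d = del_set D R d"
  by (cases d) auto

lemma dels_set_cong:
  "(\<And>r. r \<notin> scratch \<Longrightarrow> R' r = R r) \<Longrightarrow> \<forall>d\<in>set ds. del_ok D R d \<Longrightarrow> dels_set D R' ds = dels_set D R ds"
  unfolding dels_set_def using del_set_cong by (intro SUP_cong refl) blast

definition marked :: "nat set \<Rightarrow> nat set \<Rightarrow> (nat \<Rightarrow> nat) \<Rightarrow> (reg \<Rightarrow> nat) \<Rightarrow> (arr \<Rightarrow> nat \<Rightarrow> nat) \<Rightarrow> bool" where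
  "marked D X sn R A \<longleftrightarrow> X \<subseteq> alive D \<and> R SZ = card X \<and> (\<forall>v<n. A SN (R SP + v) \<noteq> 0 \<longleftrightarrow> v \<in> D \<union> X) \<and>
     (\<forall>q<R SP. A SN q = sn q)"

lemma marked_cong: "marked D X sn R A \<Longrightarrow> R' SZ = R SZ \<Longrightarrow> R' SP = R SP \<Longrightarrow> A' SN = A SN \<Longrightarrow> marked D X sn R' A'"
  by (simp add: marked_def)

lemma wp_mark:
  assumes "marked D X sn R A" "R UU \<in> alive D"
    and "\<And>R' A'. marked D (insert (R UU) X) sn R' A' \<Longrightarrow> (\<And>r. r \<noteq> SZ \<Longrightarrow> R' r = R r) \<Longrightarrow> (\<And>a. a \<noteq> SN \<Longrightarrow> A' a = A a) \<Longrightarrow> Q R' A' f"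
  shows "wp mark Q R A f"
proof (cases "A SN (R SP + R UU) = 0")
  case True
  have u: "R UU < n" "R UU \<notin> D" using assms(2) by (auto simp: alive_def)
  then have X: "R UU \<notin> X" using assms(1) True by (auto simp: marked_def)
  have "finite X" using assms(1) finite_subset[of X "alive D"] by (auto simp: marked_def alive_def)
  then have "card (insert (R UU) X) = Suc (card X)" using X by simp
  then have "marked D (insert (R UU) X) sn (R(SZ := Suc (R SZ))) (A(SN := (A SN)(R SP + R UU := 1)))"
    using assms(1,2) u by (auto simp: marked_def)
  then have "Q (R(SZ := Suc (R SZ))) (A(SN := (A SN)(R SP + R UU := 1))) f" by (rule assms(3)) auto
  then show ?thesis using True by (simp add: mark_def)
next
  case False
  then have "R UU \<in> X" using assms(1,2) by (auto simp: marked_def alive_def)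
  then have "marked D (insert (R UU) X) sn R A" using assms(1) by (simp add: insert_absorb)
  then have "Q R A f" by (rule assms(3)) auto
  then show ?thesis using False by (simp add: mark_def)
qed

lemma wp_del_prog:
  assumes rd: "ready D A" and mk: "marked D X sn R A" and ok: "del_ok D R d" and f: "n + g \<le> f"
    and post: "\<And>R' A' f'. \<lbrakk>marked D (X \<union> del_set D R d) sn R' A'; g \<le> f'; same_off (del_prog d) R A R' A'\<rbrakk> \<Longrightarrow> Q R' A' f'"
  shows "wp (del_prog d) Q R A f"
proof (cases d)
  case (Del r)
  have r: "R r \<in> alive D" using ok Del by simp
  have "wp mark Q (R(UU := R r)) A f"
  proof (rule wp_mark[of D X sn])
    show "marked D X sn (R(UU := R r)) A" using mk by (auto intro: marked_cong)
    fix R' A' assume "marked D (insert ((R(UU := R r)) UU) X) sn R' A'"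
      "\<And>x. x \<noteq> SZ \<Longrightarrow> R' x = (R(UU := R r)) x" "\<And>a. a \<noteq> SN \<Longrightarrow> A' a = A a"
    then show "Q R' A' f" using f Del by (intro post) (auto simp: same_off_def mark_def)
  qed (use r in auto)
  then show ?thesis using Del by simp
next
  case (DelN r r')
  have v: "R r < n" "r \<notin> scratch" "r' \<notin> scratch" using ok DelN by (auto simp: alive_def)
  then have ne: "r \<notin> {PP, EE, UU, SZ, SP}" "r' \<notin> {PP, EE, UU, SZ, SP}" by (auto simp: scratch_def)
  let ?c = "IF Both (Below (Elt DE (Var UU)) (Num 1)) (Both (Below (Elt PO (Var r)) (Elt PO (Var UU))) (Fails (same (Var UU) (Var r'))))
      THEN mark ELSE Nop"
  let ?Y = "\<lambda>ys. {u\<in>set ys. u \<in> later D (R r) - {R r'}}"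
  have "wp (scan_nbrs r ?c) Q R A f"
  proof (rule wp_scan_nbrs[where v = "R r" and I = "\<lambda>ys R' A' f'. marked D (X \<union> ?Y ys) sn R' A' \<and>
       length ys \<le> length (nbr ! R r) \<and> length (nbr ! R r) - length ys + g \<le> f'"])
    show "marked D (X \<union> ?Y []) sn (R(PP := p, EE := e)) A \<and> length [] \<le> length (nbr ! R r) \<and>
       length (nbr ! R r) - length [] + g \<le> f" for p e
      using mk f length_nbr_le[OF v(1)] by (auto intro: marked_cong)
  next
    fix ys u zs R' A' g' p
    assume split: "nbr ! R r = ys @ u # zs"
      and I: "marked D (X \<union> ?Y ys) sn R' A' \<and> length ys \<le> length (nbr ! R r) \<and> length (nbr ! R r) - length ys + g \<le> Suc g'"
      and so: "same_off (scan_nbrs r ?c) R A R' A'"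
    have A': "A' DE = A DE" "A' PO = pos" using so rd by (simp_all add: same_off_def mark_def ready_def)
    have R': "R' r = R r" "R' r' = R r'" using so ne by (auto simp: same_off_def mark_def)
    have u: "u < n" "adjacent E (R r) u" using nbr_less[OF v(1), of u] set_nbr[OF v(1)] split by auto
    let ?R = "R'(PP := p, UU := u)"
    have Rr: "?R r = R r" "?R r' = R r'" using R' ne by auto
    have DE: "A' DE u = 0 \<longleftrightarrow> u \<notin> D" using A' rd u by (simp add: ready_def)
    have mk': "marked D (X \<union> ?Y ys) sn ?R A'" using I by (auto intro: marked_cong)
    have len: "length (ys @ [u]) \<le> length (nbr ! R r)" "length (nbr ! R r) - length (ys @ [u]) + g \<le> g'"
      using split I by auto
    have B: "holds (Both (Below (Elt DE (Var UU)) (Num 1)) (Both (Below (Elt PO (Var r)) (Elt PO (Var UU))) (Fails (same (Var UU) (Var r'))))) ?R A' \<longleftrightarrow>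
        u \<notin> D \<and> pos (R r) < pos u \<and> u \<noteq> R r'"
      using DE A' Rr unfolding holds.simps holds_same ev.simps by simp
    show "wp ?c (\<lambda>R' A' f'. marked D (X \<union> ?Y (ys @ [u])) sn R' A' \<and> length (ys @ [u]) \<le> length (nbr ! R r) \<and>
         length (nbr ! R r) - length (ys @ [u]) + g \<le> f') ?R A' g'"
    proof (cases "u \<in> later D (R r) - {R r'}")
      case True
      then have h: "u \<notin> D" "pos (R r) < pos u" "u \<noteq> R r'" by (auto simp: later_iff)
      have eq: "X \<union> ?Y (ys @ [u]) = insert (?R UU) (X \<union> ?Y ys)" using True by auto
      have "wp mark (\<lambda>R' A' f'. marked D (X \<union> ?Y (ys @ [u])) sn R' A' \<and> length (ys @ [u]) \<le> length (nbr ! R r) \<and>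
         length (nbr ! R r) - length (ys @ [u]) + g \<le> f') ?R A' g'"
        by (rule wp_mark[OF mk']) (use len h u eq in \<open>auto simp: alive_def\<close>)
      then show ?thesis unfolding wp_Branch B using h by simp
    next
      case False
      then have eq: "?Y (ys @ [u]) = ?Y ys" by auto
      have "\<not> (u \<notin> D \<and> pos (R r) < pos u \<and> u \<noteq> R r')" using False u by (auto simp: later_iff)
      then show ?thesis unfolding wp_Branch B eq using mk' len by auto
    qed
  next
    fix R' A' f'
    assume I: "marked D (X \<union> ?Y (nbr ! R r)) sn R' A' \<and> length (nbr ! R r) \<le> length (nbr ! R r) \<and>
        length (nbr ! R r) - length (nbr ! R r) + g \<le> f'" and so: "same_off (scan_nbrs r ?c) R A R' A'"
    have "later D (R r) \<subseteq> set (nbr ! R r)" unfolding set_nbr[OF v(1)] by (auto simp: later_iff)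
    then have "?Y (nbr ! R r) = del_set D R d" unfolding DelN del_set.simps by blast
    then show "Q R' A' f'" using I so DelN by (intro post) auto
  qed (use rd v in \<open>auto simp: ready_def mark_def\<close>)
  then show ?thesis using DelN by simp
qed

lemma wp_dels_prog:
  assumes "ready D A" "marked D X sn R A" "\<forall>d\<in>set ds. del_ok D R d" "length ds * n + g \<le> f"
    and "\<And>R' A' f'. \<lbrakk>marked D (X \<union> dels_set D R ds) sn R' A'; g \<le> f'; same_off (dels_prog ds) R A R' A'\<rbrakk> \<Longrightarrow> Q R' A' f'"
  shows "wp (dels_prog ds) Q R A f"
  using assms
proof (induction ds arbitrary: R A X f)
  case Nil
  have "Q R A f" by (rule Nil.prems(5)) (use Nil in \<open>auto simp: dels_set_def same_off_def\<close>)
  then show ?case by simp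
next
  case (Cons d ds)
  have "wp (del_prog d) (wp (dels_prog ds) Q) R A f"
  proof (rule wp_del_prog[OF Cons.prems(1,2)])
    show "del_ok D R d" "n + (length ds * n + g) \<le> f" using Cons.prems by auto
    fix R' A' f'
    assume mk: "marked D (X \<union> del_set D R d) sn R' A'" and f': "length ds * n + g \<le> f'" and so: "same_off (del_prog d) R A R' A'"
    have R': "R' r = R r" if "r \<notin> scratch" for r using so reg_writes_del_prog[of d] that by (auto simp: same_off_def scratch_def)
    have A': "A' a = A a" if "a \<noteq> SN" for a using so arr_writes_del_prog[of d] that by (auto simp: same_off_def)
    show "wp (dels_prog ds) Q R' A' f'"
    proof (rule Cons.IH[OF _ mk _ f'])
      show "ready D A'" by (rule ready_cong[OF Cons.prems(1)]) (use A' in auto)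
      show "\<forall>d\<in>set ds. del_ok D R' d" using Cons.prems(3) del_ok_cong[of R' R] R' by auto
      fix R'' A'' f''
      assume "marked D (X \<union> del_set D R d \<union> dels_set D R' ds) sn R'' A''" "g \<le> f''" "same_off (dels_prog ds) R' A' R'' A''"
      moreover have "dels_set D R' ds = dels_set D R ds" using Cons.prems(3) by (intro dels_set_cong R') auto
      ultimately show "Q R'' A'' f''" using so
        by (intro Cons.prems(5)) (auto simp: dels_set_def same_off_def Un_assoc)
    qed
  qed
  then show ?case by simp
qed

lemma wp_mark_prog:
  assumes rd: "ready D A" and N: "R NN = n" and ok: "\<forall>d\<in>set ds. del_ok D R d" and f: "Suc (length ds) * n + g \<le> f"
    and post: "\<And>R' A' f'. \<lbrakk>marked D (dels_set D R ds) (A SN) R' A'; g \<le> f'; same_off (mark_prog ds) R A R' A'\<rbrakk> \<Longrightarrow> Q R' A' f'"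
  shows "wp (mark_prog ds) Q R A f"
proof -
  let ?R = "R(SZ := 0, QQ := 0)"
  let ?c = "SN\<langle>Plus (Var SP) (Var QQ)\<rangle> ::= Elt DE (Var QQ)"
  have "wp (count_loop QQ (Var NN) ?c) (wp (dels_prog ds) Q) ?R A f"
  proof (rule wp_count_loop[where m = 0 and N = n and I = "\<lambda>i R' A' f'. (\<forall>v<i. A' SN (R SP + v) = A DE v) \<and>
      (\<forall>q<R SP. A' SN q = A SN q) \<and> n - i + (length ds * n + g) \<le> f'"])
    fix i R' A' g' assume i: "i < n" "R' QQ = i" and I: "(\<forall>v<i. A' SN (R SP + v) = A DE v) \<and>
      (\<forall>q<R SP. A' SN q = A SN q) \<and> n - i + (length ds * n + g) \<le> Suc g'" and so: "same_off (count_loop QQ (Var NN) ?c) ?R A R' A'"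
    have "A' DE = A DE" "R' SP = R SP" using so by (simp_all add: same_off_def)
    then show "wp ?c (\<lambda>R'' A'' f''. (\<forall>v<Suc i. A'' SN (R SP + v) = A DE v) \<and> (\<forall>q<R SP. A'' SN q = A SN q) \<and>
        n - Suc i + (length ds * n + g) \<le> f'') R' A' g'"
      using I i by (auto simp: less_Suc_eq)
  next
    fix R' A' f' assume I: "(\<forall>v<n. A' SN (R SP + v) = A DE v) \<and> (\<forall>q<R SP. A' SN q = A SN q) \<and> n - n + (length ds * n + g) \<le> f'"
      and so: "same_off (count_loop QQ (Var NN) ?c) ?R A R' A'"
    have R': "R' r = ?R r" if "r \<noteq> QQ" for r using so that by (simp add: same_off_def)
    have A': "A' a = A a" if "a \<noteq> SN" for a using so that by (simp add: same_off_def)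
    have R'': "R' r = R r" if "r \<notin> scratch" for r using R'[of r] that by (auto simp: scratch_def)
    show "wp (dels_prog ds) Q R' A' f'"
    proof (rule wp_dels_prog)
      show "ready D A'" by (rule ready_cong[OF rd]) (use A' in auto)
      show "marked D {} (A SN) R' A'" using I R' rd by (auto simp: marked_def ready_def)
      show "\<forall>d\<in>set ds. del_ok D R' d" using ok del_ok_cong[of R' R] R'' by blast
      show "length ds * n + g \<le> f'" using I by simp
      fix R2 A2 f2 assume "marked D ({} \<union> dels_set D R' ds) (A SN) R2 A2" "g \<le> f2" "same_off (dels_prog ds) R' A' R2 A2"
      moreover have "dels_set D R' ds = dels_set D R ds" using ok by (intro dels_set_cong R'') auto
      ultimately show "Q R2 A2 f2" using so by (intro post) (auto simp: same_off_def mark_prog_def)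
    qed
  qed (use N f in \<open>auto simp: same_off_def\<close>)
  then show ?thesis by (simp add: mark_prog_def)
qed

definition stack :: "(arr \<Rightarrow> nat \<Rightarrow> nat) \<Rightarrow> nat \<Rightarrow> (nat set \<times> nat) list \<Rightarrow> bool" where
  "stack A sp stk \<longleftrightarrow> sp = length stk * (n + 1) \<and>
     (\<forall>e<length stk. A SN (e * (n + 1) + n) = snd (stk ! e) \<and>
        (\<forall>v<n. A SN (e * (n + 1) + v) \<noteq> 0 \<longleftrightarrow> v \<in> fst (stk ! e)))"

lemma stack_cong:
  assumes "stack A sp stk" "\<And>q. q < sp \<Longrightarrow> A' SN q = A SN q"
  shows "stack A' sp stk"
proof -
  have lt: "e * (n + 1) + v < sp" if "e < length stk" "v \<le> n" for e v
  proof -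
    have "Suc e * (n + 1) \<le> length stk * (n + 1)" using that(1) by (intro mult_right_mono) auto
    then show ?thesis using assms(1) that(2) by (simp add: stack_def)
  qed
  then have "A' SN (e * (n + 1) + v) = A SN (e * (n + 1) + v)" if "e < length stk" "v \<le> n" for e v
    using assms(2) that by blast
  then show ?thesis using assms(1) unfolding stack_def by (metis le_refl less_imp_le_nat)
qed

lemma stack_snoc:
  assumes "stack A sp stk" "\<And>v. v < n \<Longrightarrow> A SN (sp + v) \<noteq> 0 \<longleftrightarrow> v \<in> D" "A SN (sp + n) = kc"
  shows "stack A (sp + (n + 1)) (stk @ [(D, kc)])"
  using assms unfolding stack_def by (auto simp: nth_append less_Suc_eq)

definition children :: "nat set \<Rightarrow> nat \<Rightarrow> nat set list \<Rightarrow> (nat set \<times> nat) list" where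
  "children D kc F = map (\<lambda>X. (D \<union> X, kc - card X)) (filter (\<lambda>X. card X \<le> kc) F)"

lemma wp_child_prog:
  assumes rd: "ready D A" and N: "R NN = n" and KC: "R KC = kc" and ok: "\<forall>d\<in>set ds. del_ok D R d"
    and st: "stack A (R SP) stk" and f: "Suc (length ds) * n + g \<le> f"
    and post: "\<And>R' A' f'. \<lbrakk>stack A' (R' SP) (stk @ children D kc [dels_set D R ds]); g \<le> f'; same_off (child_prog ds) R A R' A'\<rbrakk> \<Longrightarrow> Q R' A' f'"
  shows "wp (child_prog ds) Q R A f"
proof -
  let ?X = "dels_set D R ds"
  let ?c = "IF Below (Var KC) (Var SZ) THEN Nop
     ELSE (SN\<langle>Plus (Var SP) (Var NN)\<rangle> ::= Minus (Var KC) (Var SZ) ;; SP ::= Plus (Var SP) (Plus (Var NN) (Num 1)))"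
  have "wp (mark_prog ds) (wp ?c Q) R A f"
  proof (rule wp_mark_prog[OF rd N ok f])
    fix R' A' f' assume mk: "marked D ?X (A SN) R' A'" and g: "g \<le> f'" and so: "same_off (mark_prog ds) R A R' A'"
    have R': "R' NN = n" "R' KC = kc" "R' SP = R SP" using so reg_writes_mark_prog[of ds] N KC by (auto simp: same_off_def)
    have SZ: "R' SZ = card ?X" using mk by (simp add: marked_def)
    have st': "stack A' (R SP) stk" using stack_cong[OF st] mk R' by (simp add: marked_def)
    show "wp ?c Q R' A' f'"
    proof (cases "card ?X \<le> kc")
      case False
      then have "Q R' A' f'" using st' R' g so by (intro post) (auto simp: children_def same_off_def child_prog_def)
      then show ?thesis using False R' SZ by simp
    next
      case True
      let ?A = "A'(SN := (A' SN)(R SP + n := kc - card ?X))" and ?R = "R'(SP := R SP + (n + 1))"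
      have "stack ?A (R SP) stk" using stack_cong[OF st', of ?A] by simp
      then have "stack ?A (R SP + (n + 1)) (stk @ [(D \<union> ?X, kc - card ?X)])"
        by (rule stack_snoc) (use mk R' in \<open>auto simp: marked_def\<close>)
      then have "Q ?R ?A f'" using True g so by (intro post) (auto simp: children_def same_off_def child_prog_def)
      then show ?thesis using True R' SZ by simp
    qed
  qed
  then show ?thesis by (simp add: child_prog_def)
qed

text \<open>For each set, one \<open>n\<close> for copying the flags and one for each of its parts,
  since a neighbour list has at most \<open>n\<close> entries.\<close>

definition family_cost :: "del list list \<Rightarrow> nat" where
  "family_cost F = sum_list (map (\<lambda>ds. Suc (length ds)) F) * n"

lemma wp_family_prog:
  assumes "ready D A" "R NN = n" "R KC = kc" "\<forall>ds\<in>set F. \<forall>d\<in>set ds. del_ok D R d"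
    "stack A (R SP) stk" "family_cost F + g \<le> f"
    and "\<And>R' A' f'. \<lbrakk>stack A' (R' SP) (stk @ children D kc (map (dels_set D R) F)); R' BR = 1; g \<le> f';
       same_off (family_prog F) R A R' A'\<rbrakk> \<Longrightarrow> Q R' A' f'"
  shows "wp (family_prog F) Q R A f"
  using assms
proof (induction F arbitrary: R A stk f)
  case Nil
  have "Q (R(BR := 1)) A f"
    by (rule Nil.prems(7)) (use Nil in \<open>auto simp: family_cost_def children_def same_off_def\<close>)
  then show ?case by simp
next
  case (Cons ds F)
  have "wp (child_prog ds) (wp (family_prog F) Q) R A f"
  proof (rule wp_child_prog[OF Cons.prems(1-3) _ Cons.prems(5)])
    show "\<forall>d\<in>set ds. del_ok D R d" "Suc (length ds) * n + (family_cost F + g) \<le> f"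
      using Cons.prems by (auto simp: family_cost_def algebra_simps)
    fix R' A' f'
    assume st: "stack A' (R' SP) (stk @ children D kc [dels_set D R ds])" and f': "family_cost F + g \<le> f'"
      and so: "same_off (child_prog ds) R A R' A'"
    have R': "R' r = R r" if "r \<notin> scratch" for r using so reg_writes_child_prog[of ds] that by (auto simp: same_off_def scratch_def)
    have A': "A' a = A a" if "a \<noteq> SN" for a using so arr_writes_child_prog[of ds] that by (auto simp: same_off_def)
    show "wp (family_prog F) Q R' A' f'"
    proof (rule Cons.IH[where R = R' and A = A' and stk = "stk @ children D kc [dels_set D R ds]" and f = f'])
      show "ready D A'" by (rule ready_cong[OF Cons.prems(1)]) (use A' in auto)
      show "stack A' (R' SP) (stk @ children D kc [dels_set D R ds])" "family_cost F + g \<le> f'" by fact+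
      show "R' NN = n" "R' KC = kc" using Cons.prems R' by (auto simp: scratch_def)
      show "\<forall>ds\<in>set F. \<forall>d\<in>set ds. del_ok D R' d" using Cons.prems(4) del_ok_cong[of R' R] R' by auto
      fix R2 A2 f2
      assume st2: "stack A2 (R2 SP) ((stk @ children D kc [dels_set D R ds]) @ children D kc (map (dels_set D R') F))"
        and h: "R2 BR = 1" "g \<le> f2" "same_off (family_prog F) R' A' R2 A2"
      have "map (dels_set D R') F = map (dels_set D R) F"
        using Cons.prems(4) by (intro map_cong refl dels_set_cong R') auto
      then have "stack A2 (R2 SP) (stk @ children D kc (map (dels_set D R) (ds # F)))"
        using st2 unfolding \<open>map (dels_set D R') F = map (dels_set D R) F\<close> by (auto simp: children_def)
      then show "Q R2 A2 f2" using h so by (intro Cons.prems(7)) (auto simp: same_off_def)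
    qed
  qed
  then show ?case by simp
qed

end

section \<open>Scanning the vertices in elimination order\<close>

text \<open>\<open>TT\<close> and \<open>SW\<close> hold a vertex plus one, with 0 for none: a
  terminal in \<open>up x\<close>, and a star at \<open>x\<close> whose first later neighbour is not
  \<open>x\<close>. \<open>MN\<close> is the first vertex of \<open>up x\<close>, and
  \<open>SA\<close>, \<open>SB\<close> are the last two stars seen. Clearing \<open>LF\<close> at
  \<open>x\<close> removes the mark left by an earlier pass.\<close>

definition gather :: prog where
  "gather = (DD ::= Num 0 ;; TT ::= Num 0 ;; MN ::= Num 0 ;; CS ::= Num 0 ;; SW ::= Num 0 ;; SA ::= Num 0 ;; SB ::= Num 0 ;;
     LF\<langle>Var XX\<rangle> ::= Num 0 ;;
     scan_nbrs XX
      (IF Below (Elt DE (Var UU)) (Num 1)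
       THEN (IF Below (Elt PO (Var XX)) (Elt PO (Var UU))
             THEN ((IF Both (Fails (Below (Var DD) (Num 1))) (Fails (Below (Elt PO (Var UU)) (Elt PO (Var MN))))
                    THEN Nop ELSE MN ::= Var UU) ;;
                   DD ::= Plus (Var DD) (Num 1) ;;
                   (IF Below (Num 0) (Elt IN (Plus (Num 3) (Var UU))) THEN TT ::= Plus (Var UU) (Num 1) ELSE Nop))
             ELSE (IF Below (Num 0) (Elt LF (Var UU))
                   THEN (SB ::= Var SA ;; SA ::= Var UU ;; CS ::= Plus (Var CS) (Num 1) ;;
                         (IF same (Elt MM (Var UU)) (Var XX) THEN Nop ELSE SW ::= Plus (Var UU) (Num 1)))
                   ELSE Nop))
       ELSE Nop))"

context ordered_graph
begin

definition gathered :: "nat set \<Rightarrow> nat set \<Rightarrow> nat \<Rightarrow> (reg \<Rightarrow> nat) \<Rightarrow> (arr \<Rightarrow> nat \<Rightarrow> nat) \<Rightarrow> bool" where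
  "gathered U S x R A \<longleftrightarrow> R DD = card U \<and> (R TT = 0 \<longrightarrow> U \<inter> T = {}) \<and> (R TT \<noteq> 0 \<longrightarrow> R TT - 1 \<in> U \<inter> T) \<and>
     (U \<noteq> {} \<longrightarrow> R MN \<in> U \<and> (\<forall>u\<in>U. pos (R MN) \<le> pos u)) \<and>
     R CS = card S \<and> (1 \<le> R CS \<longrightarrow> R SA \<in> S) \<and> (2 \<le> R CS \<longrightarrow> R SB \<in> S \<and> R SA \<noteq> R SB) \<and>
     (R SW = 0 \<longrightarrow> (\<forall>v\<in>S. A MM v = x)) \<and> (R SW \<noteq> 0 \<longrightarrow> R SW - 1 \<in> S \<and> A MM (R SW - 1) \<noteq> x)"

lemma gathered_cong:
  assumes "gathered U S x R A" "\<And>r. r \<in> {DD, TT, MN, CS, SA, SB, SW} \<Longrightarrow> R' r = R r" "A' MM = A MM"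
  shows "gathered U S x R' A'"
proof -
  have eqs: "R' DD = R DD" "R' TT = R TT" "R' MN = R MN" "R' CS = R CS" "R' SA = R SA" "R' SB = R SB" "R' SW = R SW"
    by (rule assms(2); simp)+
  show ?thesis using assms(1) unfolding gathered_def eqs assms(3) .
qed

lemma gathered_later:
  assumes g: "gathered U S x R A" and fin: "finite U" and u: "u \<notin> U"
    and R': "R' DD = Suc (R DD)" "R' TT = (if u \<in> T then Suc u else R TT)"
      "R' MN = (if 1 \<le> R DD \<and> \<not> pos u < pos (R MN) then R MN else u)" "R' CS = R CS" "R' SA = R SA" "R' SB = R SB" "R' SW = R SW"
  shows "gathered (insert u U) S x R' A"
proof -
  have c: "R DD = card U" and t0: "R TT = 0 \<Longrightarrow> U \<inter> T = {}" and t1: "R TT \<noteq> 0 \<Longrightarrow> R TT - 1 \<in> U \<inter> T"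
    and m: "U \<noteq> {} \<Longrightarrow> R MN \<in> U" "\<And>w. w \<in> U \<Longrightarrow> pos (R MN) \<le> pos w"
    using g unfolding gathered_def by blast+
  have e: "U = {} \<longleftrightarrow> R DD = 0" using fin c by simp
  have m': "R' MN \<in> insert u U \<and> (\<forall>w\<in>insert u U. pos (R' MN) \<le> pos w)"
  proof (cases "1 \<le> R DD \<and> \<not> pos u < pos (R MN)")
    case True
    then show ?thesis using R'(3) m e by auto
  next
    case False
    then have "pos u \<le> pos w" if "w \<in> U" for w using m(2)[OF that] that e by auto
    then show ?thesis using R'(3) False by auto
  qed
  have t: "(R' TT = 0 \<longrightarrow> insert u U \<inter> T = {}) \<and> (R' TT \<noteq> 0 \<longrightarrow> R' TT - 1 \<in> insert u U \<inter> T)"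
    using R'(2) t0 t1 by auto
  have "R' DD = card (insert u U)" using R'(1) c fin u by simp
  then show ?thesis using g m' t unfolding gathered_def R'(4-7) by blast
qed

lemma gathered_star:
  assumes g: "gathered U S x R A" and fin: "finite S" and u: "u \<notin> S"
    and R': "R' DD = R DD" "R' TT = R TT" "R' MN = R MN" "R' CS = Suc (R CS)" "R' SA = u" "R' SB = R SA"
      "R' SW = (if A MM u = x then R SW else Suc u)"
  shows "gathered U (insert u S) x R' A"
  using assms unfolding gathered_def by (auto simp: Suc_le_eq)

lemma wp_gather:
  assumes rd: "ready D A" and x: "R XX = x" "x \<in> alive D" and f: "length (nbr ! x) + g \<le> f"
    and post: "\<And>R' A' f'. \<lbrakk>gathered (later D x) {v \<in> alive D. x \<in> later D v \<and> A LF v \<noteq> 0} x R' A'; A' LF = (A LF)(x := 0);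
       g \<le> f'; same_off gather R A R' A'\<rbrakk> \<Longrightarrow> Q R' A' f'"
  shows "wp gather Q R A f"
proof -
  have xn: "x < n" using x by (simp add: alive_def)
  let ?c = "IF Below (Elt DE (Var UU)) (Num 1)
       THEN (IF Below (Elt PO (Var XX)) (Elt PO (Var UU))
             THEN ((IF Both (Fails (Below (Var DD) (Num 1))) (Fails (Below (Elt PO (Var UU)) (Elt PO (Var MN))))
                    THEN Nop ELSE MN ::= Var UU) ;;
                   DD ::= Plus (Var DD) (Num 1) ;;
                   (IF Below (Num 0) (Elt IN (Plus (Num 3) (Var UU))) THEN TT ::= Plus (Var UU) (Num 1) ELSE Nop))
             ELSE (IF Below (Num 0) (Elt LF (Var UU))
                   THEN (SB ::= Var SA ;; SA ::= Var UU ;; CS ::= Plus (Var CS) (Num 1) ;;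
                         (IF same (Elt MM (Var UU)) (Var XX) THEN Nop ELSE SW ::= Plus (Var UU) (Num 1)))
                   ELSE Nop))
       ELSE Nop"
  let ?R = "R(DD := 0, TT := 0, MN := 0, CS := 0, SW := 0, SA := 0, SB := 0)"
  let ?A = "A(LF := (A LF)(x := 0))"
  let ?U = "\<lambda>ys. {u\<in>set ys. u \<in> later D x}" and ?S = "\<lambda>ys. {v\<in>set ys. v \<in> alive D \<and> x \<in> later D v \<and> A LF v \<noteq> 0}"
  have "wp (scan_nbrs XX ?c) Q ?R ?A f"
  proof (rule wp_scan_nbrs[where v = x and I = "\<lambda>ys R' A' f'. gathered (?U ys) (?S ys) x R' A' \<and>
      length ys \<le> length (nbr ! x) \<and> length (nbr ! x) - length ys + g \<le> f'"])
    show "gathered (?U []) (?S []) x (?R(PP := p, EE := e)) ?A \<and> length [] \<le> length (nbr ! x) \<and>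
       length (nbr ! x) - length [] + g \<le> f" for p e
      using f by (simp add: gathered_def)
  next
    fix ys u zs R' A' g' p
    assume split: "nbr ! x = ys @ u # zs"
      and I: "gathered (?U ys) (?S ys) x R' A' \<and> length ys \<le> length (nbr ! x) \<and> length (nbr ! x) - length ys + g \<le> Suc g'"
      and so: "same_off (scan_nbrs XX ?c) ?R ?A R' A'"
    have "A' = ?A" using so by (auto simp: same_off_def)
    then have A': "A' DE = A DE" "A' PO = pos" "A' IN = A IN" "A' LF = (A LF)(x := 0)" "A' MM = A MM"
      using rd by (auto simp: ready_def)
    have X: "R' XX = x" using so x by (simp add: same_off_def)
    have u: "u < n" "adjacent E x u" "u \<notin> set ys" "u \<noteq> x"
      using nbr_less[OF xn, of u] set_nbr[OF xn] distinct_nbr[OF xn] split whole.adj_irrefl by auto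
    have DE: "A' DE u = 0 \<longleftrightarrow> u \<notin> D" using A' rd u by (simp add: ready_def)
    have IN: "0 < A' IN (3 + u) \<longleftrightarrow> u \<in> T" using rd u A' by (simp add: ready_def loaded_def)
    have len: "length (ys @ [u]) \<le> length (nbr ! x)" "length (nbr ! x) - length (ys @ [u]) + g \<le> g'" using split I by auto
    let ?R1 = "R'(PP := p, UU := u)"
    let ?I = "\<lambda>R' A' f'. gathered (?U (ys @ [u])) (?S (ys @ [u])) x R' A' \<and> length (ys @ [u]) \<le> length (nbr ! x) \<and>
       length (nbr ! x) - length (ys @ [u]) + g \<le> f'"
    have gat: "gathered (?U ys) (?S ys) x R' A'" using I by simp
    have gat1: "gathered (?U ys) (?S ys) x ?R1 A'" using gat by (rule gathered_cong) auto
    define J where "J = ?I"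
    have J: "J R2 A' g'" if "gathered (?U (ys @ [u])) (?S (ys @ [u])) x R2 A'" for R2
      unfolding J_def using that len by blast
    have case_u: "u \<in> D \<or> u \<notin> D \<and> pos x < pos u \<or> u \<notin> D \<and> pos u < pos x \<and> A LF u \<noteq> 0 \<or> u \<notin> D \<and> pos u < pos x \<and> A LF u = 0"
      using u xn whole.inj_pos by (metis atLeastLessThan_iff inj_onD nat_neq_iff zero_le)
    then consider (dead) "u \<in> D" | (up) "u \<notin> D" "pos x < pos u" | (star) "u \<notin> D" "pos u < pos x" "A LF u \<noteq> 0" | (none) "u \<notin> D" "pos u < pos x" "A LF u = 0"
      by blast
    then have "wp ?c J ?R1 A' g'"
    proof cases
      case dead
      then have "?U (ys @ [u]) = ?U ys" "?S (ys @ [u]) = ?S ys" by (auto simp: later_iff alive_def)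
      then have "J ?R1 A' g'" using gat1 by (intro J) simp
      then show ?thesis using dead DE by simp
    next
      case up
      have U: "?U (ys @ [u]) = insert u (?U ys)" using up u by (auto simp: later_iff)
      have S: "?S (ys @ [u]) = ?S ys" using up by (auto simp: later_iff)
      have fin: "finite (?U ys)" "u \<notin> ?U ys" using u by auto
      have G: "J R2 A' g'"
        if "R2 DD = Suc (R' DD)" "R2 TT = (if u \<in> T then Suc u else R' TT)"
          "R2 MN = (if 1 \<le> R' DD \<and> \<not> pos u < pos (R' MN) then R' MN else u)" "R2 CS = R' CS" "R2 SA = R' SA" "R2 SB = R' SB" "R2 SW = R' SW" for R2
        by (rule J, unfold U S, rule gathered_later[OF gat fin]) (use that in auto)
      show ?thesis using up DE A'(2) X IN by (simp add: G)
    next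
      case star
      have S: "?S (ys @ [u]) = insert u (?S ys)" using star u xn x adjacent_sym by (auto simp: later_iff alive_def)
      have U: "?U (ys @ [u]) = ?U ys" using star by (auto simp: later_iff)
      have fin: "finite (?S ys)" "u \<notin> ?S ys" using u by auto
      have G: "J R2 A' g'"
        if "R2 DD = R' DD" "R2 TT = R' TT" "R2 MN = R' MN" "R2 CS = Suc (R' CS)" "R2 SA = u" "R2 SB = R' SA"
          "R2 SW = (if A' MM u = x then R' SW else Suc u)" for R2
        by (rule J, unfold U S, rule gathered_star[OF gat fin]) (use that in auto)
      show ?thesis using star DE A'(2,4) u X by (simp add: G)
    next
      case none
      then have "?U (ys @ [u]) = ?U ys" "?S (ys @ [u]) = ?S ys" by (auto simp: later_iff)
      then have "J ?R1 A' g'" using gat1 by (intro J) simp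
      then show ?thesis using none DE A'(2,4) u X by simp
    qed
    then show "wp ?c ?I ?R1 A' g'" unfolding J_def .
  next
    fix R' A' f'
    assume I: "gathered (?U (nbr ! x)) (?S (nbr ! x)) x R' A' \<and> length (nbr ! x) \<le> length (nbr ! x) \<and>
       length (nbr ! x) - length (nbr ! x) + g \<le> f'" and so: "same_off (scan_nbrs XX ?c) ?R ?A R' A'"
    have "u \<in> set (nbr ! x)" if "u \<in> later D x \<or> x \<in> later D u" for u
      using that set_nbr[OF xn] adjacent_sym by (auto simp: later_iff)
    then have "?U (nbr ! x) = later D x" "?S (nbr ! x) = {v \<in> alive D. x \<in> later D v \<and> A LF v \<noteq> 0}" by auto
    moreover have "A' LF = (A LF)(x := 0)" using so by (simp add: same_off_def)
    ultimately show "Q R' A' f'" using I so by (intro post) (auto simp: same_off_def gather_def)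
  qed (use rd xn x in \<open>auto simp: ready_def loaded_def\<close>)
  then show ?thesis using x by (simp add: gather_def)
qed

end

section \<open>Choosing the branching family\<close>

text \<open>Treats the stars \<open>VV\<close> and \<open>r\<close> at \<open>y\<close> when one has
  degree above three or when they share another vertex, which shows in a union of fewer than four
  vertices. The exceptional configuration is left to \<open>c\<close>.\<close>

definition pair_prog :: "reg \<Rightarrow> reg \<Rightarrow> prog \<Rightarrow> prog" where
  "pair_prog y r c =
     (IF Below (Num 3) (Elt DG (Var VV))
      THEN family_prog [[Del y], [Del VV, Del r], [Del VV, DelN r y], [DelN VV y]]
      ELSE IF Below (Num 3) (Elt DG (Var r))
      THEN family_prog [[Del y], [Del r, Del VV], [Del r, DelN VV y], [DelN r y]]
      ELSE (mark_prog [DelN VV y, DelN r y] ;;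
        IF Below (Var SZ) (Num 4)
        THEN family_prog [[Del y], [Del VV, Del r], [DelN VV y, DelN r y]] ELSE c))"

text \<open>When a vertex with several stars is passed over, only two of the stars are stored;
  whether they are exceptional is tested later, by the call of \<open>pair_prog\<close> at
  \<open>WW\<close>. A terminal with just two later neighbours takes \<open>MN\<close> as an
  arbitrary choice of \<open>t\<close>.\<close>

definition decide_prog :: prog where
  "decide_prog =
    (IF Below (Var CS) (Num 1)
     THEN (IF Below (Var DD) (Num 2) THEN Nop
       ELSE IF Below (Num 0) (Var TT) THEN (TT ::= Minus (Var TT) (Num 1) ;; family_prog [[Del TT], [DelN XX TT]])
       ELSE IF Below (Num 0) (Elt IN (Plus (Num 3) (Var XX)))
       THEN (IF Below (Var DD) (Num 3) THEN (TT ::= Var MN ;; family_prog [[Del TT], [DelN XX TT]])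
             ELSE (LF\<langle>Var XX\<rangle> ::= Num 1 ;; MM\<langle>Var XX\<rangle> ::= Var MN ;; DG\<langle>Var XX\<rangle> ::= Var DD))
       ELSE Nop)
     ELSE IF Below (Num 0) (Var SW)
     THEN (VV ::= Minus (Var SW) (Num 1) ;; WW ::= Elt MM (Var VV) ;;
       (IF same (Elt S1 (Var WW)) (Var VV) THEN V2 ::= Elt S2 (Var WW) ELSE V2 ::= Elt S1 (Var WW)) ;;
       pair_prog WW V2
        (IF Below (Var CS) (Num 2)
         THEN family_prog [[Del VV, Del V2], [Del VV, DelN V2 WW], [DelN VV XX], [DelN VV WW, DelN V2 WW]]
         ELSE ((IF same (Var SA) (Var VV) THEN V3 ::= Var SB ELSE V3 ::= Var SA) ;;
           pair_prog XX V3
            (family_prog [[Del XX], [Del VV, Del V2, Del V3], [Del VV, Del V2, DelN V3 XX], [Del VV, DelN V2 WW],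
               [DelN VV XX, Del V3], [DelN VV XX, DelN V3 XX]]))))
     ELSE IF Below (Num 0) (Var TT)
     THEN (TT ::= Minus (Var TT) (Num 1) ;; family_prog [[Del XX], [Del SA, Del TT], [DelN SA XX]])
     ELSE IF Below (Var CS) (Num 2) THEN family_prog [[Del SA], [DelN SA XX]]
     ELSE (S1\<langle>Var XX\<rangle> ::= Var SA ;; S2\<langle>Var XX\<rangle> ::= Var SB))"

lemma reg_writes_pair_prog: "reg_writes (pair_prog y r c) \<subseteq> scratch \<union> reg_writes c"
proof -
  have f: "reg_writes (family_prog F) \<subseteq> scratch" for F using reg_writes_family_prog by (auto simp: scratch_def)
  have m: "reg_writes (mark_prog ds) \<subseteq> scratch" for ds using reg_writes_mark_prog[of ds] by (auto simp: scratch_def)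
  show ?thesis unfolding pair_prog_def reg_writes.simps by (intro Un_least le_supI1[OF f] le_supI1[OF m]) auto
qed

lemma arr_writes_pair_prog: "arr_writes (pair_prog y r c) \<subseteq> insert SN (arr_writes c)"
proof -
  have f: "arr_writes (family_prog F) \<subseteq> insert SN X" for F X using arr_writes_family_prog[of F] by auto
  have m: "arr_writes (mark_prog ds) \<subseteq> insert SN X" for ds X using arr_writes_mark_prog[of ds] by auto
  show ?thesis unfolding pair_prog_def arr_writes.simps by (intro Un_least f m) auto
qed

lemma reg_writes_decide_prog: "reg_writes decide_prog \<subseteq> scratch \<union> {TT, VV, WW, V2, V3}"
proof -
  have f: "reg_writes (family_prog F) \<subseteq> scratch \<union> {TT, VV, WW, V2, V3}" for F
    using reg_writes_family_prog by (auto simp: scratch_def)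
  have p: "reg_writes (pair_prog y r c) \<subseteq> scratch \<union> {TT, VV, WW, V2, V3}"
    if "reg_writes c \<subseteq> scratch \<union> {TT, VV, WW, V2, V3}" for y r c
    using reg_writes_pair_prog[of y r c] that by auto
  have p2: "reg_writes (pair_prog WW V2 (IF b THEN family_prog F ELSE ((IF b' THEN V3 ::= Var SB ELSE V3 ::= Var SA) ;;
      pair_prog XX V3 (family_prog F')))) \<subseteq> scratch \<union> {TT, VV, WW, V2, V3}" for b b' F F'
    by (rule p, unfold reg_writes.simps, intro Un_least f p) auto
  show ?thesis unfolding decide_prog_def reg_writes.simps by (intro Un_least p2 f) auto
qed

lemma arr_writes_decide_prog: "arr_writes decide_prog \<subseteq> {SN, LF, MM, DG, S1, S2}"
proof -
  have f: "arr_writes (family_prog F) \<subseteq> {SN, LF, MM, DG, S1, S2}" for F using arr_writes_family_prog[of F] by auto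
  have p: "arr_writes (pair_prog y r c) \<subseteq> {SN, LF, MM, DG, S1, S2}" if "arr_writes c \<subseteq> {SN, LF, MM, DG, S1, S2}" for y r c
    using arr_writes_pair_prog[of y r c] that by auto
  have p2: "arr_writes (pair_prog WW V2 (IF b THEN family_prog F ELSE ((IF b' THEN V3 ::= Var SB ELSE V3 ::= Var SA) ;;
      pair_prog XX V3 (family_prog F')))) \<subseteq> {SN, LF, MM, DG, S1, S2}" for b b' F F'
    by (rule p, unfold arr_writes.simps, intro Un_least f p) auto
  show ?thesis unfolding decide_prog_def arr_writes.simps by (intro Un_least p2 f) auto
qed

context ordered_graph
begin

lemma dels_set_simps [simp]:
  "dels_set D R [] = {}" "dels_set D R (d # ds) = del_set D R d \<union> dels_set D R ds"
  by (auto simp: dels_set_def)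

definition node :: "nat set \<Rightarrow> nat \<Rightarrow> (nat set \<times> nat) list \<Rightarrow> (reg \<Rightarrow> nat) \<Rightarrow> (arr \<Rightarrow> nat \<Rightarrow> nat) \<Rightarrow> bool" where
  "node D kc stk R A \<longleftrightarrow> ready D A \<and> R NN = n \<and> R KC = kc \<and> stack A (R SP) stk"

definition branched :: "nat set \<Rightarrow> nat \<Rightarrow> (nat set \<times> nat) list \<Rightarrow> (reg \<Rightarrow> nat) \<Rightarrow> (arr \<Rightarrow> nat \<Rightarrow> nat) \<Rightarrow> bool" where
  "branched D kc stk R A \<longleftrightarrow> R BR = 1 \<and>
     (\<exists>F. elimination_order.branching (alive D) (adjacent E) pos T F \<and> stack A (R SP) (stk @ children D kc F))"

lemma node_cong:
  "node D kc stk R A \<Longrightarrow> R' NN = R NN \<Longrightarrow> R' KC = R KC \<Longrightarrow> R' SP = R SP \<Longrightarrow>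
   (\<And>a. a \<in> {IN, ST, PO, OD, DE, SN} \<Longrightarrow> A' a = A a) \<Longrightarrow> node D kc stk R' A'"
  by (auto simp: node_def stack_def ready_def loaded_def)

lemma wp_family_branch:
  assumes nd: "node D kc stk R A" and ok: "\<forall>ds\<in>set F. \<forall>d\<in>set ds. del_ok D R d"
    and f: "family_cost F + g \<le> f" and br: "elimination_order.branching (alive D) (adjacent E) pos T (map (dels_set D R) F)"
    and post: "\<And>R' A' f'. branched D kc stk R' A' \<Longrightarrow> g \<le> f' \<Longrightarrow> Q R' A' f'"
  shows "wp (family_prog F) Q R A f"
proof (rule wp_family_prog[OF _ _ _ ok _ f])
  show "ready D A" "R NN = n" "R KC = kc" "stack A (R SP) stk" using nd by (auto simp: node_def)
qed (use br post in \<open>auto simp: branched_def\<close>)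

text \<open>\<open>13 * n\<close> is \<open>3 * n\<close> for measuring the union and
  \<open>10 * n\<close> for the most expensive of the three families.\<close>

lemma wp_pair_prog:
  assumes nd: "node D kc stk R A" and sc: "elimination_order.scanned (alive D) (adjacent E) pos T i L"
    and v: "R VV = v" "v \<in> L" "a \<in> later D v" "A DG v = card (later D v)"
    and v': "R r = v'" "v' \<in> L" "a \<in> later D v'" "A DG v' = card (later D v')" and a: "R y = a"
    and ne: "v \<noteq> v'" and sr: "r \<notin> scratch" "y \<notin> scratch" and f: "13 * n + g \<le> f"
    and br: "\<And>R' A' f'. branched D kc stk R' A' \<Longrightarrow> g \<le> f' \<Longrightarrow> Q R' A' f'"
    and cont: "\<And>R' A' f'. \<lbrakk>node D kc stk R' A'; \<And>r. r \<notin> scratch \<or> r = BR \<Longrightarrow> R' r = R r; \<And>b. b \<noteq> SN \<Longrightarrow> A' b = A b;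
        card (later D v) = 3; card (later D v') = 3; 4 \<le> card ((later D v - {a}) \<union> (later D v' - {a})); g \<le> f'\<rbrakk> \<Longrightarrow> wp c Q R' A' f'"
  shows "wp (pair_prog y r c) Q R A f"
proof -
  interpret W: elimination_order "alive D" "adjacent E" pos T by (rule elimination_order_alive)
  have up: "later D = W.up" by (rule ext) (simp add: later_def)
  have st: "W.star v" "W.star v'" using W.scanned_star[OF sc] v v' by auto
  have in_alive: "v \<in> alive D" "v' \<in> alive D" using st by (auto simp: W.star_def)
  have "a \<in> alive D" using v W.up_V up by auto
  note al = in_alive this
  have VV: "VV \<notin> scratch" by (simp add: scratch_def)
  have ge3: "3 \<le> card (later D v)" "3 \<le> card (later D v')" using st by (auto simp: W.star_def up)
  let ?c1 = "wp (family_prog [[Del y], [Del VV, Del r], [Del VV, DelN r y], [DelN VV y]]) Q R A f"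
  have 1: ?c1 if "3 < A DG v"
  proof (rule wp_family_branch[OF nd _ _ _ br])
    have "W.branching [{a}, {v, v'}, {v} \<union> (W.up v' - {a}), W.up v - {a}]"
      using st v v' ne that up by (intro W.branching_big_star) auto
    then show "W.branching (map (dels_set D R) [[Del y], [Del VV, Del r], [Del VV, DelN r y], [DelN VV y]])"
      using v v' a up by (simp add: insert_commute)
  qed (use v v' a al sr VV f in \<open>auto simp: family_cost_def\<close>)
  have 2: "wp (family_prog [[Del y], [Del r, Del VV], [Del r, DelN VV y], [DelN r y]]) Q R A f" if "3 < A DG v'"
  proof (rule wp_family_branch[OF nd _ _ _ br])
    have "W.branching [{a}, {v', v}, {v'} \<union> (W.up v - {a}), W.up v' - {a}]"
      using st v v' ne that up by (intro W.branching_big_star) auto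
    then show "W.branching (map (dels_set D R) [[Del y], [Del r, Del VV], [Del r, DelN VV y], [DelN r y]])"
      using v v' a up by (simp add: insert_commute)
  qed (use v v' a al sr VV f in \<open>auto simp: family_cost_def\<close>)
  have 3: "wp (mark_prog [DelN VV y, DelN r y]) (wp (IF Below (Var SZ) (Num 4)
        THEN family_prog [[Del y], [Del VV, Del r], [DelN VV y, DelN r y]] ELSE c) Q) R A f"
    if "\<not> 3 < A DG v" "\<not> 3 < A DG v'"
  proof (rule wp_mark_prog[where D = D and g = "10 * n + g"])
    have c3: "card (later D v) = 3" "card (later D v') = 3" using that ge3 v v' by auto
    fix R' A' f' assume mk: "marked D (dels_set D R [DelN VV y, DelN r y]) (A SN) R' A'" and f': "10 * n + g \<le> f'"
      and so: "same_off (mark_prog [DelN VV y, DelN r y]) R A R' A'"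
    have R': "R' q = R q" if "q \<notin> scratch \<or> q = BR \<or> q = SP" for q
    proof -
      have "q \<notin> {PP, EE, UU, SZ, QQ}" using that by (auto simp: scratch_def)
      then have "q \<notin> reg_writes (mark_prog [DelN VV y, DelN r y])" using reg_writes_mark_prog by blast
      then show ?thesis using so by (simp add: same_off_def)
    qed
    have A': "A' b = A b" if "b \<noteq> SN" for b using so arr_writes_mark_prog that by (auto simp: same_off_def)
    have SZ: "R' SZ = card ((later D v - {a}) \<union> (later D v' - {a}))" using mk v v' a by (simp add: marked_def)
    have "stack A' (R SP) stk"
      by (rule stack_cong[of A]) (use nd mk R'[of SP] in \<open>auto simp: node_def marked_def\<close>)
    moreover have "ready D A'" by (rule ready_cong[of D A]) (use nd A' in \<open>auto simp: node_def\<close>)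
    moreover have "R' NN = R NN" "R' KC = R KC" "R' SP = R SP" by (rule R'; simp add: scratch_def)+
    ultimately have nd': "node D kc stk R' A'" using nd unfolding node_def by simp
    show "wp (IF Below (Var SZ) (Num 4) THEN family_prog [[Del y], [Del VV, Del r], [DelN VV y, DelN r y]] ELSE c) Q R' A' f'"
    proof (cases "R' SZ < 4")
      case True
      have "wp (family_prog [[Del y], [Del VV, Del r], [DelN VV y, DelN r y]]) Q R' A' f'"
      proof (rule wp_family_branch[OF nd' _ _ _ br])
        have "W.branching [{a}, {v, v'}, (W.up v - {a}) \<union> (W.up v' - {a})]"
          using v v' c3 True SZ ne unfolding up by (intro W.branching_sharing_stars[OF sc]) auto
        then show "W.branching (map (dels_set D R') [[Del y], [Del VV, Del r], [DelN VV y, DelN r y]])"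
          using v v' a up R' sr VV by (simp add: insert_commute)
      qed (use v v' a al sr VV R' f' in \<open>auto simp: family_cost_def\<close>)
      then show ?thesis using True by simp
    next
      case False
      have "wp c Q R' A' f'" using nd' c3 False SZ f' R' A' by (intro cont) auto
      then show ?thesis using False by simp
    qed
  qed (use nd v v' al sr VV f in \<open>auto simp: node_def\<close>)
  show ?thesis using 1 2 3 v v' by (simp add: pair_prog_def)
qed

text \<open>From position \<open>i\<close> on, \<open>LF\<close> may still hold marks of an earlier
  pass, hence the restriction.\<close>

definition stars_of :: "nat set \<Rightarrow> nat \<Rightarrow> (arr \<Rightarrow> nat \<Rightarrow> nat) \<Rightarrow> nat set" where
  "stars_of D i A = {v \<in> alive D. pos v < i \<and> A LF v \<noteq> 0}"

definition node_inv :: "nat set \<Rightarrow> nat \<Rightarrow> (arr \<Rightarrow> nat \<Rightarrow> nat) \<Rightarrow> bool" where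
  "node_inv D i A \<longleftrightarrow>
     elimination_order.scan_inv (alive D) (adjacent E) pos T i (stars_of D i A) (A MM) (A DG) (A S1) (A S2)"

lemma stars_of_Suc:
  assumes "x \<in> alive D" "pos x = i"
  shows "stars_of D (Suc i) A = stars_of D i A \<union> (if A LF x = 0 then {} else {x})"
proof -
  have *: "pos v = i \<longleftrightarrow> v = x" if "v \<in> alive D" for v
    using inj_onD[OF whole.inj_pos, of v x] that assms by (auto simp: alive_def)
  have "v \<in> stars_of D (Suc i) A \<longleftrightarrow> v \<in> stars_of D i A \<or> v = x \<and> A LF x \<noteq> 0" for v
    unfolding stars_of_def mem_Collect_eq less_Suc_eq using *[of v] assms(1) by blast
  then show ?thesis by auto
qed

lemma stars_of_cong: "(\<And>v. v \<in> alive D \<Longrightarrow> pos v < i \<Longrightarrow> A' LF v = A LF v) \<Longrightarrow> stars_of D i A' = stars_of D i A"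
  by (auto simp: stars_of_def)

text \<open>\<open>45 * n\<close> is attained with linked stars: 13 for each of the two calls of
  \<open>pair_prog\<close> and 19 for the six-member family. Passing over a vertex runs no loop, so
  \<open>cont\<close> returns all credits.\<close>

lemma wp_decide_prog:
  assumes nd: "node D kc stk R A" and x: "R XX = x" "x \<in> alive D" "pos x = i" and BR: "R BR = 0"
    and inv: "node_inv D i A" and LF: "A LF x = 0"
    and gat: "gathered (later D x) {v \<in> stars_of D i A. x \<in> later D v} x R A"
    and f: "45 * n + g \<le> f"
    and br: "\<And>R' A' f'. branched D kc stk R' A' \<Longrightarrow> g \<le> f' \<Longrightarrow> Q R' A' f'"
    and cont: "\<And>R' A'. \<lbrakk>R' BR = 0; node D kc stk R' A'; node_inv D (Suc i) A'\<rbrakk> \<Longrightarrow> Q R' A' f"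
  shows "wp decide_prog Q R A f"
proof -
  interpret W: elimination_order "alive D" "adjacent E" pos T by (rule elimination_order_alive)
  have up: "later D = W.up" by (rule ext) (simp add: later_def)
  let ?L = "stars_of D i A" and ?S = "{v \<in> stars_of D i A. x \<in> later D v}"
  have si: "W.scan_inv i ?L (A MM) (A DG) (A S1) (A S2)" using inv by (simp add: node_inv_def)
  then have sc: "W.scanned i ?L" by (simp add: W.scan_inv_def)
  have star: "W.star v" if "v \<in> ?L" for v using W.scanned_star[OF sc that] .
  have L_alive: "v \<in> alive D" if "v \<in> ?L" for v using that by (simp add: stars_of_def)
  have finS: "finite ?S" using finite_subset[of ?S "alive D"] by (auto simp: stars_of_def alive_def)
  have single: "a = b" if "a \<in> ?S" "b \<in> ?S" "card ?S = 1" for a b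
    using that by (metis card_1_singletonE singletonD)
  have IN: "0 < A IN (3 + x) \<longleftrightarrow> x \<in> T" using nd x by (simp add: node_def ready_def loaded_def alive_def)
  have DD: "R DD = card (later D x)" and CS: "R CS = card ?S" using gat by (auto simp: gathered_def)
  have fin_up: "finite (later D x)" unfolding up by (rule W.finite_up)
  have TTz: "R TT = 0 \<Longrightarrow> later D x \<inter> T = {}" and TTp: "R TT \<noteq> 0 \<Longrightarrow> R TT - 1 \<in> later D x \<inter> T"
    using gat by (auto simp: gathered_def)
  have MN: "R MN \<in> later D x" "\<And>u. u \<in> later D x \<Longrightarrow> pos (R MN) \<le> pos u" if "later D x \<noteq> {}"
    using gat that by (auto simp: gathered_def)
  have SA: "R SA \<in> ?S" if "1 \<le> R CS" using gat that by (auto simp: gathered_def)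
  have SB: "R SB \<in> ?S" "R SA \<noteq> R SB" if "2 \<le> R CS" using gat that by (auto simp: gathered_def)
  have SWz: "\<And>v. R SW = 0 \<Longrightarrow> v \<in> ?S \<Longrightarrow> A MM v = x" and SWp: "R SW \<noteq> 0 \<Longrightarrow> R SW - 1 \<in> ?S \<and> A MM (R SW - 1) \<noteq> x"
    using gat by (auto simp: gathered_def)
  have later_alive: "u \<in> alive D" if "u \<in> later D v" for u v using that by (auto simp: later_iff alive_def)
  have continue: "Q R A' f" if "node D kc stk R A'" "node_inv D (Suc i) A'" for A'
    using that BR by (intro cont) auto
  show ?thesis
  proof (cases "R CS < 1")
    case CS0: True
    then have nostar: "x \<notin> W.up v" if "v \<in> ?L" for v using CS finS that up by auto
    have simplicial: "wp (family_prog [[Del TT], [DelN XX TT]]) Q (R(TT := t)) A f"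
      if t: "t \<in> later D x" "2 \<le> card (later D x)" "t \<in> T \<or> x \<in> T \<and> card (later D x) = 2" for t
    proof (rule wp_family_branch[OF _ _ _ _ br])
      show "node D kc stk (R(TT := t)) A" using nd by (rule node_cong) auto
      have "W.branching [{t}, W.up x - {t}]"
        using t nostar x unfolding up by (intro W.branching_simplicial[OF sc]) auto
      then show "W.branching (map (dels_set D (R(TT := t))) [[Del TT], [DelN XX TT]])" using x up by simp
    qed (use t x later_alive f in \<open>auto simp: scratch_def family_cost_def\<close>)
    have inert: "Q R A f" if "W.inert x"
    proof (rule continue[OF nd])
      have "W.scan_inv (Suc i) ?L (A MM) (A DG) (A S1) (A S2)"
        using W.scan_inv_inert[OF si x(2,3) that nostar] .
      then show "node_inv D (Suc i) A" unfolding node_inv_def stars_of_Suc[OF x(2,3)] using LF by simp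
    qed
    consider (few) "R DD < 2" | (ter) "\<not> R DD < 2" "R TT \<noteq> 0" | (two) "\<not> R DD < 2" "R TT = 0" "x \<in> T" "R DD < 3"
      | (new) "\<not> R DD < 2" "R TT = 0" "x \<in> T" "\<not> R DD < 3" | (plain) "\<not> R DD < 2" "R TT = 0" "x \<notin> T" by blast
    then show ?thesis
    proof cases
      case few
      have "W.inert x" unfolding W.inert_def
      proof (intro allI notI)
        fix a b assume "W.T_triangle x a b"
        then have "{a, b} \<subseteq> later D x" "a \<noteq> b" by (auto simp: W.T_triangle_def up)
        then have "card {a, b} \<le> card (later D x)" using fin_up by (intro card_mono)
        then show False using few DD \<open>a \<noteq> b\<close> by simp
      qed
      then show ?thesis using few CS0 inert by (simp add: decide_prog_def)
    next
      case ter
      then have "wp (family_prog [[Del TT], [DelN XX TT]]) Q (R(TT := R TT - 1)) A f"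
        using TTp DD by (intro simplicial) auto
      then show ?thesis using ter CS0 by (simp add: decide_prog_def)
    next
      case two
      have "later D x \<noteq> {}" using two DD by auto
      then have "wp (family_prog [[Del TT], [DelN XX TT]]) Q (R(TT := R MN)) A f"
        using MN DD two by (intro simplicial) auto
      then show ?thesis using two CS0 IN x by (simp add: decide_prog_def)
    next
      case new
      have ne: "later D x \<noteq> {}" using new DD by auto
      let ?A = "A(LF := (A LF)(x := 1), MM := (A MM)(x := R MN), DG := (A DG)(x := R DD))"
      have "Q R ?A f"
      proof (rule continue)
        show "node D kc stk R ?A" using nd by (rule node_cong) auto
        have "stars_of D i ?A = ?L" using x by (intro stars_of_cong) auto
        then have stars: "stars_of D (Suc i) ?A = insert x ?L" unfolding stars_of_Suc[OF x(2,3)] by simp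
        have "W.scan_inv i ?L (?A MM) (?A DG) (?A S1) (?A S2)"
          using x by (intro W.scan_inv_cong[OF si]) auto
        then have "W.scan_inv (Suc i) (insert x ?L) (?A MM) (?A DG) (?A S1) (?A S2)"
          using new MN[OF ne] DD x TTz up by (intro W.scan_inv_star) (auto simp: W.star_def)
        then show "node_inv D (Suc i) ?A" unfolding node_inv_def stars .
      qed
      then show ?thesis using new CS0 IN x by (simp add: decide_prog_def)
    next
      case plain
      have "W.inert x" using plain TTz by (auto simp: W.inert_def W.T_triangle_def up)
      then show ?thesis using plain CS0 IN x inert by (simp add: decide_prog_def)
    qed
  next
    case CS1: False
    then have SAS: "R SA \<in> ?L" "x \<in> later D (R SA)" using SA by auto
    show ?thesis
    proof (cases "R SW = 0")
      case SW0: True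
      have fst: "W.up (R SA) - {x} \<subseteq> W.up x" using W.first_star_rest[OF si SAS(1)] SWz SW0 SAS by auto
      show ?thesis
      proof (cases "R TT = 0")
        case False
        let ?t = "R TT - 1"
        have t: "?t \<in> later D x" "?t \<in> T" using TTp[OF False] by auto
        have "wp (family_prog [[Del XX], [Del SA, Del TT], [DelN SA XX]]) Q (R(TT := ?t)) A f"
        proof (rule wp_family_branch[OF _ _ _ _ br])
          show "node D kc stk (R(TT := ?t)) A" using nd by (rule node_cong) auto
          have "W.branching [{x}, {R SA, ?t}, W.up (R SA) - {x}]"
            by (rule W.branching_star_and_terminal[OF x(2) star[OF SAS(1)] _ fst]) (use SAS up t in auto)
          then show "W.branching (map (dels_set D (R(TT := ?t))) [[Del XX], [Del SA, Del TT], [DelN SA XX]])"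
            using x up by (simp add: insert_commute)
        qed (use t x later_alive L_alive SAS f in \<open>auto simp: scratch_def family_cost_def\<close>)
        then show ?thesis using CS1 SW0 False by (simp add: decide_prog_def)
      next
        case TT0: True
        show ?thesis
        proof (cases "R CS < 2")
          case True
          then have "card ?S = 1" using CS CS1 by simp
          then have only: "u = R SA" if "u \<in> ?L" "x \<in> W.up u" for u
            using single[of "R SA" u] SAS that up by simp
          have "wp (family_prog [[Del SA], [DelN SA XX]]) Q R A f"
          proof (rule wp_family_branch[OF nd _ _ _ br])
            have "W.branching [{R SA}, W.up (R SA) - {x}]"
              by (rule W.branching_single_star[OF sc x(2,3) SAS(1) _ fst]) (use SAS up in simp, rule only)
            then show "W.branching (map (dels_set D R) [[Del SA], [DelN SA XX]])" using x up by simp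
          qed (use L_alive SAS f in \<open>auto simp: scratch_def family_cost_def\<close>)
          then show ?thesis using CS1 SW0 TT0 True by (simp add: decide_prog_def)
        next
          case False
          then have SBS: "R SB \<in> ?L" "x \<in> later D (R SB)" "R SA \<noteq> R SB" using SB by auto
          let ?A = "A(S1 := (A S1)(x := R SA), S2 := (A S2)(x := R SB))"
          have "Q R ?A f"
          proof (rule continue)
            show "node D kc stk R ?A" using nd by (rule node_cong) auto
            have stars: "stars_of D (Suc i) ?A = ?L" unfolding stars_of_Suc[OF x(2,3)] using LF by (auto simp: stars_of_def)
            have "W.scan_inv i ?L (?A MM) (?A DG) (?A S1) (?A S2)"
              using x by (intro W.scan_inv_cong[OF si]) auto
            then have "W.scan_inv (Suc i) ?L (?A MM) (?A DG) (?A S1) (?A S2)"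
              using x SWz[OF SW0] TTz[OF TT0] SAS SBS unfolding up by (intro W.scan_inv_hub) auto
            then show "node_inv D (Suc i) ?A" unfolding node_inv_def stars .
          qed
          then show ?thesis using CS1 SW0 TT0 False x by (simp add: decide_prog_def)
        qed
      qed
    next
      case SW1: False
      define v where "v = R SW - 1"
      define w where "w = A MM v"
      define v2 where "v2 = (if A S1 w = v then A S2 w else A S1 w)"
      have v: "v \<in> ?L" "x \<in> W.up v" "A MM v \<noteq> x" using SWp[OF SW1] up by (auto simp: v_def)
      note lk = W.linked_star[OF si x(2,3) v w_def v2_def]
      have DG: "A DG u = card (later D u)" if "u \<in> ?L" for u using si that up by (simp add: W.scan_inv_def)
      let ?R = "R(VV := v, WW := w, V2 := v2)"
      let ?F5 = "[[Del VV, Del V2], [Del VV, DelN V2 WW], [DelN VV XX], [DelN VV WW, DelN V2 WW]]"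
      let ?F3 = "[[Del XX], [Del VV, Del V2, Del V3], [Del VV, Del V2, DelN V3 XX], [Del VV, DelN V2 WW],
               [DelN VV XX, Del V3], [DelN VV XX, DelN V3 XX]]"
      let ?c = "IF Below (Var CS) (Num 2) THEN family_prog ?F5
         ELSE ((IF same (Var SA) (Var VV) THEN V3 ::= Var SB ELSE V3 ::= Var SA) ;; pair_prog XX V3 (family_prog ?F3))"
      have wA: "w \<in> alive D" using lk(4) W.up_V by blast
      have "wp (pair_prog WW V2 ?c) Q ?R A f"
      proof (rule wp_pair_prog[where D = D and L = ?L and v = v and v' = v2 and a = w and g = "32 * n + g" and kc = kc and stk = stk and i = i])
        show "node D kc stk ?R A" using nd by (rule node_cong) auto
        show "Q R' A' f'" if "branched D kc stk R' A'" "32 * n + g \<le> f'" for R' A' f' using br that by auto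
        fix R1 A1 f1
        assume nd1: "node D kc stk R1 A1" and R1: "\<And>r. r \<notin> scratch \<or> r = BR \<Longrightarrow> R1 r = ?R r" and A1: "\<And>b. b \<noteq> SN \<Longrightarrow> A1 b = A b"
          and c3: "card (later D v) = 3" "card (later D v2) = 3" and disj: "4 \<le> card ((later D v - {w}) \<union> (later D v2 - {w}))"
          and f1: "32 * n + g \<le> f1"
        have r1: "R1 VV = v" "R1 WW = w" "R1 V2 = v2" "R1 CS = R CS" "R1 SA = R SA" "R1 SB = R SB" "R1 XX = x"
          using x by (simp_all add: R1 scratch_def)
        \<comment> \<open>A union of four from two sets of two is disjoint, so \<open>x\<close>,
          being in \<open>up v - {w}\<close>, cannot belong to \<open>up v2\<close>.\<close>
        have xv2: "x \<notin> W.up v2"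
        proof
          assume "x \<in> W.up v2"
          then have "x \<in> (W.up v - {w}) \<inter> (W.up v2 - {w})" using v lk(5) by auto
          then have "(W.up v - {w}) \<inter> (W.up v2 - {w}) \<noteq> {}" by blast
          then have "0 < card ((W.up v - {w}) \<inter> (W.up v2 - {w}))" using W.finite_up by (simp add: card_gt_0_iff)
          moreover have "card (W.up v - {w}) = 2" "card (W.up v2 - {w}) = 2" using c3 lk(3,4) W.finite_up unfolding up by auto
          ultimately show False using disj card_Un_Int[of "W.up v - {w}" "W.up v2 - {w}"] W.finite_up unfolding up by simp
        qed
        show "wp ?c Q R1 A1 f1"
        proof (cases "R CS < 2")
          case True
          then have "card ?S = 1" using CS CS1 by simp
          then have only: "u = v" if "u \<in> ?L" "x \<in> W.up u" for u
            using single[of v u] v that up by simp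
          have "wp (family_prog ?F5) Q R1 A1 f1"
          proof (rule wp_family_branch[OF nd1 _ _ _ br])
            have "W.branching [{v, v2}, {v} \<union> (W.up v2 - {w}), W.up v - {x}, (W.up v - {w}) \<union> (W.up v2 - {w})]"
            proof (rule W.branching_linked_star[OF sc x(2,3)])
              show "card (W.up v) = 3" "card (W.up v2) = 3" "4 \<le> card ((W.up v - {w}) \<union> (W.up v2 - {w}))"
                using c3 disj unfolding up by auto
              show "u = v" if "u \<in> ?L" "x \<in> W.up u" for u by (rule only[OF that])
            qed (use v lk xv2 in auto)
            then show "W.branching (map (dels_set D R1) ?F5)" using r1 up by (simp add: insert_commute)
          qed (use v lk(1) L_alive f1 r1 in \<open>auto simp: scratch_def family_cost_def\<close>)
          then show ?thesis using True r1 by simp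
        next
          case False
          then have SBS: "R SB \<in> ?L" "x \<in> later D (R SB)" "R SA \<noteq> R SB" using SB by auto
          define v3 where "v3 = (if R SA = v then R SB else R SA)"
          have v3: "v3 \<in> ?L" "x \<in> W.up v3" "v \<noteq> v3" using SAS SBS up by (auto simp: v3_def)
          let ?R2 = "R1(V3 := v3)"
          have "wp (pair_prog XX V3 (family_prog ?F3)) Q ?R2 A1 f1"
          proof (rule wp_pair_prog[where D = D and L = ?L and v = v and v' = v3 and a = x and g = "19 * n + g" and kc = kc and stk = stk and i = i])
            show "node D kc stk ?R2 A1" using nd1 by (rule node_cong) auto
            show "Q R' A' f'" if "branched D kc stk R' A'" "19 * n + g \<le> f'" for R' A' f' using br that by auto
            fix R3 A3 f3
            assume nd3: "node D kc stk R3 A3" and R3: "\<And>r. r \<notin> scratch \<or> r = BR \<Longrightarrow> R3 r = ?R2 r"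
              and disj3: "4 \<le> card ((later D v - {x}) \<union> (later D v3 - {x}))" and f3: "19 * n + g \<le> f3"
            have r3: "R3 VV = v" "R3 WW = w" "R3 V2 = v2" "R3 V3 = v3" "R3 XX = x" using r1 by (simp_all add: R3 scratch_def)
            show "wp (family_prog ?F3) Q R3 A3 f3"
            proof (rule wp_family_branch[OF nd3 _ _ _ br])
              have "W.branching [{x}, {v, v2, v3}, {v, v2} \<union> (W.up v3 - {x}), {v} \<union> (W.up v2 - {w}),
                 (W.up v - {x}) \<union> {v3}, (W.up v - {x}) \<union> (W.up v3 - {x})]"
                by (rule W.branching_linked_stars[OF sc]) (use v lk xv2 v3 c3 disj3 up in auto)
              then show "W.branching (map (dels_set D R3) ?F3)" using r3 up by (simp add: insert_commute)
            qed (use v v3 lk(1) L_alive f3 r3 x in \<open>auto simp: scratch_def family_cost_def\<close>)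
          qed (use sc v v3 r1 DG A1 f1 up in \<open>auto simp: scratch_def\<close>)
          then show ?thesis using False r1 by (simp add: v3_def split: if_splits)
        qed
      qed (use sc v lk(1-4) DG f up in \<open>auto simp: scratch_def\<close>)
      then show ?thesis using CS1 SW1 by (simp add: decide_prog_def v_def w_def v2_def split: if_splits)
    qed
  qed
qed

end

section \<open>The search\<close>

definition pass_prog :: prog where
  "pass_prog = (BR ::= Num 0 ;; II ::= Num 1 ;;
     (WHILE Both (Below (Var II) (Plus (Var NN) (Num 1))) (Below (Var BR) (Num 1)) DO
       (XX ::= Elt OD (Var II) ;;
        (IF Below (Elt DE (Var XX)) (Num 1) THEN (gather ;; decide_prog) ELSE Nop) ;;
        II ::= Plus (Var II) (Num 1))))"

definition expand_prog :: prog where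
  "expand_prog = (SP ::= Minus (Var SP) (Plus (Var NN) (Num 1)) ;; KC ::= Elt SN (Plus (Var SP) (Var NN)) ;; QQ ::= Num 0 ;;
     count_loop QQ (Var NN) (DE\<langle>Var QQ\<rangle> ::= Elt SN (Plus (Var SP) (Var QQ))) ;;
     pass_prog ;; (IF Below (Var BR) (Num 1) THEN RES ::= Num 1 ELSE Nop))"

definition search_prog :: prog where
  "search_prog = (RES ::= Num 0 ;; SN\<langle>Var NN\<rangle> ::= Var KK ;; SP ::= Plus (Var NN) (Num 1) ;;
     (WHILE Both (Below (Num 0) (Var SP)) (Below (Var RES) (Num 1)) DO expand_prog))"

lemma gather_writes:
  "reg_writes gather = {DD, TT, MN, CS, SW, SA, SB, PP, EE, UU}" "arr_writes gather = {LF}"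
  by (auto simp: gather_def)

lemma reg_writes_pass_prog: "r \<in> {RES, NN, KK, KC} \<Longrightarrow> r \<notin> reg_writes pass_prog"
  using reg_writes_decide_prog by (auto simp: pass_prog_def gather_writes scratch_def)

lemma arr_writes_pass_prog: "a \<in> {IN, ST, PO, OD, DE} \<Longrightarrow> a \<notin> arr_writes pass_prog"
  using arr_writes_decide_prog by (auto simp: pass_prog_def gather_writes)

context ordered_graph
begin

definition rest_cost :: "nat \<Rightarrow> nat" where
  "rest_cost i = (\<Sum>j\<in>{i..n}. Suc (length (nbr ! od j)))"

lemma rest_cost_Suc: "i \<le> n \<Longrightarrow> rest_cost i = Suc (length (nbr ! od i)) + rest_cost (Suc i)"
  unfolding rest_cost_def by (simp add: sum.atLeast_Suc_atMost)

lemma rest_cost_1: "rest_cost 1 = n + (\<Sum>v<n. length (nbr ! v))"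
proof -
  have inj: "inj_on od {1..n}" using od by (intro inj_on_inverseI[of _ pos]) auto
  have "od ` {1..n} = {..<n}"
  proof (rule card_subset_eq)
    show "card (od ` {1..n}) = card {..<n}" using inj by (simp add: card_image)
  qed (use od in auto)
  then have "(\<Sum>j\<in>{1..n}. length (nbr ! od j)) = (\<Sum>v<n. length (nbr ! v))"
    using sum.reindex[OF inj, of "\<lambda>v. length (nbr ! v)"] by simp
  moreover have "rest_cost 1 = (\<Sum>j\<in>{1..n}. length (nbr ! od j)) + n"
    unfolding rest_cost_def Suc_eq_plus1 sum.distrib by simp
  ultimately show ?thesis by simp
qed

text \<open>The \<open>45 * n\<close> credits for branching are spent at most once, because
  branching ends the pass. The other \<open>n\<close> and the degree sum pay for visiting each
  vertex and gathering its neighbours.\<close>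

lemma wp_pass_prog:
  assumes nd: "node D kc stk R A" and f: "46 * n + (\<Sum>v<n. length (nbr ! v)) + g \<le> f"
    and post: "\<And>R' A' f'. \<lbrakk>branched D kc stk R' A' \<or> R' BR = 0 \<and> node D kc stk R' A' \<and>
        elimination_order.hits (alive D) (adjacent E) pos T {}; g \<le> f'; same_off pass_prog R A R' A'\<rbrakk> \<Longrightarrow> Q R' A' f'"
  shows "wp pass_prog Q R A f"
proof -
  interpret W: elimination_order "alive D" "adjacent E" pos T by (rule elimination_order_alive)
  let ?step = "IF Below (Elt DE (Var XX)) (Num 1) THEN (gather ;; decide_prog) ELSE Nop"
  let ?body = "XX ::= Elt OD (Var II) ;; ?step ;; II ::= Plus (Var II) (Num 1)"
  let ?b = "Both (Below (Var II) (Plus (Var NN) (Num 1))) (Below (Var BR) (Num 1))"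
  let ?R = "R(BR := 0, II := 1)"
  define I where "I R' A' f' \<longleftrightarrow> 1 \<le> R' II \<and> R' II \<le> Suc n \<and> R' NN = n \<and>
     (R' BR = 0 \<and> node D kc stk R' A' \<and> node_inv D (R' II) A' \<and> rest_cost (R' II) + (45 * n + g) \<le> f' \<or> branched D kc stk R' A' \<and> g \<le> f')"
    for R' A' f'
  have "wp (WHILE ?b DO ?body) (\<lambda>R' A' f'. same_off pass_prog R A R' A' \<longrightarrow> Q R' A' f') ?R A f"
  proof (rule wp_Loop[where I = I])
    have "W.scan_inv 1 {} (A MM) (A DG) (A S1) (A S2)"
      using pos_range by (intro W.scan_inv_first_one) (auto simp: alive_def Suc_le_eq)
    moreover have "stars_of D 1 A = {}" using pos_range by (auto simp: stars_of_def alive_def)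
    ultimately have "node_inv D 1 A" by (simp add: node_inv_def)
    moreover have "node D kc stk ?R A" using nd by (rule node_cong) auto
    moreover have "R NN = n" using nd by (simp add: node_def)
    ultimately show "I ?R A f" using f rest_cost_1 by (auto simp: I_def)
  next
    fix R1 A1 f1 assume I1: "I R1 A1 f1" and b: "holds ?b R1 A1"
    let ?i = "R1 II" and ?x = "od (R1 II)"
    have BR: "R1 BR = 0" using b by simp
    then have nb: "\<not> branched D kc stk R1 A1" by (simp add: branched_def)
    have nd1: "node D kc stk R1 A1" and inv1: "node_inv D ?i A1" and f1: "rest_cost ?i + (45 * n + g) \<le> f1"
      and i: "1 \<le> ?i" "R1 NN = n" using I1 nb by (auto simp: I_def)
    have i': "?i \<le> n" using b i by simp
    have x: "?x < n" "pos ?x = ?i" using od[of ?i] i i' by auto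
    obtain f2 where f2: "f1 = Suc f2" "length (nbr ! ?x) + (rest_cost (Suc ?i) + (45 * n + g)) \<le> f2"
      using f1 rest_cost_Suc[OF i'] by (cases f1) auto
    let ?R2 = "R1(XX := ?x)"
    have nd2: "node D kc stk ?R2 A1" using nd1 by (rule node_cong) auto
    have rd: "ready D A1" "A1 OD = od" using nd1 by (auto simp: node_def ready_def)
    let ?J = "\<lambda>R' A' f'. I (R'(II := Suc ?i)) A' f'"
    have "wp ?step ?J ?R2 A1 f2"
    proof (cases "?x \<in> D")
      case True
      have gap: "pos v \<noteq> ?i" if "v \<in> alive D" for v
        using inj_onD[OF whole.inj_pos, of v ?x] that x True by (auto simp: alive_def)
      have "W.scan_inv (Suc ?i) (stars_of D ?i A1) (A1 MM) (A1 DG) (A1 S1) (A1 S2)"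
        by (rule W.scan_inv_gap) (use inv1 gap in \<open>auto simp: node_inv_def\<close>)
      moreover have "stars_of D (Suc ?i) A1 = stars_of D ?i A1" using gap by (auto simp: stars_of_def less_Suc_eq)
      ultimately have "node_inv D (Suc ?i) A1" by (simp add: node_inv_def)
      moreover have "node D kc stk (?R2(II := Suc ?i)) A1" using nd2 by (rule node_cong) auto
      ultimately have "?J ?R2 A1 f2" using i i' BR f2 by (auto simp: I_def)
      moreover have "A1 DE ?x \<noteq> 0" using rd x True by (simp add: ready_def)
      ultimately show ?thesis by simp
    next
      case False
      then have xa: "?x \<in> alive D" using x by (simp add: alive_def)
      have "wp gather (wp decide_prog ?J) ?R2 A1 f2"
      proof (rule wp_gather[OF rd(1), where x = ?x and g = "rest_cost (Suc ?i) + (45 * n + g)"])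
        fix R3 A3 f3
        assume gat: "gathered (later D ?x) {v \<in> alive D. ?x \<in> later D v \<and> A1 LF v \<noteq> 0} ?x R3 A3"
          and LF: "A3 LF = (A1 LF)(?x := 0)" and f3: "rest_cost (Suc ?i) + (45 * n + g) \<le> f3" and so: "same_off gather ?R2 A1 R3 A3"
        have A3: "A3 a = A1 a" if "a \<noteq> LF" for a using so that by (simp add: same_off_def gather_writes)
        have R3: "R3 XX = ?x" "R3 BR = 0" "R3 NN = n" "R3 KC = R1 KC" "R3 SP = R1 SP" "R3 II = ?i"
          using so BR i by (simp_all add: same_off_def gather_writes)
        have nd3: "node D kc stk R3 A3" using nd2 by (rule node_cong) (use R3 A3 i in auto)
        have stars: "stars_of D ?i A3 = stars_of D ?i A1" using LF x by (intro stars_of_cong) auto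
        have inv3: "node_inv D ?i A3" using inv1 stars A3 by (simp add: node_inv_def)
        have S: "{v \<in> alive D. ?x \<in> later D v \<and> A1 LF v \<noteq> 0} = {v \<in> stars_of D ?i A3. ?x \<in> later D v}"
          unfolding stars using x by (auto simp: stars_of_def later_iff)
        show "wp decide_prog ?J R3 A3 f3"
        proof (rule wp_frame, rule wp_decide_prog[OF nd3 R3(1) xa x(2) R3(2) inv3, where g = g])
          show "gathered (later D ?x) {v \<in> stars_of D ?i A3. ?x \<in> later D v} ?x R3 A3" using gat S by simp
          show "45 * n + g \<le> f3" using f3 by simp
          show "A3 LF ?x = 0" using LF by simp
          have "NN \<notin> reg_writes decide_prog" using reg_writes_decide_prog by (auto simp: scratch_def)
          then have N: "R4 NN = n" if "same_off decide_prog R3 A3 R4 A4" for R4 A4 using that R3 by (simp add: same_off_def)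
          show "same_off decide_prog R3 A3 R4 A4 \<longrightarrow> ?J R4 A4 f4" if "branched D kc stk R4 A4" "g \<le> f4" for R4 A4 f4
          proof
            assume "same_off decide_prog R3 A3 R4 A4"
            moreover have "branched D kc stk (R4(II := Suc ?i)) A4" using that(1) by (simp add: branched_def)
            ultimately show "?J R4 A4 f4" using N i' that(2) by (simp add: I_def)
          qed
          show "same_off decide_prog R3 A3 R4 A4 \<longrightarrow> ?J R4 A4 f3"
            if o: "R4 BR = 0" "node D kc stk R4 A4" "node_inv D (Suc ?i) A4" for R4 A4
          proof
            assume "same_off decide_prog R3 A3 R4 A4"
            moreover have "node D kc stk (R4(II := Suc ?i)) A4" using o(2) by (rule node_cong) auto
            ultimately show "?J R4 A4 f3" using N i' f3 o by (simp add: I_def)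
          qed
        qed
      qed (use xa f2 in auto)
      moreover have "A1 DE ?x = 0" using rd x False by (simp add: ready_def)
      ultimately show ?thesis by simp
    qed
    then have "wp ?body I R1 A1 f2"
      unfolding wp_Then wp_Set_Reg ev.simps rd(2)
    proof (rule wp_conseq)
      fix R' A' f' assume J: "I (R'(II := Suc ?i)) A' f'" and so: "same_off ?step ?R2 A1 R' A'"
      have "R' II = ?i" using so reg_writes_decide_prog by (auto simp: same_off_def gather_writes scratch_def)
      then show "I (R'(II := R' II + 1)) A' f'" using J by simp
    qed
    then show "\<exists>g. f1 = Suc g \<and> wp ?body I R1 A1 g" using f2 by blast
  next
    fix R1 A1 f1 assume I1: "I R1 A1 f1" and b: "\<not> holds ?b R1 A1"
    have "branched D kc stk R1 A1 \<or> R1 BR = 0 \<and> node D kc stk R1 A1 \<and> W.hits {}" "g \<le> f1"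
    proof -
      have "W.hits {}" if "R1 BR = 0" "node_inv D (R1 II) A1"
      proof (rule W.scan_inv_final)
        show "W.scan_inv (R1 II) (stars_of D (R1 II) A1) (A1 MM) (A1 DG) (A1 S1) (A1 S2)" using that by (simp add: node_inv_def)
        show "pos v < R1 II" if "v \<in> alive D" for v
          using pos_range[of v] that b \<open>R1 BR = 0\<close> I1 by (auto simp: alive_def I_def)
      qed
      then show "branched D kc stk R1 A1 \<or> R1 BR = 0 \<and> node D kc stk R1 A1 \<and> W.hits {}" "g \<le> f1"
        using I1 by (auto simp: I_def)
    qed
    then show "same_off pass_prog R A R1 A1 \<longrightarrow> Q R1 A1 f1" using post by blast
  qed
  then have "wp (WHILE ?b DO ?body) Q ?R A f"
  proof (rule wp_conseq)
    fix R' A' f' assume "same_off pass_prog R A R' A' \<longrightarrow> Q R' A' f'" and so: "same_off (WHILE ?b DO ?body) ?R A R' A'"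
    then show "Q R' A' f'" by (auto simp: same_off_def pass_prog_def)
  qed
  then show ?thesis by (simp add: pass_prog_def)
qed

lemma stack_pop:
  assumes "stack A sp (stk @ [(D, kc)])"
  shows "stack A (sp - (n + 1)) stk" "sp = sp - (n + 1) + (n + 1)" "A SN (sp - (n + 1) + n) = kc"
    "\<And>v. v < n \<Longrightarrow> A SN (sp - (n + 1) + v) \<noteq> 0 \<longleftrightarrow> v \<in> D"
proof -
  have sp: "sp = length stk * (n + 1) + (n + 1)" using assms by (simp add: stack_def)
  have e: "A SN (e * (n + 1) + n) = snd ((stk @ [(D, kc)]) ! e)"
    "\<And>v. v < n \<Longrightarrow> A SN (e * (n + 1) + v) \<noteq> 0 \<longleftrightarrow> v \<in> fst ((stk @ [(D, kc)]) ! e)" if "e < Suc (length stk)" for e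
    using assms that by (auto simp: stack_def)
  show "stack A (sp - (n + 1)) stk" unfolding stack_def
  proof (intro conjI allI impI)
    show "sp - (n + 1) = length stk * (n + 1)" using sp by simp
    show "A SN (i * (n + 1) + n) = snd (stk ! i)" if "i < length stk" for i using e(1)[of i] that by (simp add: nth_append)
    show "A SN (i * (n + 1) + v) \<noteq> 0 \<longleftrightarrow> v \<in> fst (stk ! i)" if "i < length stk" "v < n" for i v
      using e(2)[of i v] that by (simp add: nth_append)
  qed
  show "sp = sp - (n + 1) + (n + 1)" using sp by simp
  show "A SN (sp - (n + 1) + n) = kc" "\<And>v. v < n \<Longrightarrow> A SN (sp - (n + 1) + v) \<noteq> 0 \<longleftrightarrow> v \<in> D"
    using e[of "length stk"] sp by auto
qed

definition solvable_at :: "nat set \<times> nat \<Rightarrow> bool" where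
  "solvable_at p = elimination_order.solvable (alive (fst p)) (adjacent E) pos T (snd p)"

definition potential :: "(nat set \<times> nat) list \<Rightarrow> nat" where
  "potential stk = sum_list (map (\<lambda>p. 2 * 2 ^ snd p - 1) stk)"

lemma branching_children:
  assumes "elimination_order.branching (alive D) (adjacent E) pos T F"
  shows "solvable_at (D, kc) \<longleftrightarrow> (\<exists>p\<in>set (children D kc F). solvable_at p)"
    "Suc (potential (children D kc F)) \<le> 2 * 2 ^ kc - 1"
proof -
  interpret W: elimination_order "alive D" "adjacent E" pos T by (rule elimination_order_alive)
  have "alive (D \<union> X) = alive D - X" for X by (auto simp: alive_def)
  then show "solvable_at (D, kc) \<longleftrightarrow> (\<exists>p\<in>set (children D kc F). solvable_at p)"
    using W.solvable_branching[OF assms, of kc] by (auto simp: solvable_at_def children_def)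
  have "potential (children D kc F) = sum_list (map (\<lambda>X. if card X \<le> kc then 2 * 2 ^ (kc - card X) - 1 else 0) F)"
    by (induction F) (auto simp: potential_def children_def)
  then show "Suc (potential (children D kc F)) \<le> 2 * 2 ^ kc - 1" using W.light_potential[OF assms, of kc] by simp
qed

text \<open>\<open>46 * n\<close> and the degree sum for the pass, \<open>n\<close> for copying the
  deletion flags, and one for the iteration of the search loop.\<close>

definition node_cost :: nat where
  "node_cost = Suc (47 * n + (\<Sum>v<n. length (nbr ! v)))"

definition search_inv :: "nat \<Rightarrow> (reg \<Rightarrow> nat) \<Rightarrow> (arr \<Rightarrow> nat \<Rightarrow> nat) \<Rightarrow> nat \<Rightarrow> bool" where
  "search_inv g R A f \<longleftrightarrow> R NN = n \<and> loaded A \<and> A PO = pos \<and> A OD = od \<and>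
     (R RES = 0 \<and> (\<exists>stk. stack A (R SP) stk \<and> (whole.solvable k \<longleftrightarrow> (\<exists>p\<in>set stk. solvable_at p)) \<and>
        potential stk * node_cost + g \<le> f) \<or>
      R RES \<noteq> 0 \<and> whole.solvable k \<and> g \<le> f)"

text \<open>Replacing a node by its children lowers the potential by at least one, which releases
  the \<open>node_cost\<close> credits spent on expanding it.\<close>

lemma wp_expand_prog:
  assumes inv: "search_inv g R A f" and run: "0 < R SP" "R RES = 0"
  shows "\<exists>f'. f = Suc f' \<and> wp expand_prog (search_inv g) R A f'"
proof -
  obtain stk' where st': "stack A (R SP) stk'" and eq': "whole.solvable k \<longleftrightarrow> (\<exists>p\<in>set stk'. solvable_at p)"
    and f': "potential stk' * node_cost + g \<le> f" and N: "R NN = n" and ld: "loaded A" "A PO = pos" "A OD = od"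
    using inv run by (auto simp: search_inv_def)
  have "stk' \<noteq> []" using st' run by (auto simp: stack_def)
  then obtain stk D kc where stk': "stk' = stk @ [(D, kc)]" by (metis rev_exhaust surj_pair)
  note pop = stack_pop[OF st'[unfolded stk']]
  have pot: "potential stk' = potential stk + (2 * 2 ^ kc - 1)" by (simp add: stk' potential_def)
  have one: "(1::nat) \<le> 2 ^ kc" by simp
  have "node_cost * (potential stk + 1) \<le> node_cost * potential stk'" using pot one by (intro mult_left_mono) linarith+
  then obtain f2 where f2: "f = Suc f2" using f' by (cases f) (auto simp: node_cost_def algebra_simps)
  have pot_cost: "potential stk' * node_cost = (potential stk + (2 * 2 ^ kc - 2)) * node_cost + node_cost"
  proof -
    have "potential stk' = Suc (potential stk + (2 * 2 ^ kc - 2))" using pot one by linarith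
    then show ?thesis by simp
  qed
  let ?sp = "R SP - (n + 1)"
  let ?R = "R(SP := ?sp, KC := kc, QQ := 0)"
  let ?c = "DE\<langle>Var QQ\<rangle> ::= Elt SN (Plus (Var SP) (Var QQ))"
  let ?fin = "IF Below (Var BR) (Num 1) THEN RES ::= Num 1 ELSE Nop"
  have "wp (count_loop QQ (Var NN) ?c) (wp pass_prog (wp ?fin (search_inv g))) ?R A f2"
  proof (rule wp_count_loop[where m = 0 and N = n and I = "\<lambda>i R' A' f'. (\<forall>v<i. A' DE v = A SN (?sp + v)) \<and> f2 \<le> f' + i"])
    show "(\<forall>v<0. A DE v = A SN (?sp + v)) \<and> f2 \<le> f2 + 0" by simp
  next
    fix i R' A' f' assume I: "(\<forall>v<i. A' DE v = A SN (?sp + v)) \<and> f2 \<le> f' + i" and i: "i < n"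
    have "n \<le> f2" using f' f2 pot_cost by (simp add: node_cost_def)
    then show "0 < f'" using I i by simp
  next
    fix i R' A' g' assume i: "i < n" "R' QQ = i" and I: "(\<forall>v<i. A' DE v = A SN (?sp + v)) \<and> f2 \<le> Suc g' + i"
      and so: "same_off (count_loop QQ (Var NN) ?c) ?R A R' A'"
    have "A' SN = A SN" "R' SP = ?sp" using so by (simp_all add: same_off_def)
    then show "wp ?c (\<lambda>R'' A'' f''. (\<forall>v<Suc i. A'' DE v = A SN (?sp + v)) \<and> f2 \<le> f'' + Suc i) R' A' g'"
      using I i by (auto simp: less_Suc_eq)
  next
    fix R1 A1 f1 assume I: "(\<forall>v<n. A1 DE v = A SN (?sp + v)) \<and> f2 \<le> f1 + n" and so: "same_off (count_loop QQ (Var NN) ?c) ?R A R1 A1"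
    have A1: "A1 a = A a" if "a \<noteq> DE" for a using so that by (simp add: same_off_def)
    have R1: "R1 NN = n" "R1 SP = ?sp" "R1 KC = kc" "R1 RES = 0" using so N run by (simp_all add: same_off_def)
    have "A1 DE v = 0 \<longleftrightarrow> v \<notin> D" if "v < n" for v using I pop(4)[OF that] that by auto
    then have "ready D A1" using ld A1 loaded_cong[OF ld(1), of A1] by (simp add: ready_def)
    moreover have "stack A1 ?sp stk" by (rule stack_cong[OF pop(1)]) (simp add: A1)
    ultimately have nd: "node D kc stk R1 A1" using R1 by (simp add: node_def)
    interpret W: elimination_order "alive D" "adjacent E" pos T by (rule elimination_order_alive)
    show "wp pass_prog (wp ?fin (search_inv g)) R1 A1 f1"
    proof (rule wp_pass_prog[OF nd, where g = "potential stk * node_cost + (2 * 2 ^ kc - 2) * node_cost + g"])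
      show "46 * n + (\<Sum>v<n. length (nbr ! v)) + (potential stk * node_cost + (2 * 2 ^ kc - 2) * node_cost + g) \<le> f1"
        using f' f2 I pot_cost unfolding add_mult_distrib by (simp add: node_cost_def)
      fix R2 A2 f3
      assume out: "branched D kc stk R2 A2 \<or> R2 BR = 0 \<and> node D kc stk R2 A2 \<and> W.hits {}"
        and f3: "potential stk * node_cost + (2 * 2 ^ kc - 2) * node_cost + g \<le> f3" and so2: "same_off pass_prog R1 A1 R2 A2"
      have R2: "R2 NN = n" "R2 RES = 0" using so2 reg_writes_pass_prog R1 by (auto simp: same_off_def)
      have A2: "A2 IN = A IN" "A2 ST = A ST" "A2 PO = pos" "A2 OD = od"
        using so2 arr_writes_pass_prog A1 ld by (auto simp: same_off_def)
      have ld2: "loaded A2" using loaded_cong[OF ld(1)] A2 by simp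
      show "wp ?fin (search_inv g) R2 A2 f3"
      proof (cases "branched D kc stk R2 A2")
        case True
        then obtain F where BR: "R2 BR = 1" and F: "W.branching F" "stack A2 (R2 SP) (stk @ children D kc F)" by (auto simp: branched_def)
        note ch = branching_children[OF F(1), of kc]
        have "potential (stk @ children D kc F) = potential stk + potential (children D kc F)" by (simp add: potential_def)
        moreover have "potential (children D kc F) \<le> 2 * 2 ^ kc - 2" using ch(2) by linarith
        ultimately have "potential (stk @ children D kc F) \<le> potential stk + (2 * 2 ^ kc - 2)" by linarith
        then have "potential (stk @ children D kc F) * node_cost \<le> (potential stk + (2 * 2 ^ kc - 2)) * node_cost"
          by (rule mult_right_mono) simp
        then have "potential (stk @ children D kc F) * node_cost + g \<le> f3"
          using f3 unfolding add_mult_distrib by linarith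
        moreover have "whole.solvable k \<longleftrightarrow> (\<exists>p\<in>set (stk @ children D kc F). solvable_at p)" using eq' ch(1) stk' by auto
        ultimately have "search_inv g R2 A2 f3" using R2 A2 ld2 F(2) unfolding search_inv_def by blast
        then show ?thesis using BR by simp
      next
        case False
        \<comment> \<open>A pass without branching certifies that no T-triangle is left, so the
          empty set solves the node whatever its budget, and the search may stop.\<close>
        then have o: "R2 BR = 0" "W.hits {}" using out by auto
        then have "W.solvable kc" unfolding W.solvable_def by (intro exI[of _ "{}"]) auto
        then have "whole.solvable k" using eq' stk' by (auto simp: solvable_at_def)
        then have "search_inv g (R2(RES := 1)) A2 f3" using R2 A2 ld2 f3 by (simp add: search_inv_def)
        then show ?thesis using o by simp
      qed
    qed
  qed (use N in \<open>auto simp: same_off_def\<close>)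
  then have "wp expand_prog (search_inv g) R A f2" using N pop(3) by (simp add: expand_prog_def wp_Then_fun)
  then show ?thesis using f2 by blast
qed

lemma wp_search_prog:
  assumes ld: "loaded A" "A PO = pos" "A OD = od" and R: "R NN = n" "R KK = k" and SN: "\<And>v. v < n \<Longrightarrow> A SN v = 0"
    and f: "(2 * 2 ^ k - 1) * node_cost \<le> f" and post: "\<And>R' A' f'. (R' RES \<noteq> 0 \<longleftrightarrow> whole.solvable k) \<Longrightarrow> Q R' A' f'"
  shows "wp search_prog Q R A f"
proof -
  let ?A = "A(SN := (A SN)(n := k))" and ?R = "R(RES := 0, SP := n + 1)"
  have "wp (WHILE Both (Below (Num 0) (Var SP)) (Below (Var RES) (Num 1)) DO expand_prog) Q ?R ?A f"
  proof (rule wp_Loop[where I = "search_inv 0"])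
    have "stack ?A (n + 1) [({}, k)]" using SN by (auto simp: stack_def)
    moreover have "whole.solvable k \<longleftrightarrow> (\<exists>p\<in>set [({}, k)]. solvable_at p)" by (simp add: solvable_at_def alive_def)
    moreover have "potential [({}, k)] * node_cost + 0 \<le> f" using f by (simp add: potential_def)
    moreover have "loaded ?A" using loaded_cong[OF ld(1), of ?A] by simp
    ultimately show "search_inv 0 ?R ?A f" unfolding search_inv_def using ld R by (auto intro!: exI[of _ "[({}, k)]"])
  next
    fix R' A' f' assume "search_inv 0 R' A' f'" "holds (Both (Below (Num 0) (Var SP)) (Below (Var RES) (Num 1))) R' A'"
    then show "\<exists>g. f' = Suc g \<and> wp expand_prog (search_inv 0) R' A' g" by (intro wp_expand_prog) auto
  next
    fix R' A' f' assume inv: "search_inv 0 R' A' f'" and b: "\<not> holds (Both (Below (Num 0) (Var SP)) (Below (Var RES) (Num 1))) R' A'"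
    have "R' RES \<noteq> 0 \<longleftrightarrow> whole.solvable k"
    proof (cases "R' RES = 0")
      case True
      then obtain stk where stk: "stack A' (R' SP) stk" "whole.solvable k \<longleftrightarrow> (\<exists>p\<in>set stk. solvable_at p)"
        using inv by (auto simp: search_inv_def)
      have "R' SP = 0" using b True by simp
      then have "stk = []" using stk(1) by (simp add: stack_def)
      then show ?thesis using stk True by simp
    next
      case False
      then show ?thesis using inv by (simp add: search_inv_def)
    qed
    then show "Q R' A' f'" by (rule post)
  qed
  then show ?thesis using R by (simp add: search_prog_def)
qed

end

section \<open>The complete program\<close>

definition main_prog :: prog where
  "main_prog = (load_prog ;; mcs_prog ;; search_prog)"

context input_graph
begin

definition degree_sum :: nat where
  "degree_sum = (\<Sum>v<n. length (nbr ! v))"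

lemma finite_E: "finite E"
proof (rule finite_subset)
  show "E \<subseteq> Pow {0..<n}" using simple by (auto simp: simple_graph_def)
qed simp

text \<open>An adjacency entry is determined by its edge and its orientation.\<close>

lemma degree_sum_le: "degree_sum \<le> 2 * card E"
proof -
  let ?P = "SIGMA v:{..<n}. set (nbr ! v)"
  let ?h = "\<lambda>(v, u). ({v, u}, v < u)"
  have "degree_sum = card ?P"
    unfolding degree_sum_def using distinct_nbr by (simp add: distinct_card)
  also have "\<dots> = card (?h ` ?P)"
  proof -
    have "inj_on ?h ?P" by (auto simp: inj_on_def doubleton_eq_iff)
    then show ?thesis by (simp add: card_image)
  qed
  also have "\<dots> \<le> card (E \<times> (UNIV :: bool set))"
  proof (rule card_mono)
    show "finite (E \<times> (UNIV :: bool set))" using finite_E by simp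
    show "?h ` ?P \<subseteq> E \<times> UNIV" using set_nbr by (auto simp: adjacent_def)
  qed
  also have "\<dots> = 2 * card E" by (simp add: card_cartesian_product)
  finally show ?thesis .
qed

definition credits :: nat where
  "credits = n + (4 * n + 2 * degree_sum + (2 * 2 ^ k - 1) * Suc (47 * n + degree_sum))"

lemma wp_main_prog:
  "wp main_prog (\<lambda>R A f. R RES \<noteq> 0 \<longleftrightarrow> subset_FVS {0..<n} E T k) (\<lambda>r. 0)
     (\<lambda>a i. if a = IN then input_array i else 0) credits"
proof -
  let ?A = "\<lambda>a i. if a = IN then input_array i else 0" and ?R = "\<lambda>r :: reg. 0 :: nat"
  let ?Q = "\<lambda>R A f. R RES \<noteq> 0 \<longleftrightarrow> subset_FVS {0..<n} E T k"
  have "wp load_prog (wp mcs_prog (wp search_prog ?Q)) ?R ?A credits"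
  proof (rule wp_load_prog[OF _ credits_def])
    fix R1 A1 assume ld: "loaded A1" and R1: "R1 NN = n" "R1 KK = k" and so: "same_off load_prog ?R ?A R1 A1"
    have A1: "A1 a = (\<lambda>i. 0)" if "a \<notin> {IN, ST}" for a using so that by (auto simp: same_off_def load_prog_def)
    have FP: "R1 FP = 0" using so by (simp add: same_off_def load_prog_def)
    show "wp mcs_prog (wp search_prog ?Q) R1 A1 (4 * n + 2 * degree_sum + (2 * 2 ^ k - 1) * Suc (47 * n + degree_sum))"
    proof (rule wp_mcs_prog[OF ld R1(1) FP, where g = "(2 * 2 ^ k - 1) * Suc (47 * n + degree_sum)"])
      fix R2 A2 f2
      assume so2: "search_order {0..<n} E (A2 PO)" and po: "\<And>v. v < n \<Longrightarrow> 0 < A2 PO v \<and> A2 PO v \<le> n"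
        and od: "\<And>i. 0 < i \<Longrightarrow> i \<le> n \<Longrightarrow> A2 OD i < n \<and> A2 PO (A2 OD i) = i"
        and f2: "(2 * 2 ^ k - 1) * Suc (47 * n + degree_sum) \<le> f2" and same: "same_off mcs_prog R1 A1 R2 A2"
      interpret O: ordered_graph n k E T nbr "A2 PO" "A2 OD"
        by unfold_locales (use so2 po od in auto)
      have A2: "A2 IN = A1 IN" "A2 ST = A1 ST" "A2 SN = A1 SN"
        using same by (auto simp: same_off_def mcs_prog_def mcs_body_def visit_nbrs_def push_def)
      have R2: "R2 NN = n" "R2 KK = k"
        using same R1 by (auto simp: same_off_def mcs_prog_def mcs_body_def visit_nbrs_def push_def)
      show "wp search_prog ?Q R2 A2 f2"
      proof (rule O.wp_search_prog)
        show "loaded A2" using loaded_cong[OF ld] A2 by simp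
        show "A2 SN v = 0" for v using A2 A1[of SN] by simp
        show "(2 * 2 ^ k - 1) * O.node_cost \<le> f2" using f2 by (simp add: O.node_cost_def degree_sum_def)
        fix R' :: "reg \<Rightarrow> nat" assume "R' RES \<noteq> 0 \<longleftrightarrow> O.whole.solvable k"
        then show "R' RES \<noteq> 0 \<longleftrightarrow> subset_FVS {0..<n} E T k"
          using O.whole.subset_FVS_iff_solvable[OF refl simple] by simp
      qed (use R2 in auto)
    qed (use A1 in \<open>auto simp: degree_sum_def\<close>)
  qed auto
  then show ?thesis by (simp add: main_prog_def wp_Then_fun)
qed

end

section \<open>Moving the input into the interleaved arrays\<close>

definition copy_loop :: com where
  "copy_loop = While (Less (Reg 3) (Reg 1)) (Seq (Store (address IN (Reg 3)) (Mem (Reg 3))) (Assign 3 (Add (Reg 3) (Const 1))))"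

definition copy_step :: nat where
  "copy_step = 20 + acost (address IN (Reg 3))"

text \<open>All targets lie at or above \<open>B\<close> and all sources below it, so no cell is
  overwritten before it is read.\<close>

lemma copy_loop_correct:
  assumes "fst s 1 = B" "fst s 3 = i" "i \<le> B"
  shows "\<exists>t s'. exec copy_loop s t s' \<and> t \<le> copy_step * Suc (B - i) \<and> fst s' = (fst s)(3 := B) \<and>
     (\<forall>j. i \<le> j \<and> j < B \<longrightarrow> snd s' (B + (arr_index IN + 16 * j)) = snd s j) \<and>
     (\<forall>a. (\<forall>j. i \<le> j \<and> j < B \<longrightarrow> a \<noteq> B + (arr_index IN + 16 * j)) \<longrightarrow> snd s' a = snd s a)"
  using assms
proof (induction "B - i" arbitrary: i s)
  case 0
  then have "i = B" by simp
  then have "\<not> bval (Less (Reg 3) (Reg 1)) s" using 0 by simp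
  from exec.WhileFalse[OF this] have "exec copy_loop s 4 s" unfolding copy_loop_def by (simp add: numeral_eq_Suc)
  moreover have "fst s = (fst s)(3 := B)" using 0 \<open>i = B\<close> by auto
  ultimately show ?case using \<open>i = B\<close> by (intro exI[of _ 4] exI[of _ s]) (auto simp: copy_step_def)
next
  case (Suc d)
  let ?ad = "B + (arr_index IN + 16 * i)"
  let ?body = "Seq (Store (address IN (Reg 3)) (Mem (Reg 3))) (Assign 3 (Add (Reg 3) (Const 1)))"
  let ?s1 = "(fst s, (snd s)(?ad := snd s i))" and ?s2 = "((fst s)(3 := Suc i), (snd s)(?ad := snd s i))"
  have lt: "i < B" using Suc by simp
  have "exec (Store (address IN (Reg 3)) (Mem (Reg 3))) s (3 + acost (address IN (Reg 3))) ?s1"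
    using exec.Store[of "address IN (Reg 3)" "Mem (Reg 3)" s] Suc.prems by (simp add: address_def eval_nat_numeral)
  moreover have "exec (Assign 3 (Add (Reg 3) (Const 1))) ?s1 4 ?s2"
    using exec.Assign[of 3 "Add (Reg 3) (Const 1)" ?s1] Suc.prems by (simp add: eval_nat_numeral)
  ultimately have body: "exec ?body s (8 + acost (address IN (Reg 3))) ?s2"
    using exec.Seq[of _ s _ ?s1 _ 4 ?s2] by (fastforce simp: eval_nat_numeral)
  have "\<exists>t s'. exec copy_loop ?s2 t s' \<and> t \<le> copy_step * Suc (B - Suc i) \<and> fst s' = (fst ?s2)(3 := B) \<and>
     (\<forall>j. Suc i \<le> j \<and> j < B \<longrightarrow> snd s' (B + (arr_index IN + 16 * j)) = snd ?s2 j) \<and>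
     (\<forall>a. (\<forall>j. Suc i \<le> j \<and> j < B \<longrightarrow> a \<noteq> B + (arr_index IN + 16 * j)) \<longrightarrow> snd s' a = snd ?s2 a)"
    using Suc.hyps(2) Suc.prems lt by (intro Suc.hyps(1)) auto
  then obtain t s' where t: "exec copy_loop ?s2 t s'" "t \<le> copy_step * Suc (B - Suc i)" and f: "fst s' = (fst s)(3 := B)"
    and c: "\<And>j. Suc i \<le> j \<Longrightarrow> j < B \<Longrightarrow> snd s' (B + (arr_index IN + 16 * j)) = snd ?s2 j"
    and o: "\<And>a. (\<forall>j. Suc i \<le> j \<and> j < B \<longrightarrow> a \<noteq> B + (arr_index IN + 16 * j)) \<Longrightarrow> snd s' a = snd ?s2 a"
    by auto
  have "bval (Less (Reg 3) (Reg 1)) s" using Suc.prems lt by simp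
  from exec.WhileTrue[OF this body t(1)[unfolded copy_loop_def]]
  have run: "exec copy_loop s (12 + acost (address IN (Reg 3)) + t) s'" unfolding copy_loop_def by (simp add: eval_nat_numeral)
  have "Suc (B - i) = Suc (Suc (B - Suc i))" using lt by simp
  then have "12 + acost (address IN (Reg 3)) + t \<le> copy_step * Suc (B - i)" using t(2) by (simp add: copy_step_def)
  moreover have "snd s' (B + (arr_index IN + 16 * j)) = snd s j" if "i \<le> j" "j < B" for j
  proof (cases "j = i")
    case True
    then show ?thesis using o[of ?ad] by auto
  next
    case False
    then show ?thesis using c[of j] that by auto
  qed
  moreover have "snd s' a = snd s a" if "\<forall>j. i \<le> j \<and> j < B \<longrightarrow> a \<noteq> B + (arr_index IN + 16 * j)" for a
    using o[of a] that lt by auto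
  ultimately show ?case using run f by blast
qed

text \<open>The base address is \<open>2 * n + 2 * card E + 3\<close>, obtained from the header by
  additions. It is no smaller than the input length, as the degree sum is at most twice the number
  of edges.\<close>

definition sfvs_com :: com where
  "sfvs_com = Seq (Assign 1 (Add (Add (Mem (Const 0)) (Mem (Const 0))) (Add (Add (Mem (Const 1)) (Mem (Const 1))) (Const 3))))
     (Seq copy_loop (compile main_prog))"

context input_graph
begin

lemma length_encode: "length (encode_instance n E T k nbr) = 3 + 2 * n + degree_sum"
proof -
  have "sum_list (map (\<lambda>xs. Suc (length xs)) nbr) = (\<Sum>v<n. Suc (length (nbr ! v)))"
    using length_nbr by (simp add: sum_list_sum_nth atLeast0LessThan)
  also have "\<dots> = degree_sum + n" unfolding degree_sum_def Suc_eq_plus1 sum.distrib by simp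
  finally show ?thesis by (simp add: encode_instance_def length_concat comp_def)
qed

lemma sfvs_com_correct:
  "\<exists>t s. exec sfvs_com (initial_state (encode_instance n E T k nbr)) t s \<and>
     (accepts s \<longleftrightarrow> subset_FVS {0..<n} E T k) \<and>
     t \<le> 20 + copy_step * Suc (2 * n + 2 * card E + 3) + step_cost main_prog * Suc credits"
proof -
  let ?s0 = "initial_state (encode_instance n E T k nbr)"
  let ?B = "2 * n + 2 * card E + 3"
  have mem: "snd ?s0 = input_array" by (auto simp: initial_state_def input_array_def)
  have in1: "input_array 0 = n" "input_array 1 = card E"
    by (simp_all add: input_array_def encode_instance_def)
  let ?s1 = "((fst ?s0)(1 := ?B), snd ?s0)"
  let ?e = "Add (Add (Mem (Const 0)) (Mem (Const 0))) (Add (Add (Mem (Const 1)) (Mem (Const 1))) (Const 3))"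
  have e: "aval ?e ?s0 = ?B" by (simp only: aval.simps mem in1)
  have 1: "exec (Assign 1 ?e) ?s0 14 ?s1" using exec.Assign[of 1 ?e ?s0] unfolding e by (simp add: eval_nat_numeral)
  obtain t2 s2 where 2: "exec copy_loop ?s1 t2 s2" "t2 \<le> copy_step * Suc ?B" and f2: "fst s2 = (fst ?s1)(3 := ?B)"
    and c2: "\<And>j. j < ?B \<Longrightarrow> snd s2 (?B + (arr_index IN + 16 * j)) = input_array j"
    and o2: "\<And>a. (\<forall>j<?B. a \<noteq> ?B + (arr_index IN + 16 * j)) \<Longrightarrow> snd s2 a = input_array a"
  proof -
    have "fst ?s1 1 = ?B" "fst ?s1 3 = 0" by (simp_all add: initial_state_def)
    from copy_loop_correct[OF this le0] obtain t2 s2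
      where "exec copy_loop ?s1 t2 s2" "t2 \<le> copy_step * Suc (?B - 0)" "fst s2 = (fst ?s1)(3 := ?B)"
        "\<forall>j. 0 \<le> j \<and> j < ?B \<longrightarrow> snd s2 (?B + (arr_index IN + 16 * j)) = snd ?s1 j"
        "\<forall>a. (\<forall>j. 0 \<le> j \<and> j < ?B \<longrightarrow> a \<noteq> ?B + (arr_index IN + 16 * j)) \<longrightarrow> snd s2 a = snd ?s1 a" by blast
    then show ?thesis using that mem by (simp only: minus_nat.diff_0 le0 simp_thms snd_conv)
  qed
  \<comment> \<open>The input ends before \<open>?B\<close>, so apart from \<open>IN\<close> all
    arrays start out as zero, which supplies the empty lists, unset flags and zero counts.\<close>
  have zero: "input_array a = 0" if "?B \<le> a" for a
    using that length_encode degree_sum_le by (auto simp: input_array_def Let_def)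
  have "represents ?B (\<lambda>r. 0) (\<lambda>a i. if a = IN then input_array i else 0) s2"
    unfolding represents_def
  proof (intro conjI allI)
    show "fst s2 1 = ?B" using f2 by simp
    have "2 * reg_index r \<noteq> 1" "2 * reg_index r \<noteq> 3" for r by presburger+
    then show "fst s2 (2 * reg_index r) = 0" for r using f2 by (simp add: initial_state_def)
    show "snd s2 (?B + (arr_index a + 16 * i)) = (if a = IN then input_array i else 0)" for a i
    proof (cases "a = IN \<and> i < ?B")
      case True
      then show ?thesis using c2 by simp
    next
      case False
      have "?B + (arr_index a + 16 * i) \<noteq> ?B + (arr_index IN + 16 * j)" if "j < ?B" for j
        using False that unfolding array_address_eq_iff by auto
      then have "snd s2 (?B + (arr_index a + 16 * i)) = 0" using o2 zero by auto
      then show ?thesis using False zero by auto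
    qed
  qed
  moreover obtain t R A where t: "runs main_prog (\<lambda>r. 0) (\<lambda>a i. if a = IN then input_array i else 0) t R A" "t \<le> credits"
    and res: "R RES \<noteq> 0 \<longleftrightarrow> subset_FVS {0..<n} E T k"
    using wp_main_prog unfolding wp_def by blast
  ultimately obtain t3 s3 where 3: "exec (compile main_prog) s2 t3 s3" "represents ?B R A s3" "t3 \<le> step_cost main_prog * Suc t"
    using compile_correct by blast
  have "step_cost main_prog * Suc t \<le> step_cost main_prog * Suc credits" using t(2) by (intro mult_left_mono) auto
  then have "t3 \<le> step_cost main_prog * Suc credits" using 3(3) by (rule le_trans[rotated])
  then have time: "1 + 14 + (1 + t2 + t3) \<le> 20 + copy_step * Suc ?B + step_cost main_prog * Suc credits" using 2(2) by linarith
  have "fst s3 (2 * reg_index RES) = R RES" using 3(2) unfolding represents_def by blast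
  then have "accepts s3 \<longleftrightarrow> subset_FVS {0..<n} E T k" using res by (simp add: accepts_def reg_index_RES)
  moreover have "exec sfvs_com ?s0 (1 + 14 + (1 + t2 + t3)) s3"
    unfolding sfvs_com_def by (rule exec.Seq[OF 1 exec.Seq[OF 2(1) 3(1)]])
  ultimately show ?thesis using time by blast
qed

lemma time_bound:
  assumes "0 < n"
  shows "20 + copy_step * Suc (2 * n + 2 * card E + 3) + step_cost main_prog * Suc credits
    \<le> (20 + 6 * copy_step + 110 * step_cost main_prog) * (2 ^ k * (n + card E))"
proof -
  let ?N = "2 ^ k * (n + card E)"
  have p: "(1::nat) \<le> 2 ^ k" by simp
  have N: "n + card E \<le> ?N" using mult_right_mono[OF p, of "n + card E"] by simp
  have "Suc (2 * n + 2 * card E + 3) \<le> 6 * ?N" using assms N by linarith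
  then have 1: "copy_step * Suc (2 * n + 2 * card E + 3) \<le> copy_step * (6 * ?N)" by (rule mult_left_mono) simp
  have "(2 * 2 ^ k - 1) * Suc (47 * n + degree_sum) \<le> (2 * 2 ^ k) * (48 * (n + card E))"
    using assms degree_sum_le by (intro mult_mono) auto
  \<comment> \<open>The search accounts for 96 of the 110, and loading and ordering together with
    the successor for at most six more.\<close>
  then have "Suc credits \<le> 110 * ?N" using degree_sum_le N assms unfolding credits_def by linarith
  then have 2: "step_cost main_prog * Suc credits \<le> step_cost main_prog * (110 * ?N)" by (intro mult_left_mono) auto
  have "20 \<le> 20 * ?N" using N assms by simp
  then show ?thesis using 1 2 by (simp only: add_mult_distrib mult.assoc mult.left_commute[of _ 6] mult.left_commute[of _ 110])
qed

end

text \<open>For \<open>n = 0\<close> the time bound would be 0, whereas every run costs at least one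
  unit; the answer is correct in that case as well.\<close>

theorem theorem3:
  "\<exists>(P :: com) (c :: nat). \<forall>(n :: nat) (E :: nat set set) (T :: nat set) (k :: nat) (adj :: nat list list).
     chordal_graph {0..<n} E \<and> T \<subseteq> {0..<n} \<and> adjacency_lists n E adj \<longrightarrow>
     (\<exists>t s. exec P (initial_state (encode_instance n E T k adj)) t s \<and>
        (accepts s \<longleftrightarrow> subset_FVS {0..<n} E T k) \<and>
        (n > 0 \<longrightarrow> t \<le> c * (2 ^ k * (n + card E))))"
proof (rule exI[of _ sfvs_com], rule exI[of _ "20 + 6 * copy_step + 110 * step_cost main_prog"], intro allI impI)
  fix n k :: nat and E :: "nat set set" and T :: "nat set" and adj :: "nat list list"
  assume "chordal_graph {0..<n} E \<and> T \<subseteq> {0..<n} \<and> adjacency_lists n E adj"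
  then interpret input_graph n k E T adj by unfold_locales auto
  show "\<exists>t s. exec sfvs_com (initial_state (encode_instance n E T k adj)) t s \<and>
        (accepts s \<longleftrightarrow> subset_FVS {0..<n} E T k) \<and>
        (n > 0 \<longrightarrow> t \<le> (20 + 6 * copy_step + 110 * step_cost main_prog) * (2 ^ k * (n + card E)))"
    using sfvs_com_correct time_bound by (meson le_trans)
qed

end
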